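(* Let $R$ be a commutative local ring with $2\in R^\times$ and a non-trivial involution $\theta$, let $n\in\{3,4\}$ and $\delta\in\mathcal E(R,\theta)$. Then the prescription for $\Theta_\delta^{(n)}$ on the relative root elements $x_{\pm i}(\cdot)$, $1\le i\le 4$, given in the context, defines an automorphism $\Theta_\delta^{(n)}\in\operatorname{Aut}(E_{\mathrm{sc}}^{(n)})$. This automorphism fixes the center of $E_{\mathrm{sc}}^{(n)}$ pointwise. Hence, for every isogeny type $\pi$ ($\pi\in\{\mathrm{sc},\mathrm{mid},\mathrm{ad}\}$ if $n=3$, $\pi\in\{\mathrm{sc},\mathrm{ad}\}$ if $n=4$), it descends uniquely to an automorphism of $E_\pi^{(n)}$, denoted by the same symbol. Moreover, for all $\delta,\varepsilon\in\mathcal E(R,\theta)$: (a) $\Theta_\delta^{(n)}\circ\Theta_\varepsilon^{(n)}=\Theta_\varepsilon^{(n)}\circ\Theta_\delta^{(n)}=\Theta_{\delta+\varepsilon}^{(n)}$; (b) $\Theta_0^{(n)}=\mathrm{id}$; (c) $(\Theta_\delta^{(n)})^{-1}=\Theta_{-\delta}^{(n)}$. The same identities hold for the induced automorphisms of $E_\pi^{(n)}$.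
   Context: Notation. $J$ is the Jacobson radical of $R$; $\theta\colon r\mapsto\bar r$ is a ring automorphism with $\theta^2=\mathrm{id}$, $\theta\ne\mathrm{id}$. $R_\theta=\{r:\bar r=r\}$, $R_\theta^-=\{r:\bar r=-r\}$, $t^+=(t+\bar t)/2$, $m=n+1$. $E_{ij}$ are matrix units, $\bar A$ is entrywise application of $\theta$. $Q_4=E_{14}-E_{23}+E_{32}-E_{41}$, $Q_5=E_{15}-E_{24}+E_{33}-E_{42}+E_{51}$. $\mathcal E(R,\theta)=\{\delta\in J\cap R_\theta^-:\ \delta R_\theta^-=0,\ \delta(t^2-1)=0\ \text{for all } t\in R_\theta^\times\}$. Groups. $G_\pi(A_n,R)$ is the group of $R$-points of the Chevalley–Demazure group scheme of type $A_n$ of isogeny type $\pi$: $\mathrm{SL}_m$ (sc), $\mathrm{PGL}_m$ (ad), and $\mathrm{SL}_4/\mu_2$ (mid, $n=3$ only). $G_\pi^{(n)}$ is the fixed-point subgroup of the automorphism $\sigma$ of $G_\pi(A_n,R)$ induced by $A\mapsto Q_m(\bar A^t)^{-1}Q_m^{-1}$; so $G_{\mathrm{sc}}^{(n)}=\mathrm{SU}_m(R)=\{A\in\mathrm{SL}_m(R):AQ_m\bar A^t=Q_m\}$. Root elements. $n=3$ ($t\in R$, $s\in R_\theta$): $x_1(t)=I+tE_{12}+\bar tE_{34}$, $x_2(s)=I+sE_{23}$, $x_3(t)=I-tE_{13}+\bar tE_{24}$, $x_4(s)=I-sE_{14}$. $n=4$ ($t\in R$; $(t,u)\in\mathcal A(R)=\{(t,u)\in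 R^2:t\bar t=u+\bar u\}$): $x_1(t)=I+tE_{12}+\bar tE_{45}$, $x_4(t)=I+tE_{14}+\bar tE_{25}$, $x_2(t,u)=I+tE_{23}+\bar tE_{34}+uE_{24}$, $x_3(t,u)=I+tE_{13}-\bar tE_{35}-uE_{15}$. $x_{-i}(\cdot)$ is obtained from $x_i(\cdot)$ by replacing each $E_{jk}$ by $E_{kj}$. $E^{(n)}_{\mathrm{sc}}\subseteq\mathrm{SU}_m(R)$ is the subgroup generated by all $x_{\pm i}(\cdot)$, $1\le i\le 4$; $E_\pi^{(n)}$ is its natural image in $G_\pi^{(n)}$ (the projection $E_{\mathrm{sc}}^{(n)}\to E_\pi^{(n)}$ has central kernel). Prescription for $\Theta_\delta^{(n)}$ (with $p=t^+$). $n=3$: $x_1(t)\mapsto I+tE_{12}+\bar tE_{34}-p\delta(E_{13}+E_{24}+E_{31}+E_{42})-p^2\delta(E_{14}+E_{32})$; $x_{-1}(t)\mapsto I+tE_{21}+\bar tE_{43}+p\delta(E_{13}+E_{24}+E_{31}+E_{42})+p^2\delta(E_{23}+E_{41})$; $x_2(s)\mapsto(1+2s\delta)(E_{11}+E_{44})+(1+s\delta)(E_{22}+E_{33})+(s+s^2\delta)E_{23}$; $x_{-2}(s)\mapsto(1-2s\delta)(E_{11}+E_{44})+(1-s\delta)(E_{22}+E_{33})+(s-s^2\delta)E_{32}$; $\Theta_\delta^{(3)}(x_{\pm3}(t))=w_2\,\Theta_\delta^{(3)}(x_{\pm1}(t))\,w_2^{-1}$; $\Theta_\delta^{(3)}(x_{\pm4}(s))=w_1\,\Theta_\delta^{(3)}(x_{\pm2}(s))\,w_1^{-1}$,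 where $w_1=E_{12}-E_{21}+E_{34}-E_{43}$ and $w_2=E_{11}+E_{23}-E_{32}+E_{44}$. $n=4$: $x_{\pm1}(t)\mapsto\operatorname{diag}(1\pm p\delta,1\pm p\delta,1\mp p\delta,1\pm p\delta,1\pm p\delta)\,x_{\pm1}(t)$; $x_2(t,u)\mapsto x_2(t,u)-p\delta(E_{13}+E_{53}+E_{31}+E_{35})+p^2\delta(E_{14}+E_{54}+E_{21}+E_{25})$; $x_{-2}(t,u)\mapsto x_{-2}(t,u)+p\delta(E_{13}+E_{53}+E_{31}+E_{35})-p^2\delta(E_{12}+E_{52}+E_{41}+E_{45})$; $\Theta_\delta^{(4)}(x_{\pm3}(t,u))=w_1\,\Theta_\delta^{(4)}(x_{\pm2}(t,u))\,w_1^{-1}$; $\Theta_\delta^{(4)}(x_4(t))=v_2\,\Theta_\delta^{(4)}(x_1(2t))\,v_2^{-1}$; $\Theta_\delta^{(4)}(x_{-4}(t))=v_2\,\Theta_\delta^{(4)}(x_{-1}(t/2))\,v_2^{-1}$, where $w_1=E_{12}-E_{21}+E_{33}+E_{45}-E_{54}$ and $v_2=E_{11}+\tfrac12E_{24}-E_{33}+2E_{42}+E_{55}$. *)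

theory Defs
  imports
    "Jordan_Normal_Form.Determinant"
    "Jordan_Normal_Form.VS_Connect"
    "HOL-Algebra.QuotRing"
    "HOL-Algebra.Generated_Groups"
    "HOL-Algebra.Bij"
begin

section \<open>The ring with involution\<close>

definition jacobson_radical :: "'a::comm_ring_1 set" where
  "jacobson_radical = \<Inter> {M. maximalideal M (class_ring :: 'a ring)}"

definition sym_part :: "('a::comm_ring_1 \<Rightarrow> 'a) \<Rightarrow> 'a set" where
  "sym_part \<theta> = {r. \<theta> r = r}"

definition skew_part :: "('a::comm_ring_1 \<Rightarrow> 'a) \<Rightarrow> 'a set" where
  "skew_part \<theta> = {r. \<theta> r = - r}"

definition sym_units :: "('a::comm_ring_1 \<Rightarrow> 'a) \<Rightarrow> 'a set" where
  "sym_units \<theta> = {t \<in> sym_part \<theta>. \<exists>u \<in> sym_part \<theta>. t * u = 1}"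

abbreviation half :: "'a::comm_ring_1" where
  "half \<equiv> inv\<^bsub>class_ring\<^esub> 2"

definition plus_part :: "('a::comm_ring_1 \<Rightarrow> 'a) \<Rightarrow> 'a \<Rightarrow> 'a" where
  "plus_part \<theta> t = (t + \<theta> t) * half"

definition \<E> :: "('a::comm_ring_1 \<Rightarrow> 'a) \<Rightarrow> 'a set" where
  "\<E> \<theta> = {\<delta> \<in> jacobson_radical \<inter> skew_part \<theta>.
     (\<forall>r \<in> skew_part \<theta>. \<delta> * r = 0) \<and> (\<forall>t \<in> sym_units \<theta>. \<delta> * (t\<^sup>2 - 1) = 0)}"

definition \<A> :: "('a::comm_ring_1 \<Rightarrow> 'a) \<Rightarrow> ('a \<times> 'a) set" where
  "\<A> \<theta> = {(t, u). t * \<theta> t = u + \<theta> u}"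

section \<open>Matrix groups\<close>

text \<open>Matrix units with rows and columns numbered from 1, whereas matrix entries in
  the library are numbered from 0.\<close>

definition munit :: "nat \<Rightarrow> nat \<Rightarrow> nat \<Rightarrow> 'a::comm_ring_1 mat" where
  "munit m i j = Matrix.mat m m (\<lambda>(r, c). if Suc r = i \<and> Suc c = j then 1 else 0)"

abbreviation "E4 \<equiv> munit 4"
abbreviation "E5 \<equiv> munit 5"

definition GL :: "nat \<Rightarrow> 'a::comm_ring_1 mat monoid" where
  "GL m = units_of (ring_mat TYPE('a) m ())"

definition conj_by :: "nat \<Rightarrow> 'a::comm_ring_1 mat \<Rightarrow> 'a mat \<Rightarrow> 'a mat" where
  "conj_by m w A = w * A * inv\<^bsub>GL m\<^esub> w"

definition Q :: "nat \<Rightarrow> 'a::comm_ring_1 mat" where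
  "Q m = (if m = 4 then E4 1 4 - E4 2 3 + E4 3 2 - E4 4 1
          else E5 1 5 - E5 2 4 + E5 3 3 - E5 4 2 + E5 5 1)"

definition SU :: "('a::comm_ring_1 \<Rightarrow> 'a) \<Rightarrow> nat \<Rightarrow> 'a mat monoid" where
  "SU \<theta> m = (GL m)\<lparr>carrier :=
     {A \<in> carrier (GL m). det A = 1 \<and> A * Q m * transpose_mat (map_mat \<theta> A) = Q m}\<rparr>"

section \<open>Relative root elements\<close>

definition x3_1 :: "('a::comm_ring_1 \<Rightarrow> 'a) \<Rightarrow> 'a \<Rightarrow> 'a mat" where
  "x3_1 \<theta> t = 1\<^sub>m 4 + t \<cdot>\<^sub>m E4 1 2 + \<theta> t \<cdot>\<^sub>m E4 3 4"

definition x3_2 :: "'a::comm_ring_1 \<Rightarrow> 'a mat" where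
  "x3_2 s = 1\<^sub>m 4 + s \<cdot>\<^sub>m E4 2 3"

definition x3_3 :: "('a::comm_ring_1 \<Rightarrow> 'a) \<Rightarrow> 'a \<Rightarrow> 'a mat" where
  "x3_3 \<theta> t = 1\<^sub>m 4 - t \<cdot>\<^sub>m E4 1 3 + \<theta> t \<cdot>\<^sub>m E4 2 4"

definition x3_4 :: "'a::comm_ring_1 \<Rightarrow> 'a mat" where
  "x3_4 s = 1\<^sub>m 4 - s \<cdot>\<^sub>m E4 1 4"

definition x4_1 :: "('a::comm_ring_1 \<Rightarrow> 'a) \<Rightarrow> 'a \<Rightarrow> 'a mat" where
  "x4_1 \<theta> t = 1\<^sub>m 5 + t \<cdot>\<^sub>m E5 1 2 + \<theta> t \<cdot>\<^sub>m E5 4 5"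

definition x4_2 :: "('a::comm_ring_1 \<Rightarrow> 'a) \<Rightarrow> 'a \<Rightarrow> 'a \<Rightarrow> 'a mat" where
  "x4_2 \<theta> t u = 1\<^sub>m 5 + t \<cdot>\<^sub>m E5 2 3 + \<theta> t \<cdot>\<^sub>m E5 3 4 + u \<cdot>\<^sub>m E5 2 4"

definition x4_3 :: "('a::comm_ring_1 \<Rightarrow> 'a) \<Rightarrow> 'a \<Rightarrow> 'a \<Rightarrow> 'a mat" where
  "x4_3 \<theta> t u = 1\<^sub>m 5 + t \<cdot>\<^sub>m E5 1 3 - \<theta> t \<cdot>\<^sub>m E5 3 5 - u \<cdot>\<^sub>m E5 1 5"

definition x4_4 :: "('a::comm_ring_1 \<Rightarrow> 'a) \<Rightarrow> 'a \<Rightarrow> 'a mat" where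
  "x4_4 \<theta> t = 1\<^sub>m 5 + t \<cdot>\<^sub>m E5 1 4 + \<theta> t \<cdot>\<^sub>m E5 2 5"

text \<open>Replacing every $E_{jk}$ by $E_{kj}$ is transposition, so $x_{-i}(\cdot)$ is the
  transpose of $x_i(\cdot)$ throughout.\<close>

definition positive_root_elements :: "('a::comm_ring_1 \<Rightarrow> 'a) \<Rightarrow> nat \<Rightarrow> 'a mat set" where
  "positive_root_elements \<theta> n =
     (if n = 3
      then range (x3_1 \<theta>) \<union> x3_2 ` sym_part \<theta> \<union> range (x3_3 \<theta>) \<union> x3_4 ` sym_part \<theta>
      else range (x4_1 \<theta>) \<union> (\<lambda>(t, u). x4_2 \<theta> t u) ` \<A> \<theta>
           \<union> (\<lambda>(t, u). x4_3 \<theta> t u) ` \<A> \<theta> \<union> range (x4_4 \<theta>))"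

definition root_elements :: "('a::comm_ring_1 \<Rightarrow> 'a) \<Rightarrow> nat \<Rightarrow> 'a mat set" where
  "root_elements \<theta> n =
     positive_root_elements \<theta> n \<union> transpose_mat ` positive_root_elements \<theta> n"

definition E_sc :: "('a::comm_ring_1 \<Rightarrow> 'a) \<Rightarrow> nat \<Rightarrow> 'a mat monoid" where
  "E_sc \<theta> n = (SU \<theta> (n + 1))\<lparr>carrier := generate (SU \<theta> (n + 1)) (root_elements \<theta> n)\<rparr>"

section \<open>The other isogeny types\<close>

definition sigma :: "('a::comm_ring_1 \<Rightarrow> 'a) \<Rightarrow> nat \<Rightarrow> 'a mat \<Rightarrow> 'a mat" where
  "sigma \<theta> m A = conj_by m (Q m) (inv\<^bsub>GL m\<^esub> (transpose_mat (map_mat \<theta> A)))"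

text \<open>Adjoint type: since the Picard group of a local ring is trivial,
  $\mathrm{PGL}_m(R) = \mathrm{GL}_m(R)/R^\times$. The elements of the quotient are cosets, and the
  map induced by $\sigma$ sends a coset to its image under $\sigma$.\<close>

definition scalars_ad :: "nat \<Rightarrow> 'a::comm_ring_1 mat set" where
  "scalars_ad m = (\<lambda>c. c \<cdot>\<^sub>m 1\<^sub>m m) ` Units class_ring"

definition G_ad_A :: "nat \<Rightarrow> 'a::comm_ring_1 mat set monoid" where
  "G_ad_A m = GL m Mod scalars_ad m"

definition G_ad :: "('a::comm_ring_1 \<Rightarrow> 'a) \<Rightarrow> nat \<Rightarrow> 'a mat set monoid" where
  "G_ad \<theta> n = (G_ad_A (n + 1))\<lparr>carrier :=
     {X \<in> carrier (G_ad_A (n + 1)). sigma \<theta> (n + 1) ` X = X}\<rparr>"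

definition proj_ad :: "nat \<Rightarrow> 'a::comm_ring_1 mat \<Rightarrow> 'a mat set" where
  "proj_ad n A = scalars_ad (n + 1) #>\<^bsub>GL (n + 1)\<^esub> A"

definition E_ad :: "('a::comm_ring_1 \<Rightarrow> 'a) \<Rightarrow> nat \<Rightarrow> 'a mat set monoid" where
  "E_ad \<theta> n = (G_ad \<theta> n)\<lparr>carrier := proj_ad n ` carrier (E_sc \<theta> n)\<rparr>"

text \<open>Intermediate type: the $R$-points of $\mathrm{SL}_4/\mu_2$ are in general more than
  $\mathrm{SL}_4(R)/\mu_2(R)$. As a group scheme,
  $\mathrm{SL}_4/\mu_2 \cong \{(A,c) \in \mathrm{GL}_4 \times \mathbb{G}_m : \det A = c^2\}/\mathbb{G}_m$
  with $\lambda \in \mathbb{G}_m$ embedded as $(\lambda I, \lambda^2)$ and $A \in \mathrm{SL}_4$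
  mapping to the class of $(A,1)$. Over a local ring the $R$-points of this quotient by
  $\mathbb{G}_m$ are again the quotient of the groups of $R$-points. On the second component
  $\sigma$ acts by $c \mapsto \bar c^{-1}$.\<close>

definition cover_mid :: "('a::comm_ring_1 mat \<times> 'a) monoid" where
  "cover_mid = (GL 4 \<times>\<times> units_of class_ring)\<lparr>carrier :=
     {(A, c). A \<in> carrier (GL 4) \<and> c \<in> Units class_ring \<and> det A = c\<^sup>2}\<rparr>"

definition scalars_mid :: "('a::comm_ring_1 mat \<times> 'a) set" where
  "scalars_mid = (\<lambda>c. (c \<cdot>\<^sub>m 1\<^sub>m 4, c\<^sup>2)) ` Units class_ring"

definition G_mid_A :: "('a::comm_ring_1 mat \<times> 'a) set monoid" where
  "G_mid_A = cover_mid Mod scalars_mid"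

definition G_mid :: "('a::comm_ring_1 \<Rightarrow> 'a) \<Rightarrow> ('a mat \<times> 'a) set monoid" where
  "G_mid \<theta> = G_mid_A\<lparr>carrier :=
     {X \<in> carrier G_mid_A. (\<lambda>(A, c). (sigma \<theta> 4 A, inv\<^bsub>class_ring\<^esub> (\<theta> c))) ` X = X}\<rparr>"

definition proj_mid :: "'a::comm_ring_1 mat \<Rightarrow> ('a mat \<times> 'a) set" where
  "proj_mid A = scalars_mid #>\<^bsub>cover_mid\<^esub> (A, 1)"

definition E_mid :: "('a::comm_ring_1 \<Rightarrow> 'a) \<Rightarrow> ('a mat \<times> 'a) set monoid" where
  "E_mid \<theta> = (G_mid \<theta>)\<lparr>carrier := proj_mid ` carrier (E_sc \<theta> 3)\<rparr>"

section \<open>The prescription\<close>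

definition w1_3 :: "'a::comm_ring_1 mat" where
  "w1_3 = E4 1 2 - E4 2 1 + E4 3 4 - E4 4 3"

definition w2_3 :: "'a::comm_ring_1 mat" where
  "w2_3 = E4 1 1 + E4 2 3 - E4 3 2 + E4 4 4"

definition w1_4 :: "'a::comm_ring_1 mat" where
  "w1_4 = E5 1 2 - E5 2 1 + E5 3 3 + E5 4 5 - E5 5 4"

definition v2_4 :: "'a::comm_ring_1 mat" where
  "v2_4 = E5 1 1 + half \<cdot>\<^sub>m E5 2 4 - E5 3 3 + 2 \<cdot>\<^sub>m E5 4 2 + E5 5 5"

definition prescription3 ::
    "('a::comm_ring_1 \<Rightarrow> 'a) \<Rightarrow> 'a \<Rightarrow> ('a mat \<Rightarrow> 'a mat) \<Rightarrow> bool" where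
  "prescription3 \<theta> \<delta> f \<longleftrightarrow>
     (\<forall>t. let p = plus_part \<theta> t in
        f (x3_1 \<theta> t) = 1\<^sub>m 4 + t \<cdot>\<^sub>m E4 1 2 + \<theta> t \<cdot>\<^sub>m E4 3 4
          - p * \<delta> \<cdot>\<^sub>m (E4 1 3 + E4 2 4 + E4 3 1 + E4 4 2) - p\<^sup>2 * \<delta> \<cdot>\<^sub>m (E4 1 4 + E4 3 2) \<and>
        f (transpose_mat (x3_1 \<theta> t)) = 1\<^sub>m 4 + t \<cdot>\<^sub>m E4 2 1 + \<theta> t \<cdot>\<^sub>m E4 4 3
          + p * \<delta> \<cdot>\<^sub>m (E4 1 3 + E4 2 4 + E4 3 1 + E4 4 2) + p\<^sup>2 * \<delta> \<cdot>\<^sub>m (E4 2 3 + E4 4 1)) \<and>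
     (\<forall>s \<in> sym_part \<theta>.
        f (x3_2 s) = (1 + 2 * s * \<delta>) \<cdot>\<^sub>m (E4 1 1 + E4 4 4) + (1 + s * \<delta>) \<cdot>\<^sub>m (E4 2 2 + E4 3 3)
          + (s + s\<^sup>2 * \<delta>) \<cdot>\<^sub>m E4 2 3 \<and>
        f (transpose_mat (x3_2 s)) = (1 - 2 * s * \<delta>) \<cdot>\<^sub>m (E4 1 1 + E4 4 4)
          + (1 - s * \<delta>) \<cdot>\<^sub>m (E4 2 2 + E4 3 3) + (s - s\<^sup>2 * \<delta>) \<cdot>\<^sub>m E4 3 2) \<and>
     (\<forall>t. f (x3_3 \<theta> t) = conj_by 4 w2_3 (f (x3_1 \<theta> t)) \<and>
        f (transpose_mat (x3_3 \<theta> t)) = conj_by 4 w2_3 (f (transpose_mat (x3_1 \<theta> t)))) \<and>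
     (\<forall>s \<in> sym_part \<theta>. f (x3_4 s) = conj_by 4 w1_3 (f (x3_2 s)) \<and>
        f (transpose_mat (x3_4 s)) = conj_by 4 w1_3 (f (transpose_mat (x3_2 s))))"

definition prescription4 ::
    "('a::comm_ring_1 \<Rightarrow> 'a) \<Rightarrow> 'a \<Rightarrow> ('a mat \<Rightarrow> 'a mat) \<Rightarrow> bool" where
  "prescription4 \<theta> \<delta> f \<longleftrightarrow>
     (\<forall>t. let a = 1 + plus_part \<theta> t * \<delta>; b = 1 - plus_part \<theta> t * \<delta> in
        f (x4_1 \<theta> t) = mat_diag 5 ((!) [a, a, b, a, a]) * x4_1 \<theta> t \<and>
        f (transpose_mat (x4_1 \<theta> t)) =
          mat_diag 5 ((!) [b, b, a, b, b]) * transpose_mat (x4_1 \<theta> t)) \<and>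
     (\<forall>(t, u) \<in> \<A> \<theta>. let p = plus_part \<theta> t in
        f (x4_2 \<theta> t u) = x4_2 \<theta> t u
          - p * \<delta> \<cdot>\<^sub>m (E5 1 3 + E5 5 3 + E5 3 1 + E5 3 5)
          + p\<^sup>2 * \<delta> \<cdot>\<^sub>m (E5 1 4 + E5 5 4 + E5 2 1 + E5 2 5) \<and>
        f (transpose_mat (x4_2 \<theta> t u)) = transpose_mat (x4_2 \<theta> t u)
          + p * \<delta> \<cdot>\<^sub>m (E5 1 3 + E5 5 3 + E5 3 1 + E5 3 5)
          - p\<^sup>2 * \<delta> \<cdot>\<^sub>m (E5 1 2 + E5 5 2 + E5 4 1 + E5 4 5)) \<and>
     (\<forall>(t, u) \<in> \<A> \<theta>. f (x4_3 \<theta> t u) = conj_by 5 w1_4 (f (x4_2 \<theta> t u)) \<and>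
        f (transpose_mat (x4_3 \<theta> t u)) = conj_by 5 w1_4 (f (transpose_mat (x4_2 \<theta> t u)))) \<and>
     (\<forall>t. f (x4_4 \<theta> t) = conj_by 5 v2_4 (f (x4_1 \<theta> (2 * t))) \<and>
        f (transpose_mat (x4_4 \<theta> t)) = conj_by 5 v2_4 (f (transpose_mat (x4_1 \<theta> (t * half)))))"

definition prescription ::
    "('a::comm_ring_1 \<Rightarrow> 'a) \<Rightarrow> nat \<Rightarrow> 'a \<Rightarrow> ('a mat \<Rightarrow> 'a mat) \<Rightarrow> bool" where
  "prescription \<theta> n \<delta> f = (if n = 3 then prescription3 \<theta> \<delta> f else prescription4 \<theta> \<delta> f)"

text \<open>Meaningful only where a unique such automorphism exists.\<close>

definition Theta :: "('a::comm_ring_1 \<Rightarrow> 'a) \<Rightarrow> nat \<Rightarrow> 'a \<Rightarrow> 'a mat \<Rightarrow> 'a mat" where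
  "Theta \<theta> n \<delta> = (THE f. f \<in> auto (E_sc \<theta> n) \<and> prescription \<theta> n \<delta> f)"

section \<open>Centre, descent and the group law\<close>

definition centre :: "('g, 'b) monoid_scheme \<Rightarrow> 'g set" where
  "centre G = {z \<in> carrier G. \<forall>g \<in> carrier G. z \<otimes>\<^bsub>G\<^esub> g = g \<otimes>\<^bsub>G\<^esub> z}"

definition descends_to ::
    "'g monoid \<Rightarrow> 'h monoid \<Rightarrow> ('g \<Rightarrow> 'h) \<Rightarrow> ('g \<Rightarrow> 'g) \<Rightarrow> ('h \<Rightarrow> 'h) \<Rightarrow> bool" where
  "descends_to E F pr f g \<longleftrightarrow> g \<in> auto F \<and> (\<forall>x \<in> carrier E. g (pr x) = pr (f x))"

definition induced :: "'g monoid \<Rightarrow> 'h monoid \<Rightarrow> ('g \<Rightarrow> 'h) \<Rightarrow> ('g \<Rightarrow> 'g) \<Rightarrow> 'h \<Rightarrow> 'h" where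
  "induced E F pr f = (THE g. descends_to E F pr f g)"

definition additive_family :: "'h monoid \<Rightarrow> 'a::comm_ring_1 set \<Rightarrow> ('a \<Rightarrow> 'h \<Rightarrow> 'h) \<Rightarrow> bool" where
  "additive_family F D T \<longleftrightarrow>
     (\<forall>\<delta> \<in> D. \<forall>\<epsilon> \<in> D. T \<delta> \<otimes>\<^bsub>AutoGroup F\<^esub> T \<epsilon> = T (\<delta> + \<epsilon>) \<and>
                     T \<epsilon> \<otimes>\<^bsub>AutoGroup F\<^esub> T \<delta> = T (\<delta> + \<epsilon>)) \<and>
     T 0 = \<one>\<^bsub>AutoGroup F\<^esub> \<and>
     (\<forall>\<delta> \<in> D. inv\<^bsub>AutoGroup F\<^esub> (T \<delta>) = T (- \<delta>))"

end

theory Submission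
  imports Defs "HOL-Algebra.Ring_Divisibility"
begin

text \<open>The set $\mathcal{E}(R,\theta)$ is an ideal of square zero on which $\theta$ acts as $-1$; it is annihilated by $3$,
  by $x - \bar x$ and by $x^3 - x$ for every $x \in R$, so that only the reduction of a matrix to $\mathbb{F}_3$
  matters after multiplication by $\delta$. Hence $\Theta_\delta(A) = A + \delta X(A)$, where $X$ comes from a
  cocycle on $\mathrm{Sp}_4(3)$ or $\Omega_5(3)$. Instead of constructing this cocycle, one exhibits a polynomial $K$ whose
  failure to be invariant under $A$ determines $\delta X(A)$. The pairs $(A, B)$ such that $B - A$
  accounts for this failure form a group which contains $(x, \Theta_\delta(x))$ for every root element $x$, and in which
  $A$ determines $B$; so this group is the graph of a homomorphism. Adding up two such relations, for $\delta$
  and $\varepsilon$, gives the group law, and with it the inverse. Central elements are scalar, $K$ is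
  invariant under them, and therefore they are fixed, which yields the descent.\<close>

section \<open>Descent of automorphisms\<close>

text \<open>The element \<delta> behaves like sqrt(-3) in Z[omega]/3: its square is zero, it is
  killed by 3, and the involution negates it. A representation over Z[omega] that reduces to the
  natural module modulo sqrt(-3) therefore supplies, modulo 3, matrices A + sqrt(-3) X(A); this is
  where X comes from. The obstacle is well-definedness: the prescription lists values on generators,
  and there is no list of defining relations of the elementary group over R on which to test them.
  The graph replaces relations by two checks: every generator has its prescribed image, and no
  element has two. The cocycle attached to X is not a coboundary one can write down by matrices;
  inside the polynomial functions of test vectors it becomes the coboundary of K, and for each
  generator this is one polynomial identity modulo 3 and all x^3 - x. Uniqueness of images then
  means that the passage from matrices to functions is injective on the matrices that can occur,
  which is where unitarity and the determinant enter.\<close>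

lemma auto_mem: "f \<in> auto G \<Longrightarrow> x \<in> carrier G \<Longrightarrow> f x \<in> carrier G"
  by (auto simp: auto_def hom_def)

lemma auto_hom: "f \<in> auto G \<Longrightarrow> x \<in> carrier G \<Longrightarrow> y \<in> carrier G \<Longrightarrow>
    f (x \<otimes>\<^bsub>G\<^esub> y) = f x \<otimes>\<^bsub>G\<^esub> f y"
  by (auto simp: auto_def hom_def)

lemma auto_inj: "f \<in> auto G \<Longrightarrow> x \<in> carrier G \<Longrightarrow> y \<in> carrier G \<Longrightarrow> f x = f y \<Longrightarrow> x = y"
  by (auto simp: auto_def Bij_def bij_betw_def inj_on_def)

lemma auto_eqI:
  assumes "f \<in> auto G" "g \<in> auto G" "\<And>x. x \<in> carrier G \<Longrightarrow> f x = g x"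
  shows "f = g"
  using assms by (intro extensionalityI[of f "carrier G" g]) (auto simp: auto_def Bij_def)

lemma AutoGroup_mult:
  "f \<in> auto G \<Longrightarrow> g \<in> auto G \<Longrightarrow> f \<otimes>\<^bsub>AutoGroup G\<^esub> g = compose (carrier G) f g"
  by (simp add: AutoGroup_def BijGroup_def auto_def)

text \<open>Inverses come from the addition rule at -\<delta> and \<delta>; closure of
  \<open>D\<close> keeps all arguments where \<open>T\<close> is known to be an
  automorphism.\<close>

lemma additive_familyI:
  assumes "group F" and D: "0 \<in> D" "\<And>\<delta>. \<delta> \<in> D \<Longrightarrow> - \<delta> \<in> D"
      "\<And>\<delta> \<epsilon>. \<delta> \<in> D \<Longrightarrow> \<epsilon> \<in> D \<Longrightarrow> \<delta> + \<epsilon> \<in> D"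
    and T: "\<And>\<delta>. \<delta> \<in> D \<Longrightarrow> T \<delta> \<in> auto F"
    and add: "\<And>\<delta> \<epsilon> x. \<delta> \<in> D \<Longrightarrow> \<epsilon> \<in> D \<Longrightarrow> x \<in> carrier F \<Longrightarrow> T \<delta> (T \<epsilon> x) = T (\<delta> + \<epsilon>) x"
    and zero: "\<And>x. x \<in> carrier F \<Longrightarrow> T 0 x = x"
  shows "additive_family F D T"
proof -
  interpret A: group "AutoGroup F" by (rule group.AutoGroup[OF assms(1)])
  have carr: "carrier (AutoGroup F) = auto F" by (simp add: AutoGroup_def)
  have mult: "T \<delta> \<otimes>\<^bsub>AutoGroup F\<^esub> T \<epsilon> = T (\<delta> + \<epsilon>)" if "\<delta> \<in> D" "\<epsilon> \<in> D" for \<delta> \<epsilon>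
  proof (rule auto_eqI[of _ F])
    show "T \<delta> \<otimes>\<^bsub>AutoGroup F\<^esub> T \<epsilon> \<in> auto F"
      using A.m_closed that T carr by blast
    show "T (\<delta> + \<epsilon>) \<in> auto F" using that D T by blast
    fix x assume "x \<in> carrier F"
    then show "(T \<delta> \<otimes>\<^bsub>AutoGroup F\<^esub> T \<epsilon>) x = T (\<delta> + \<epsilon>) x"
      by (simp add: AutoGroup_mult T that compose_eq add)
  qed
  have one: "T 0 = \<one>\<^bsub>AutoGroup F\<^esub>"
  proof (rule auto_eqI[of _ F])
    show "T 0 \<in> auto F" using D T by blast
    show "\<one>\<^bsub>AutoGroup F\<^esub> \<in> auto F" using A.one_closed carr by blast
    fix x assume "x \<in> carrier F"
    then show "T 0 x = \<one>\<^bsub>AutoGroup F\<^esub> x" by (simp add: zero AutoGroup_def BijGroup_def)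
  qed
  have "inv\<^bsub>AutoGroup F\<^esub> (T \<delta>) = T (- \<delta>)" if "\<delta> \<in> D" for \<delta>
    using A.inv_equality[of "T (- \<delta>)" "T \<delta>"] mult[of "- \<delta>" \<delta>] that T D carr one by simp
  then show ?thesis
    unfolding additive_family_def using mult one by (metis add.commute)
qed

lemma descends_unique:
  assumes F: "carrier F = pr ` carrier E"
    and "descends_to E F pr f g" "descends_to E F pr f h"
  shows "g = h"
  using assms by (intro auto_eqI[of g F h]) (auto simp: descends_to_def)

text \<open>Because \<open>f\<close> fixes the kernel pointwise, it respects the fibres of
  \<open>pr\<close> in both directions. The descended map can then be evaluated on an arbitrarily
  chosen preimage.\<close>

lemma descends_ex:
  assumes "group E" "group F" and pr: "pr \<in> hom E F" and F: "carrier F = pr ` carrier E"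
    and f: "f \<in> auto E"
    and ker: "\<And>x. x \<in> carrier E \<Longrightarrow> pr x = \<one>\<^bsub>F\<^esub> \<Longrightarrow> f x = x"
  shows "\<exists>g. descends_to E F pr f g"
proof -
  interpret E: group E by fact
  interpret F: group F by fact
  interpret pr: group_hom E F pr using pr by unfold_locales
  have eq_iff: "pr x = pr y \<longleftrightarrow> pr (inv\<^bsub>E\<^esub> x \<otimes>\<^bsub>E\<^esub> y) = \<one>\<^bsub>F\<^esub>"
    if "x \<in> carrier E" "y \<in> carrier E" for x y
    using that F.inv_solve_left[of "\<one>\<^bsub>F\<^esub>" "pr x" "pr y"] by (auto simp: eq_commute)
  have split: "f y = f x \<otimes>\<^bsub>E\<^esub> f (inv\<^bsub>E\<^esub> x \<otimes>\<^bsub>E\<^esub> y)"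
    if "x \<in> carrier E" "y \<in> carrier E" for x y
    using that auto_hom[OF f, of x "inv\<^bsub>E\<^esub> x \<otimes>\<^bsub>E\<^esub> y"]
    by (simp add: E.m_assoc[symmetric])
  have iff: "pr (f x) = pr (f y) \<longleftrightarrow> pr x = pr y" if xy: "x \<in> carrier E" "y \<in> carrier E" for x y
  proof -
    define k where "k = inv\<^bsub>E\<^esub> x \<otimes>\<^bsub>E\<^esub> y"
    have k: "k \<in> carrier E" using xy by (simp add: k_def)
    have "pr (f x) = pr (f y) \<longleftrightarrow> pr (f k) = \<one>\<^bsub>F\<^esub>"
    proof -
      have "pr (f y) = pr (f x) \<otimes>\<^bsub>F\<^esub> pr (f k)"
        using split[OF xy] xy k auto_mem[OF f] by (simp add: k_def)
      then show ?thesis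
        using xy k auto_mem[OF f] by simp
    qed
    \<comment> \<open>If \<open>f k\<close> lies in the kernel, then \<open>f\<close> fixes it, and
      injectivity gives \<open>f k = k\<close>; so the kernel is reached only from itself.\<close>
    moreover have "pr (f k) = \<one>\<^bsub>F\<^esub> \<longleftrightarrow> pr k = \<one>\<^bsub>F\<^esub>"
      using ker k auto_mem[OF f] auto_inj[OF f] by metis
    ultimately show ?thesis using eq_iff[OF xy] k_def by simp
  qed
  define s where "s y = (SOME x. x \<in> carrier E \<and> pr x = y)" for y
  have s: "s y \<in> carrier E" "pr (s y) = y" if "y \<in> carrier F" for y
  proof -
    have "\<exists>x. x \<in> carrier E \<and> pr x = y" using that F by auto
    from someI_ex[OF this] show "s y \<in> carrier E" "pr (s y) = y" by (auto simp: s_def)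
  qed
  define g where "g = restrict (\<lambda>y. pr (f (s y))) (carrier F)"
  have g: "g (pr x) = pr (f x)" if "x \<in> carrier E" for x
    using that s[of "pr x"] iff[of "s (pr x)" x] by (simp add: g_def)
  have "g \<in> hom F F"
  proof (rule homI)
    fix u v assume "u \<in> carrier F" "v \<in> carrier F"
    then obtain x y where xy: "u = pr x" "v = pr y" "x \<in> carrier E" "y \<in> carrier E"
      using F by auto
    then show "g (u \<otimes>\<^bsub>F\<^esub> v) = g u \<otimes>\<^bsub>F\<^esub> g v"
      using g[of "x \<otimes>\<^bsub>E\<^esub> y"] g[of x] g[of y] auto_hom[OF f] auto_mem[OF f] by simp
  next
    fix u assume "u \<in> carrier F"
    then show "g u \<in> carrier F" using F g auto_mem[OF f] by auto
  qed
  moreover have "bij_betw g (carrier F) (carrier F)"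
  proof (rule bij_betw_imageI)
    show "inj_on g (carrier F)"
      using F g iff by (auto simp: inj_on_def)
    have "f ` carrier E = carrier E" using f by (auto simp: auto_def Bij_def bij_betw_def)
    then show "g ` carrier F = carrier F"
      unfolding F image_image using g by (metis (no_types, lifting) image_cong image_image)
  qed
  moreover have "g \<in> extensional (carrier F)" by (simp add: g_def)
  ultimately have "descends_to E F pr f g"
    using g by (simp add: descends_to_def auto_def Bij_def)
  then show ?thesis by blast
qed

section \<open>Automorphisms given by a functional relation\<close>

text \<open>Read \<open>Rel \<delta> A B\<close> as ``$B$ is the image of $A$ under the automorphism with
  parameter $\delta$''. Invertibility comes for free from \<open>Rel_add\<close>.\<close>

locale relation_family =
  fixes E :: "'g monoid" and D :: "'a::comm_ring_1 set" and Rel :: "'a \<Rightarrow> 'g \<Rightarrow> 'g \<Rightarrow> bool"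
    and gens :: "'g set" and pres :: "'a \<Rightarrow> ('g \<Rightarrow> 'g) \<Rightarrow> bool"
  assumes group_E: "group E"
    and D_zero: "0 \<in> D" and D_uminus: "\<And>\<delta>. \<delta> \<in> D \<Longrightarrow> - \<delta> \<in> D"
    and D_add: "\<And>\<delta> \<epsilon>. \<delta> \<in> D \<Longrightarrow> \<epsilon> \<in> D \<Longrightarrow> \<delta> + \<epsilon> \<in> D"
    and gens_carrier: "gens \<subseteq> carrier E"
    and generated: "carrier E = generate E gens"
    and Rel_carrier: "\<And>\<delta> A B. \<delta> \<in> D \<Longrightarrow> Rel \<delta> A B \<Longrightarrow> A \<in> carrier E \<and> B \<in> carrier E"
    and Rel_unique: "\<And>\<delta> A B B'. \<delta> \<in> D \<Longrightarrow> Rel \<delta> A B \<Longrightarrow> Rel \<delta> A B' \<Longrightarrow> B = B'"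
    and Rel_mult: "\<And>\<delta> A B A' B'. \<delta> \<in> D \<Longrightarrow> Rel \<delta> A B \<Longrightarrow> Rel \<delta> A' B' \<Longrightarrow>
      Rel \<delta> (A \<otimes>\<^bsub>E\<^esub> A') (B \<otimes>\<^bsub>E\<^esub> B')"
    and Rel_inv: "\<And>\<delta> A B. \<delta> \<in> D \<Longrightarrow> Rel \<delta> A B \<Longrightarrow> Rel \<delta> (inv\<^bsub>E\<^esub> A) (inv\<^bsub>E\<^esub> B)"
    and Rel_zero: "\<And>A. A \<in> carrier E \<Longrightarrow> Rel 0 A A"
    and Rel_add: "\<And>\<delta> \<epsilon> A B C. \<delta> \<in> D \<Longrightarrow> \<epsilon> \<in> D \<Longrightarrow> Rel \<epsilon> A B \<Longrightarrow> Rel \<delta> B C \<Longrightarrow>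
      Rel (\<delta> + \<epsilon>) A C"
    and Rel_gens: "\<And>\<delta> x. \<delta> \<in> D \<Longrightarrow> x \<in> gens \<Longrightarrow> \<exists>y. Rel \<delta> x y"
    and Rel_centre: "\<And>\<delta> z. \<delta> \<in> D \<Longrightarrow> z \<in> centre E \<Longrightarrow> Rel \<delta> z z"
    and pres_iff: "\<And>\<delta> f. \<delta> \<in> D \<Longrightarrow> pres \<delta> f \<longleftrightarrow> (\<forall>x \<in> gens. Rel \<delta> x (f x))"
begin

interpretation E: group E by (rule group_E)

text \<open>The elements that have an image form a subgroup containing the generators. The identity
  obtains its image from the rule for central elements.\<close>

lemma Rel_total:
  assumes "\<delta> \<in> D" "A \<in> carrier E"
  shows "\<exists>B. Rel \<delta> A B"
proof -
  have one: "Rel \<delta> \<one>\<^bsub>E\<^esub> \<one>\<^bsub>E\<^esub>"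
    using Rel_centre[OF assms(1)] by (simp add: centre_def)
  have "A \<in> generate E gens" using assms generated by simp
  then show ?thesis
    by (induction rule: generate.induct)
      (use assms(1) one Rel_gens Rel_inv Rel_mult in blast)+
qed

definition T :: "'a \<Rightarrow> 'g \<Rightarrow> 'g" where
  "T \<delta> = (\<lambda>A \<in> carrier E. THE B. Rel \<delta> A B)"

lemma T_eq: "\<delta> \<in> D \<Longrightarrow> Rel \<delta> A B \<Longrightarrow> T \<delta> A = B"
  using Rel_carrier Rel_unique unfolding T_def by (auto intro!: the_equality)

lemma Rel_T: "\<delta> \<in> D \<Longrightarrow> A \<in> carrier E \<Longrightarrow> Rel \<delta> A (T \<delta> A)"
  using Rel_total T_eq by metis

lemma T_carrier: "\<delta> \<in> D \<Longrightarrow> A \<in> carrier E \<Longrightarrow> T \<delta> A \<in> carrier E"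
  using Rel_T Rel_carrier by blast

lemma T_add: "\<delta> \<in> D \<Longrightarrow> \<epsilon> \<in> D \<Longrightarrow> A \<in> carrier E \<Longrightarrow> T \<delta> (T \<epsilon> A) = T (\<delta> + \<epsilon>) A"
  using Rel_add[OF _ _ Rel_T Rel_T] T_carrier D_add T_eq by metis

lemma T_zero: "A \<in> carrier E \<Longrightarrow> T 0 A = A"
  using T_eq Rel_zero D_zero by blast

lemma T_auto:
  assumes "\<delta> \<in> D" shows "T \<delta> \<in> auto E"
proof -
  have "T \<delta> \<in> hom E E"
  proof (rule homI)
    fix A B assume "A \<in> carrier E" "B \<in> carrier E"
    then show "T \<delta> (A \<otimes>\<^bsub>E\<^esub> B) = T \<delta> A \<otimes>\<^bsub>E\<^esub> T \<delta> B"
      by (intro T_eq Rel_mult Rel_T assms)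
  qed (rule T_carrier[OF assms])
  moreover have "bij_betw (T \<delta>) (carrier E) (carrier E)"
  proof (rule bij_betw_byWitness[where f' = "T (- \<delta>)"])
    show "\<forall>A\<in>carrier E. T (- \<delta>) (T \<delta> A) = A" "\<forall>A\<in>carrier E. T \<delta> (T (- \<delta>) A) = A"
      using T_add[of \<delta> "- \<delta>"] T_add[of "- \<delta>" \<delta>] D_uminus[OF assms] assms T_zero by simp_all
    show "T \<delta> ` carrier E \<subseteq> carrier E" "T (- \<delta>) ` carrier E \<subseteq> carrier E"
      using T_carrier D_uminus assms by blast+
  qed
  moreover have "T \<delta> \<in> extensional (carrier E)" by (simp add: T_def)
  ultimately show ?thesis by (simp add: auto_def Bij_def)
qed

lemma T_centre: "\<delta> \<in> D \<Longrightarrow> z \<in> centre E \<Longrightarrow> T \<delta> z = z"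
  using T_eq Rel_centre by blast

lemma pres_T: "\<delta> \<in> D \<Longrightarrow> pres \<delta> (T \<delta>)"
  using Rel_T gens_carrier by (auto simp: pres_iff)

text \<open>\<open>pres\<close> controls \<open>f\<close> on generators only; since
  \<open>Rel\<close> is closed under products and inverses, the whole graph of \<open>f\<close> lies
  in it, and there images are determined.\<close>

lemma auto_pres_unique:
  assumes \<delta>: "\<delta> \<in> D" and f: "f \<in> auto E" "pres \<delta> f"
  shows "f = T \<delta>"
proof (rule auto_eqI[OF f(1) T_auto[OF \<delta>]])
  interpret f: group_hom E E f using f(1) by unfold_locales (auto simp: auto_def)
  fix x assume "x \<in> carrier E"
  then have "x \<in> generate E gens" using generated by simp
  then have "Rel \<delta> x (f x)"
  proof (induction rule: generate.induct)
    case one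
    then show ?case using Rel_centre[OF \<delta>, of "\<one>\<^bsub>E\<^esub>"] by (simp add: centre_def)
  next
    case (incl h)
    then show ?case using f(2) pres_iff[OF \<delta>] by blast
  next
    case (inv h)
    then have "Rel \<delta> h (f h)" "h \<in> carrier E" using f(2) pres_iff[OF \<delta>] gens_carrier by auto
    then show ?case using Rel_inv[OF \<delta>] by simp
  next
    case (eng h1 h2)
    then show ?case using Rel_mult[OF \<delta>] Rel_carrier[OF \<delta>] by fastforce
  qed
  then show "f x = T \<delta> x" using T_eq[OF \<delta>] by simp
qed

lemma ex1_auto_pres: "\<delta> \<in> D \<Longrightarrow> \<exists>!f. f \<in> auto E \<and> pres \<delta> f"
  using T_auto pres_T auto_pres_unique by blast

lemma the_auto_pres: "\<delta> \<in> D \<Longrightarrow> (THE f. f \<in> auto E \<and> pres \<delta> f) = T \<delta>"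
  using T_auto pres_T auto_pres_unique by blast

lemma additive_family_T: "additive_family E D T"
  by (rule additive_familyI[OF group_E D_zero D_uminus D_add T_auto T_add T_zero])

text \<open>Quotients with central kernel: \<open>T_centre\<close> turns centrality into the
  pointwise fixing that descent asks for. Every isogeny type is an instance, the simply connected
  one with \<open>pr = id\<close>.\<close>

context
  fixes F :: "'h monoid" and pr :: "'g \<Rightarrow> 'h"
  assumes group_F: "group F" and pr: "pr \<in> hom E F" and F: "carrier F = pr ` carrier E"
    and ker: "\<And>x. x \<in> carrier E \<Longrightarrow> pr x = \<one>\<^bsub>F\<^esub> \<Longrightarrow> x \<in> centre E"
begin

lemma ex1_descends_T: "\<delta> \<in> D \<Longrightarrow> \<exists>!g. descends_to E F pr (T \<delta>) g"
  using descends_ex[OF group_E group_F pr F T_auto] ker T_centre descends_unique[OF F]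
  by metis

lemma descends_induced: "\<delta> \<in> D \<Longrightarrow> descends_to E F pr (T \<delta>) (induced E F pr (T \<delta>))"
  using ex1_descends_T unfolding induced_def by (rule theI')

lemma additive_family_induced: "additive_family F D (\<lambda>\<delta>. induced E F pr (T \<delta>))"
proof (rule additive_familyI[OF group_F D_zero D_uminus D_add])
  fix \<delta> \<epsilon> x assume "\<delta> \<in> D" "\<epsilon> \<in> D" "x \<in> carrier F"
  then show "induced E F pr (T \<delta>) (induced E F pr (T \<epsilon>) x) = induced E F pr (T (\<delta> + \<epsilon>)) x"
    using descends_induced[of \<delta>] descends_induced[of \<epsilon>] descends_induced[of "\<delta> + \<epsilon>"] F D_add
    by (auto simp: descends_to_def T_carrier T_add)
next
  fix x assume "x \<in> carrier F"
  then show "induced E F pr (T 0) x = x"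
    using descends_induced[OF D_zero] F by (auto simp: descends_to_def T_zero)
qed (use descends_induced in \<open>auto simp: descends_to_def\<close>)

end

end

section \<open>Local rings with involution\<close>

text \<open>Zorn's lemma for the ideals that contain \<open>x\<close>, with properness expressed by
  1 \<notin> I so that it passes to unions of chains.\<close>

lemma nonunit_in_maximalideal:
  fixes x :: "'a::comm_ring_1"
  assumes "\<not> x dvd 1"
  shows "\<exists>M. maximalideal M (class_ring :: 'a ring) \<and> x \<in> M"
proof -
  let ?R = "class_ring :: 'a ring"
  define A where "A = {I. ideal I ?R \<and> x \<in> I \<and> 1 \<notin> I}"
  have full: "I = UNIV" if "ideal I ?R" "1 \<in> I" for I
    using ideal.one_imp_carrier[OF that(1)] that(2) by simp
  have "ideal (PIdl\<^bsub>?R\<^esub> x) ?R" "x \<in> PIdl\<^bsub>?R\<^esub> x"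
    using cring.cgenideal_ideal[OF class_cring.cring_axioms,
        of x] ring.cgenideal_self[OF class_ring.ring_axioms, of x] by simp_all
  moreover have "1 \<notin> PIdl\<^bsub>?R\<^esub> x"
    using assms by (auto simp: cgenideal_def dvd_def mult.commute)
  ultimately have "A \<noteq> {}" by (auto simp: A_def)
  then have "\<exists>M\<in>A. \<forall>X\<in>A. M \<subseteq> X \<longrightarrow> X = M"
  proof (rule subset_Zorn_nonempty)
    fix C assume C: "C \<noteq> {}" "subset.chain A C"
    then have "subset.chain {I. ideal I ?R} C"
      by (auto simp: pred_on.chain_def A_def)
    from ring.chain_Union_is_ideal[OF class_ring.ring_axioms this] C show "\<Union> C \<in> A"
      by (auto simp: A_def pred_on.chain_def)
  qed
  then obtain M where M: "ideal M ?R" "x \<in> M" "1 \<notin> M"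
    and max: "\<And>X. ideal X ?R \<Longrightarrow> 1 \<notin> X \<Longrightarrow> M \<subseteq> X \<Longrightarrow> X = M"
    by (auto simp: A_def)
  have "maximalideal M ?R"
    by (rule maximalidealI[OF M(1)]) (use M max full in auto)
  with M show ?thesis by blast
qed

locale involution_ring =
  fixes \<theta> :: "'a::comm_ring_1 \<Rightarrow> 'a"
  assumes local_ring: "\<exists>!M. maximalideal M (class_ring :: 'a ring)"
    and two_unit: "(2::'a) \<in> Units class_ring"
    and automorphism: "\<theta> \<in> ring_iso class_ring class_ring"
    and involution: "\<theta> \<circ> \<theta> = id"
begin

lemma theta_add: "\<theta> (x + y) = \<theta> x + \<theta> y"
  and theta_mult: "\<theta> (x * y) = \<theta> x * \<theta> y"
  and theta_one: "\<theta> 1 = 1"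
  using automorphism by (auto simp: ring_iso_def Ring.ring_hom_def)

lemma theta_theta: "\<theta> (\<theta> x) = x"
  using involution by (metis comp_apply id_apply)

lemma theta_zero: "\<theta> 0 = 0"
  using theta_add[of 0 0] by simp

lemma theta_uminus: "\<theta> (- x) = - \<theta> x"
  using theta_add[of x "- x"] by (metis add.commute add.right_inverse eq_neg_iff_add_eq_0 theta_zero)

lemma theta_diff: "\<theta> (x - y) = \<theta> x - \<theta> y"
  using theta_add[of x "- y"] by (simp add: theta_uminus)

lemma theta_numeral: "\<theta> (numeral k) = numeral k"
proof -
  have "\<theta> (of_nat m) = of_nat m" for m
    by (induction m) (simp_all add: theta_zero theta_add theta_one)
  from this[of "numeral k"] show ?thesis by simp
qed

lemma theta_power: "\<theta> (x ^ k) = \<theta> x ^ k"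
  by (induction k) (simp_all add: theta_one theta_mult)

lemmas theta_simps = theta_add theta_mult theta_one theta_theta theta_zero theta_uminus
  theta_diff theta_numeral theta_power

lemma comm_ring_hom_theta: "comm_ring_hom \<theta>"
  by unfold_locales (simp_all add: theta_simps)

lemma two_half: "2 * half = (1::'a)"
  using monoid.Units_r_inv[OF class_semiring.monoid_axioms two_unit] by simp

lemma double_half: "x * half + x * half = (x::'a)"
proof -
  have "x * half + x * half = x * (2 * half)" by (simp only: mult_2 distrib_left)
  then show ?thesis by (simp only: two_half mult_1_right)
qed

lemma two_cancel:
  fixes x y :: 'a
  assumes "2 * x = 2 * y" shows "x = y"
proof -
  have "z = half * (2 * z)" for z :: 'a
    by (simp only: two_half mult.assoc[symmetric] mult.commute[of half 2] mult_1_left)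
  then show ?thesis using assms by metis
qed

lemma theta_half: "\<theta> half = half"
proof (rule two_cancel)
  have "2 * \<theta> half = \<theta> (2 * half)" by (simp only: theta_mult theta_numeral)
  then show "2 * \<theta> half = 2 * half" by (simp only: two_half theta_one)
qed

text \<open>Otherwise both elements lie in the unique maximal ideal, and so does their difference 1.
  It is through this dichotomy that locality enters the argument.\<close>

lemma unit_or_one_plus_unit:
  fixes x :: 'a
  assumes "\<not> x dvd 1" shows "1 + x dvd 1"
proof (rule ccontr)
  assume "\<not> 1 + x dvd 1"
  with assms obtain M where M: "maximalideal M (class_ring :: 'a ring)" "x \<in> M" "1 + x \<in> M"
    using nonunit_in_maximalideal local_ring by metis
  interpret maximalideal M "class_ring :: 'a ring" by (rule M)
  have "1 \<in> M"
    using a_closed[OF M(3) a_inv_closed[OF M(2)]] class_ring_simps by (simp add: class_ring_simps)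
  then show False using I_notcarr one_imp_carrier by simp
qed

text \<open>The inverse of a symmetric unit is symmetric by uniqueness of inverses, so invertibility
  may be tested in the whole ring.\<close>

lemma sym_unitsI:
  assumes "\<theta> s = s" "s dvd 1" shows "s \<in> sym_units \<theta>"
proof -
  obtain u where u: "s * u = 1" using assms(2) by (metis dvdE)
  have "s * \<theta> u = 1" using arg_cong[OF u, of \<theta>] by (simp add: theta_simps assms)
  then have "\<theta> u = u" using u by (metis mult.assoc mult.commute mult.right_neutral)
  then show ?thesis using u assms by (auto simp: sym_units_def sym_part_def)
qed

section \<open>The ideal \<E> and its annihilator\<close>

lemma EED:
  assumes "\<delta> \<in> \<E> \<theta>"
  shows EE_jac: "\<delta> \<in> jacobson_radical" and theta_EE: "\<theta> \<delta> = - \<delta>"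
    and EE_skew: "\<And>r. \<theta> r = - r \<Longrightarrow> \<delta> * r = 0"
    and EE_sym_unit: "\<And>s. \<theta> s = s \<Longrightarrow> s dvd 1 \<Longrightarrow> \<delta> * s\<^sup>2 = \<delta>"
  using assms sym_unitsI by (auto simp: \<E>_def skew_part_def right_diff_distrib)

text \<open>The difference of \<open>x\<close> and its conjugate is skew. Multiplication by \<delta>
  thus does not see the involution, and hermitian identities become bilinear ones.\<close>

lemma EE_mult_theta: "\<delta> \<in> \<E> \<theta> \<Longrightarrow> \<delta> * \<theta> x = \<delta> * x"
  using EE_skew[of \<delta> "x - \<theta> x"] by (simp add: theta_simps right_diff_distrib)

text \<open>Elements of \<E> are themselves skew, hence annihilated by all the others.\<close>

lemma EE_EE: "\<delta> \<in> \<E> \<theta> \<Longrightarrow> \<epsilon> \<in> \<E> \<theta> \<Longrightarrow> \<delta> * \<epsilon> = 0"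
  by (rule EE_skew) (simp_all add: theta_EE)

text \<open>For the symmetric unit 2 the condition on squares reads (4 - 1) \<delta> = 0.\<close>

lemma EE_three: "\<delta> \<in> \<E> \<theta> \<Longrightarrow> 3 * \<delta> = 0"
proof -
  assume \<delta>: "\<delta> \<in> \<E> \<theta>"
  have "(2::'a) dvd 1" using two_half by (metis dvd_triv_left)
  from EE_sym_unit[OF \<delta> _ this] have "\<delta> * 4 = \<delta>" by (simp add: theta_simps)
  moreover have "\<delta> * 4 = \<delta> + 3 * \<delta>"
    using distrib_left[of \<delta> 1 3] by (simp add: mult.commute)
  ultimately show ?thesis by simp
qed

lemma jacobson_mult:
  fixes \<delta> r :: 'a
  assumes "\<delta> \<in> jacobson_radical" shows "\<delta> * r \<in> jacobson_radical"
  using assms maximalideal.axioms(1) ideal.I_r_closed[of _ "class_ring :: 'a ring" \<delta> r]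
  by (fastforce simp: jacobson_radical_def)

lemma jacobson_add:
  fixes \<delta> \<epsilon> :: 'a
  assumes "\<delta> \<in> jacobson_radical" "\<epsilon> \<in> jacobson_radical" shows "\<delta> + \<epsilon> \<in> jacobson_radical"
  unfolding jacobson_radical_def
proof (rule InterI, elim CollectE)
  fix M assume M: "maximalideal M (class_ring :: 'a ring)"
  interpret maximalideal M "class_ring :: 'a ring" by (rule M)
  show "\<delta> + \<epsilon> \<in> M"
    using assms M a_closed[of \<delta> \<epsilon>] by (auto simp: jacobson_radical_def)
qed

lemma EE_mult:
  assumes "\<delta> \<in> \<E> \<theta>" shows "\<delta> * r \<in> \<E> \<theta>"
proof -
  have "\<delta> * r * s = 0" if "\<theta> s = - s" for s
    using EE_skew[OF assms that] by (metis mult.assoc mult.commute mult_zero_right)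
  moreover have "\<delta> * r * (t\<^sup>2 - 1) = 0" if "t \<in> sym_units \<theta>" for t
    using assms that by (auto simp: \<E>_def) (metis mult.assoc mult.commute mult_zero_right)
  moreover have "\<theta> (\<delta> * r) = - (\<delta> * r)"
    using EE_mult_theta[OF assms] theta_EE[OF assms] by (simp add: theta_mult)
  ultimately show ?thesis
    using jacobson_mult[OF EE_jac[OF assms]] by (simp add: \<E>_def skew_part_def)
qed

lemma EE_add: "\<delta> \<in> \<E> \<theta> \<Longrightarrow> \<epsilon> \<in> \<E> \<theta> \<Longrightarrow> \<delta> + \<epsilon> \<in> \<E> \<theta>"
  by (auto simp: \<E>_def skew_part_def jacobson_add theta_simps distrib_right)

lemma EE_mult_left: "\<delta> \<in> \<E> \<theta> \<Longrightarrow> r * \<delta> \<in> \<E> \<theta>"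
  using EE_mult by (simp add: mult.commute)

lemma EE_uminus: "\<delta> \<in> \<E> \<theta> \<Longrightarrow> - \<delta> \<in> \<E> \<theta>"
  using EE_mult[of \<delta> "- 1"] by simp

lemma EE_zero: "0 \<in> \<E> \<theta>"
proof -
  have "0 \<in> M" if "maximalideal M (class_ring :: 'a ring)" for M
    using that additive_subgroup.zero_closed[of M "class_ring :: 'a ring"]
    by (simp add: maximalideal_def ideal_def)
  then show ?thesis by (simp add: \<E>_def skew_part_def theta_zero jacobson_radical_def)
qed

lemma EE_sum: "(\<And>i. i \<in> I \<Longrightarrow> f i \<in> \<E> \<theta>) \<Longrightarrow> sum f I \<in> \<E> \<theta>"
  by (induction I rule: infinite_finite_induct) (auto simp: EE_zero EE_add)

lemma plus_part:
  assumes "\<delta> \<in> \<E> \<theta>" shows "\<delta> * plus_part \<theta> t = \<delta> * t"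
proof -
  have "\<delta> * plus_part \<theta> t = (\<delta> * t + \<delta> * \<theta> t) * half"
    by (simp only: plus_part_def distrib_left flip: mult.assoc)
  then show ?thesis by (simp only: EE_mult_theta[OF assms] distrib_right double_half)
qed

lemma theta_plus_part: "\<theta> (plus_part \<theta> t) = plus_part \<theta> t"
  by (simp add: plus_part_def theta_simps theta_half add.commute)

text \<open>The residue field has three elements unless $\delta = 0$.\<close>

lemma EE_cube: "\<delta> \<in> \<E> \<theta> \<Longrightarrow> \<delta> * t ^ 3 = \<delta> * t"
proof -
  assume \<delta>: "\<delta> \<in> \<E> \<theta>"
  \<comment> \<open>The condition defining \<E> speaks of symmetric units only; the symmetric part
    of \<open>t\<close> acts on \<delta> as \<open>t\<close> does.\<close>
  define s where "s = plus_part \<theta> t"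
  have s: "\<theta> s = s" by (simp add: s_def theta_plus_part)
  have "\<delta> * s ^ 3 = \<delta> * s"
  proof (cases "s dvd 1")
    case True
    have "\<delta> * s ^ 3 = \<delta> * s\<^sup>2 * s"
      by (simp add: power3_eq_cube power2_eq_square mult.assoc)
    then show ?thesis by (simp only: EE_sym_unit[OF \<delta> s True])
  next
    case False
    \<comment> \<open>As \<open>s\<close> and \<open>- s\<close> are non-units, both 1 + s and 1 - s
      are units. Their squares act as 1 on \<delta>, and the difference of these squares is 4
      s.\<close>
    then have "1 + s dvd 1" "1 - s dvd 1"
      using unit_or_one_plus_unit[of s] unit_or_one_plus_unit[of "- s"] by auto
    then have "\<delta> * (1 + s)\<^sup>2 = \<delta>" "\<delta> * (1 - s)\<^sup>2 = \<delta>"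
      using EE_sym_unit[OF \<delta>] s by (simp_all add: theta_simps)
    moreover have "\<delta> * (1 + s)\<^sup>2 - \<delta> * (1 - s)\<^sup>2 = 2 * (2 * (\<delta> * s))"
      by (simp add: power2_eq_square algebra_simps)
    ultimately have "2 * (2 * (\<delta> * s)) = 2 * (2 * 0)" by simp
    then have "\<delta> * s = 0" by (rule two_cancel[OF two_cancel])
    then show ?thesis by (metis mult.assoc mult_zero_left power3_eq_cube)
  qed
  moreover have eq: "\<delta> * s = \<delta> * t" using plus_part[OF \<delta>] by (simp add: s_def)
  moreover have "\<delta> * s ^ k = \<delta> * t ^ k" for k
  proof (induction k)
    case (Suc k)
    have "\<delta> * s ^ Suc k = (\<delta> * s) * s ^ k" by (simp add: mult.assoc)
    also have "\<dots> = t * (\<delta> * s ^ k)" by (simp only: eq mult_ac)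
    finally show ?case by (simp add: Suc mult_ac)
  qed simp
  ultimately show ?thesis by metis
qed

end

section \<open>Explicit matrices\<close>

lemma mat_eq_rows_list:
  "A \<in> carrier_mat m n \<Longrightarrow>
    A = mat_of_rows_list n (map (\<lambda>i. map (\<lambda>j. A $$ (i, j)) [0..<n]) [0..<m])"
  by (intro eq_matI) (auto simp: mat_of_rows_list_def)

lemma dim_mat_of_rows_list [simp]:
  "dim_row (mat_of_rows_list n rs) = length rs" "dim_col (mat_of_rows_list n rs) = n"
  by (simp_all add: mat_of_rows_list_def)

lemma index_mat_of_rows_list [simp]:
  "i < length rs \<Longrightarrow> j < n \<Longrightarrow> mat_of_rows_list n rs $$ (i, j) = rs ! i ! j"
  by (simp add: mat_of_rows_list_def)

lemma mat_of_rows_list_carrier [simp]: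
  "mat_of_rows_list n rs \<in> carrier_mat m k \<longleftrightarrow> length rs = m \<and> n = k"
  by auto

text \<open>Row lists serve as the normal form of explicit matrices: the simplifier multiplies them
  out, and matrix identities turn into lists of scalar identities.\<close>

lemma mult_mat_of_rows_list:
  fixes rs ss :: "'a::comm_ring_1 list list"
  assumes "length ss = k" "list_all (\<lambda>r. length r = k) rs"
  shows "mat_of_rows_list k rs * mat_of_rows_list n ss =
    mat_of_rows_list n (map (\<lambda>r. map (\<lambda>j. sum_list (map2 (\<lambda>a s. a * s ! j) r ss)) [0..<n]) rs)"
proof (rule eq_matI, goal_cases)
  case (1 i j)
  then have i: "i < length rs" and j: "j < n" by simp_all
  have l: "length (rs ! i) = k" using assms(2) i by (simp add: list_all_length)
  have "(mat_of_rows_list k rs * mat_of_rows_list n ss) $$ (i, j) =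
      (\<Sum>x = 0..<k. rs ! i ! x * ss ! x ! j)"
    using i j assms(1) by (simp add: scalar_prod_def)
  also have "\<dots> = sum_list (map2 (\<lambda>a s. a * s ! j) (rs ! i) ss)"
    using l assms(1) by (simp add: sum_list_sum_nth)
  finally show ?case using i j by simp
qed simp_all

lemma transpose_mat_of_rows_list:
  assumes "length rs = k"
  shows "transpose_mat (mat_of_rows_list n rs) =
    mat_of_rows_list k (map (\<lambda>j. map (\<lambda>r. r ! j) rs) [0..<n])"
  using assms by (intro eq_matI) auto

lemma map_mat_of_rows_list:
  assumes "list_all (\<lambda>r. length r = n) rs"
  shows "map_mat f (mat_of_rows_list n rs) = mat_of_rows_list n (map (map f) rs)"
  using assms by (intro eq_matI) (auto simp: list_all_length)

lemma minus_mat_of_rows_list: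
  assumes "length ss = length rs" "list_all (\<lambda>r. length r = n) rs" "list_all (\<lambda>r. length r = n) ss"
  shows "mat_of_rows_list n rs - mat_of_rows_list n ss =
    mat_of_rows_list n (map2 (map2 (-)) rs ss)"
  using assms by (intro eq_matI) (auto simp: list_all_length)

lemma smult_mat_of_rows_list:
  assumes "list_all (\<lambda>r. length r = n) rs"
  shows "c \<cdot>\<^sub>m mat_of_rows_list n rs = mat_of_rows_list n (map (map ((*) c)) rs)"
  using assms by (intro eq_matI) (auto simp: list_all_length)

lemma munit_carrier [simp]: "munit m i j \<in> carrier_mat m m"
  by (simp add: munit_def)

lemma munit_dim [simp]: "dim_row (munit m i j) = m" "dim_col (munit m i j) = m"
  by (simp_all add: munit_def)

lemma munit_index [simp]:
  "r < m \<Longrightarrow> c < m \<Longrightarrow> munit m i j $$ (r, c) = (if Suc r = i \<and> Suc c = j then 1 else 0)"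
  by (simp add: munit_def)

lemma upt_small: "[0..<4] = [0, 1, 2, 3]" "[0..<5] = [0, 1, 2, 3, 4]" "[0..<3] = [0, 1, 2]"
  by (simp_all add: upt_rec)

lemmas rows4 = mat_eq_rows_list[of _ 4 4]
lemmas rows5 = mat_eq_rows_list[of _ 5 5]

lemmas rows_eval = upt_small minus_carrier_mat

lemmas mat_eval = mult_mat_of_rows_list map_mat_of_rows_list minus_mat_of_rows_list
    smult_mat_of_rows_list upt_small
  transpose_mat_of_rows_list[where k = 4] transpose_mat_of_rows_list[where k = 5]

section \<open>Row lists of root elements, Weyl elements and forms\<close>

lemma x3_1_rows:
  "x3_1 \<theta> t = mat_of_rows_list 4
    [[1,t,0,0],[0,1,0,0],[0,0,1,\<theta> t],[0,0,0,1]]"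
  by (subst rows4) (simp_all add: x3_1_def rows_eval)

lemma x3_1_transpose_rows:
  "transpose_mat (x3_1 \<theta> t) = mat_of_rows_list 4
    [[1,0,0,0],[t,1,0,0],[0,0,1,0],[0,0,\<theta> t,1]]"
  by (simp add: x3_1_rows mat_eval)

lemma x3_2_rows:
  "x3_2 s = mat_of_rows_list 4
    [[1,0,0,0],[0,1,s,0],[0,0,1,0],[0,0,0,1]]"
  by (subst rows4) (simp_all add: x3_2_def rows_eval)

lemma x3_2_transpose_rows:
  "transpose_mat (x3_2 s) = mat_of_rows_list 4
    [[1,0,0,0],[0,1,0,0],[0,s,1,0],[0,0,0,1]]"
  by (simp add: x3_2_rows mat_eval)

lemma x3_3_rows:
  "x3_3 \<theta> t = mat_of_rows_list 4
    [[1,0,- t,0],[0,1,0,\<theta> t],[0,0,1,0],[0,0,0,1]]"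
  by (subst rows4) (simp_all add: x3_3_def rows_eval)

lemma x3_3_transpose_rows:
  "transpose_mat (x3_3 \<theta> t) = mat_of_rows_list 4
    [[1,0,0,0],[0,1,0,0],[- t,0,1,0],[0,\<theta> t,0,1]]"
  by (simp add: x3_3_rows mat_eval)

lemma x3_4_rows:
  "x3_4 s = mat_of_rows_list 4
    [[1,0,0,- s],[0,1,0,0],[0,0,1,0],[0,0,0,1]]"
  by (subst rows4) (simp_all add: x3_4_def rows_eval)

lemma x3_4_transpose_rows:
  "transpose_mat (x3_4 s) = mat_of_rows_list 4
    [[1,0,0,0],[0,1,0,0],[0,0,1,0],[- s,0,0,1]]"
  by (simp add: x3_4_rows mat_eval)

lemma x4_1_rows:
  "x4_1 \<theta> t = mat_of_rows_list 5
    [[1,t,0,0,0],[0,1,0,0,0],[0,0,1,0,0],[0,0,0,1,\<theta> t],[0,0,0,0,1]]"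
  by (subst rows5) (simp_all add: x4_1_def rows_eval)

lemma x4_1_transpose_rows:
  "transpose_mat (x4_1 \<theta> t) = mat_of_rows_list 5
    [[1,0,0,0,0],[t,1,0,0,0],[0,0,1,0,0],[0,0,0,1,0],[0,0,0,\<theta> t,1]]"
  by (simp add: x4_1_rows mat_eval)

lemma x4_2_rows:
  "x4_2 \<theta> t u = mat_of_rows_list 5
    [[1,0,0,0,0],[0,1,t,u,0],[0,0,1,\<theta> t,0],[0,0,0,1,0],[0,0,0,0,1]]"
  by (subst rows5) (simp_all add: x4_2_def rows_eval)

lemma x4_2_transpose_rows:
  "transpose_mat (x4_2 \<theta> t u) = mat_of_rows_list 5
    [[1,0,0,0,0],[0,1,0,0,0],[0,t,1,0,0],[0,u,\<theta> t,1,0],[0,0,0,0,1]]"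
  by (simp add: x4_2_rows mat_eval)

lemma x4_3_rows:
  "x4_3 \<theta> t u = mat_of_rows_list 5
    [[1,0,t,0,- u],[0,1,0,0,0],[0,0,1,0,- \<theta> t],[0,0,0,1,0],[0,0,0,0,1]]"
  by (subst rows5) (simp_all add: x4_3_def rows_eval)

lemma x4_3_transpose_rows:
  "transpose_mat (x4_3 \<theta> t u) = mat_of_rows_list 5
    [[1,0,0,0,0],[0,1,0,0,0],[t,0,1,0,0],[0,0,0,1,0],[- u,0,- \<theta> t,0,1]]"
  by (simp add: x4_3_rows mat_eval)

lemma x4_4_rows:
  "x4_4 \<theta> t = mat_of_rows_list 5
    [[1,0,0,t,0],[0,1,0,0,\<theta> t],[0,0,1,0,0],[0,0,0,1,0],[0,0,0,0,1]]"
  by (subst rows5) (simp_all add: x4_4_def rows_eval)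

lemma x4_4_transpose_rows:
  "transpose_mat (x4_4 \<theta> t) = mat_of_rows_list 5
    [[1,0,0,0,0],[0,1,0,0,0],[0,0,1,0,0],[t,0,0,1,0],[0,\<theta> t,0,0,1]]"
  by (simp add: x4_4_rows mat_eval)

lemma w1_3_rows:
  "w1_3  = mat_of_rows_list 4
    [[0,1,0,0],[-1,0,0,0],[0,0,0,1],[0,0,-1,0]]"
  by (subst rows4) (simp_all add: w1_3_def rows_eval)

lemma w2_3_rows:
  "w2_3  = mat_of_rows_list 4
    [[1,0,0,0],[0,0,1,0],[0,-1,0,0],[0,0,0,1]]"
  by (subst rows4) (simp_all add: w2_3_def rows_eval)

lemma w1_4_rows:
  "w1_4  = mat_of_rows_list 5
    [[0,1,0,0,0],[-1,0,0,0,0],[0,0,1,0,0],[0,0,0,0,1],[0,0,0,-1,0]]"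
  by (subst rows5) (simp_all add: w1_4_def rows_eval)

lemma v2_4_rows:
  "v2_4  = mat_of_rows_list 5
    [[1,0,0,0,0],[0,0,0,half,0],[0,0,-1,0,0],[0,2,0,0,0],[0,0,0,0,1]]"
  by (subst rows5) (simp_all add: v2_4_def rows_eval)

lemma Q4_rows:
  "Q 4 = mat_of_rows_list 4
    [[0,0,0,1],[0,0,-1,0],[0,1,0,0],[-1,0,0,0]]"
  by (subst rows4) (simp_all add: Q_def rows_eval)

lemma Q5_rows:
  "Q 5 = mat_of_rows_list 5
    [[0,0,0,0,1],[0,0,0,-1,0],[0,0,1,0,0],[0,-1,0,0,0],[1,0,0,0,0]]"
  by (subst rows5) (simp_all add: Q_def rows_eval)


lemmas root_rows = x3_1_rows x3_2_rows x3_3_rows x3_4_rows x4_1_rows x4_2_rows x4_3_rows x4_4_rows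
  x3_1_transpose_rows x3_2_transpose_rows x3_3_transpose_rows x3_4_transpose_rows
  x4_1_transpose_rows x4_2_transpose_rows x4_3_transpose_rows x4_4_transpose_rows

lemma one_mat4_rows: "1\<^sub>m 4 = mat_of_rows_list 4 [[1,0,0,0],[0,1,0,0],[0,0,1,0],[0,0,0,1]]"
  by (subst rows4[of "1\<^sub>m 4"]) (simp_all add: rows_eval)

lemma one_mat5_rows:
  "1\<^sub>m 5 = mat_of_rows_list 5 [[1,0,0,0,0],[0,1,0,0,0],[0,0,1,0,0],[0,0,0,1,0],[0,0,0,0,1]]"
  by (subst rows5[of "1\<^sub>m 5"]) (simp_all add: rows_eval)

lemmas one_mat_rows = one_mat4_rows one_mat5_rows

lemma mat_assoc:
  "dim_col A = dim_row B \<Longrightarrow> dim_col B = dim_row C \<Longrightarrow> A * B * C = A * (B * (C :: 'a::semiring_0 mat))"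
  by (rule assoc_mult_mat) auto

lemma mat_smult:
  fixes A B :: "'a::comm_ring_1 mat"
  assumes "dim_col A = dim_row B"
  shows "A * (k \<cdot>\<^sub>m B) = k \<cdot>\<^sub>m (A * B)" "k \<cdot>\<^sub>m A * B = k \<cdot>\<^sub>m (A * B)"
  by (rule mult_smult_distrib[of A "dim_row A" "dim_col A" B "dim_col B"]
      mult_smult_assoc_mat[of A "dim_row A" "dim_col A" B "dim_col B"]; use assms in auto)+

lemma smult_smult_mat: "k \<cdot>\<^sub>m (l \<cdot>\<^sub>m (A :: 'a::comm_ring_1 mat)) = (k * l) \<cdot>\<^sub>m A"
  by (rule eq_matI) (auto simp: mult.assoc)

lemma one_smult_mat: "1 \<cdot>\<^sub>m (A :: 'a::comm_ring_1 mat) = A"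
  by (rule eq_matI) auto

section \<open>The unitary groups\<close>

lemma group_GL: "group (GL m :: 'a::comm_ring_1 mat monoid)"
  unfolding GL_def by (rule monoid.units_group[OF ring.is_monoid[OF ring_mat]])

lemma GL_simps [simp]:
  "monoid.mult (GL m) = (*)" "\<one>\<^bsub>GL m\<^esub> = 1\<^sub>m m"
  by (simp_all add: GL_def units_of_mult units_of_one ring_mat_simps)

lemma GL_iff:
  "A \<in> carrier (GL m) \<longleftrightarrow>
    A \<in> carrier_mat m m \<and> (\<exists>B \<in> carrier_mat m m. B * A = 1\<^sub>m m \<and> A * B = 1\<^sub>m m)"
  by (simp add: GL_def units_of_carrier Units_def ring_mat_simps)

lemma GL_carrier: "A \<in> carrier (GL m) \<Longrightarrow> A \<in> carrier_mat m m"
  by (simp add: GL_iff)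

lemma GL_inv:
  assumes "A \<in> carrier (GL m)"
  shows "inv\<^bsub>GL m\<^esub> A \<in> carrier_mat m m" "inv\<^bsub>GL m\<^esub> A * A = 1\<^sub>m m" "A * inv\<^bsub>GL m\<^esub> A = 1\<^sub>m m"
  using GL_carrier[OF group.inv_closed[OF group_GL assms]]
    group.l_inv[OF group_GL assms] group.r_inv[OF group_GL assms] by simp_all

lemma det_one_GL:
  assumes "A \<in> carrier_mat m m" "det A = 1" shows "A \<in> carrier (GL m)"
  using assms adj_mat[OF assms(1)] by (auto simp: GL_iff intro!: bexI[of _ "adj_mat A"])

context involution_ring
begin

interpretation theta: comm_ring_hom \<theta> by (rule comm_ring_hom_theta)

lemma in_SU: "A \<in> carrier (SU \<theta> m) \<longleftrightarrow>
    A \<in> carrier_mat m m \<and> det A = 1 \<and> A * Q m * transpose_mat (map_mat \<theta> A) = Q m"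
  using det_one_GL GL_carrier by (auto simp: SU_def)

lemma subgroup_SU:
  assumes "m \<in> {4, 5}"
  shows "subgroup (carrier (SU \<theta> m)) (GL m)"
proof -
  interpret GL: group "GL m :: 'a mat monoid" by (rule group_GL)
  have Q: "(Q m :: 'a mat) \<in> carrier_mat m m"
    using assms by (auto simp: Q4_rows Q5_rows)
  show ?thesis
  proof (rule GL.subgroupI)
    show "carrier (SU \<theta> m) \<subseteq> carrier (GL m)" by (auto simp: SU_def)
    have "1\<^sub>m m \<in> carrier (SU \<theta> m)"
      using assms by (auto simp: in_SU theta.mat_hom_one Q4_rows Q5_rows)
    then show "carrier (SU \<theta> m) \<noteq> {}" by blast
  next
    fix A assume "A \<in> carrier (SU \<theta> m)"
    then have A: "A \<in> carrier_mat m m" "det A = 1" "A * Q m * transpose_mat (map_mat \<theta> A) = Q m"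
      by (auto simp: in_SU)
    define B where "B = inv\<^bsub>GL m\<^esub> A"
    have B: "B \<in> carrier_mat m m" "B * A = 1\<^sub>m m" "A * B = 1\<^sub>m m"
      using GL_inv[of A m] det_one_GL[OF A(1,2)] by (simp_all add: B_def)
    have "det B = 1"
      using det_mult[OF B(1) A(1)] A(2) B(2) by simp
    moreover have "transpose_mat (map_mat \<theta> A) * transpose_mat (map_mat \<theta> B) = 1\<^sub>m m"
    proof -
      have "transpose_mat (map_mat \<theta> A) * transpose_mat (map_mat \<theta> B)
          = transpose_mat (map_mat \<theta> (B * A))"
        using A B by (subst theta.mat_hom_mult[OF B(1) A(1)]) (simp add: transpose_mult[of _ m m _ m])
      then show ?thesis by (simp add: B theta.mat_hom_one)
    qed
    then have "B * Q m * transpose_mat (map_mat \<theta> B) = Q m"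
    proof -
      assume C: "transpose_mat (map_mat \<theta> A) * transpose_mat (map_mat \<theta> B) = 1\<^sub>m m"
      have "B * Q m * transpose_mat (map_mat \<theta> B)
          = B * (A * Q m * transpose_mat (map_mat \<theta> A)) * transpose_mat (map_mat \<theta> B)"
        by (simp only: A)
      also have "\<dots> = (B * A) * Q m * (transpose_mat (map_mat \<theta> A) * transpose_mat (map_mat \<theta> B))"
        using A(1) B(1) Q by (simp add: mat_assoc)
      finally show ?thesis using B Q C by simp
    qed
    ultimately show "inv\<^bsub>GL m\<^esub> A \<in> carrier (SU \<theta> m)"
      using B by (simp add: in_SU B_def)
  next
    fix A B assume "A \<in> carrier (SU \<theta> m)" "B \<in> carrier (SU \<theta> m)"
    then have A: "A \<in> carrier_mat m m" "det A = 1" "A * Q m * transpose_mat (map_mat \<theta> A) = Q m"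
      and B: "B \<in> carrier_mat m m" "det B = 1" "B * Q m * transpose_mat (map_mat \<theta> B) = Q m"
      by (auto simp: in_SU)
    have "A * B * Q m * transpose_mat (map_mat \<theta> (A * B))
       = A * (B * Q m * transpose_mat (map_mat \<theta> B)) * transpose_mat (map_mat \<theta> A)"
      using A(1) B(1) Q by (simp add: theta.mat_hom_mult transpose_mult[of _ m m _ m] mat_assoc)
    then show "A \<otimes>\<^bsub>GL m\<^esub> B \<in> carrier (SU \<theta> m)"
      using A B by (simp add: in_SU det_mult)
  qed
qed

lemma SU_simps: "monoid.mult (SU \<theta> m) = (*)" "\<one>\<^bsub>SU \<theta> m\<^esub> = 1\<^sub>m m"
  by (simp_all add: SU_def)

lemma group_SU: "m \<in> {4, 5} \<Longrightarrow> group (SU \<theta> m)"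
  using subgroup.subgroup_is_group[OF subgroup_SU group_GL, of m] by (simp add: SU_def)

text \<open>The defining equation exhibits a right inverse of \<open>A\<close>, namely
  \<open>Q m\<close> times the conjugate transpose times the inverse of \<open>Q m\<close>. It is
  also the left inverse, and this is the assertion rearranged.\<close>

lemma SU_transpose:
  assumes "A * Q m * transpose_mat (map_mat \<theta> A) = Q m" "A \<in> carrier_mat m m" "det A = 1"
    and m: "m \<in> {4, 5}"
  shows "transpose_mat (map_mat \<theta> A) * Q m * A = Q m"
proof -
  \<comment> \<open>\<open>Q 4\<close> squares to -1 and \<open>Q 5\<close> to 1, so the inverse of
    \<open>Q m\<close> is \<open>c\<close> times itself.\<close>
  define c :: 'a where "c = (if m = 4 then - 1 else 1)"
  define P where "P = c \<cdot>\<^sub>m (Q m :: 'a mat)"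
  have Q: "(Q m :: 'a mat) \<in> carrier_mat m m" and P: "P \<in> carrier_mat m m"
    and QP: "Q m * P = 1\<^sub>m m" "P * Q m = 1\<^sub>m m" and c: "c * c = 1"
    using m by (auto simp: P_def Q4_rows Q5_rows c_def one_mat_rows mat_eval)
  let ?A = "transpose_mat (map_mat \<theta> A)"
  obtain B where B: "B \<in> carrier_mat m m" "B * A = 1\<^sub>m m" "A * B = 1\<^sub>m m"
    using GL_inv[OF det_one_GL[OF assms(2,3)]] by blast
  have At: "?A \<in> carrier_mat m m" using assms(2) by simp
  have AX: "A * (Q m * ?A * P) = 1\<^sub>m m"
  proof -
    have "A * (Q m * ?A * P) = (A * Q m * ?A) * P"
      using assms(2) At Q P by (simp add: mat_assoc)
    then show ?thesis by (simp only: assms(1) QP)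
  qed
  have X: "Q m * ?A * P \<in> carrier_mat m m" using At Q P by (intro mult_carrier_mat)
  have "Q m * ?A * P = B * A * (Q m * ?A * P)" using X by (simp only: B(2) left_mult_one_mat)
  also have "\<dots> = B * (A * (Q m * ?A * P))" by (rule assoc_mult_mat[OF B(1) assms(2) X])
  also have "\<dots> = B" by (simp only: AX right_mult_one_mat[OF B(1)])
  finally have "P * (Q m * ?A * P * A) = P" using B P by simp
  moreover have "P * (Q m * ?A * P * A) = (P * Q m) * (?A * (P * A))"
    using assms(2) At Q P by (simp add: mat_assoc)
  ultimately have "?A * (P * A) = P" using QP At assms(2) P by simp
  then have "c \<cdot>\<^sub>m (?A * Q m * A) = c \<cdot>\<^sub>m Q m"
    using assms(2) At Q by (simp add: P_def mat_assoc mat_smult)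
  then have "c \<cdot>\<^sub>m (c \<cdot>\<^sub>m (?A * Q m * A)) = c \<cdot>\<^sub>m (c \<cdot>\<^sub>m Q m)" by (simp only:)
  then show ?thesis by (simp add: smult_smult_mat c one_smult_mat)
qed

section \<open>Matrices over the annihilated ideal\<close>

text \<open>Congruence modulo the annihilator of $\mathcal{E}(R,\theta)$: everything that is multiplied by
  an element of $\mathcal{E}(R,\theta)$ matters only up to this congruence.\<close>

definition cong :: "'a \<Rightarrow> 'a \<Rightarrow> bool" where
  "cong x y \<longleftrightarrow> (\<forall>e \<in> \<E> \<theta>. e * x = e * y)"

definition mcong :: "'a mat \<Rightarrow> 'a mat \<Rightarrow> bool" where
  "mcong X Y \<longleftrightarrow> dim_row X = dim_row Y \<and> dim_col X = dim_col Y \<and>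
     (\<forall>i < dim_row X. \<forall>j < dim_col X. cong (X $$ (i, j)) (Y $$ (i, j)))"

text \<open>The corrections B - A live here. Two of them multiply to zero, and congruent matrices
  act on them alike.\<close>

definition EM :: "nat \<Rightarrow> nat \<Rightarrow> 'a mat set" where
  "EM r c = {Z \<in> carrier_mat r c. \<forall>i<r. \<forall>j<c. Z $$ (i, j) \<in> \<E> \<theta>}"

lemma congD: "cong x y \<Longrightarrow> e \<in> \<E> \<theta> \<Longrightarrow> e * x = e * y"
  by (simp add: cong_def)

lemma cong_refl: "cong x x" by (simp add: cong_def)

lemma cong_sym: "cong x y \<Longrightarrow> cong y x" by (simp add: cong_def)

lemma cong_add: "cong x y \<Longrightarrow> cong x' y' \<Longrightarrow> cong (x + x') (y + y')"
  by (simp add: cong_def distrib_left)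

lemma cong_diff: "cong x y \<Longrightarrow> cong x' y' \<Longrightarrow> cong (x - x') (y - y')"
  by (simp add: cong_def right_diff_distrib)

lemma cong_uminus: "cong x y \<Longrightarrow> cong (- x) (- y)"
  by (simp add: cong_def)

text \<open>With \<open>e\<close> also \<open>e * x\<close> lies in \<E>, so the two factors can be
  exchanged one after the other.\<close>

lemma cong_mult: "cong x y \<Longrightarrow> cong x' y' \<Longrightarrow> cong (x * x') (y * y')"
  unfolding cong_def by (metis EE_mult mult.assoc)

lemma cong_power: "cong x y \<Longrightarrow> cong (x ^ k) (y ^ k)"
  by (induction k) (auto intro: cong_refl cong_mult)

lemma cong_sum: "(\<And>i. i \<in> I \<Longrightarrow> cong (f i) (g i)) \<Longrightarrow> cong (sum f I) (sum g I)"
  by (induction I rule: infinite_finite_induct) (auto intro: cong_refl cong_add)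

lemma cong_theta: "cong (\<theta> x) x"
  by (simp add: cong_def EE_mult_theta)

lemma cong_plus_part: "cong (plus_part \<theta> x) x"
  by (simp add: cong_def plus_part)

lemma cong_cube: "cong (x ^ 3) x"
  by (simp add: cong_def EE_cube)

lemma cong_three: "cong 3 0"
  using EE_three by (simp add: cong_def mult.commute)

lemma cong_EE: "x \<in> \<E> \<theta> \<Longrightarrow> cong x 0"
  by (simp add: cong_def EE_EE)

lemmas cong_intros = cong_refl cong_add cong_diff cong_uminus cong_mult cong_power

lemma mcong_refl: "mcong X X"
  by (simp add: mcong_def cong_refl)

lemma mcong_sym: "mcong X Y \<Longrightarrow> mcong Y X"
  by (auto simp: mcong_def intro: cong_sym)

lemma mcong_index: "mcong X Y \<Longrightarrow> X \<in> carrier_mat r c \<Longrightarrow> i < r \<Longrightarrow> j < c \<Longrightarrow>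
    cong (X $$ (i, j)) (Y $$ (i, j))"
  by (auto simp: mcong_def)

lemma mcong_mult:
  assumes "mcong X Y" "mcong X' Y'" "X \<in> carrier_mat r c" "X' \<in> carrier_mat c d"
  shows "mcong (X * X') (Y * Y')"
proof -
  have "Y \<in> carrier_mat r c" "Y' \<in> carrier_mat c d" using assms by (auto simp: mcong_def)
  then show ?thesis
    using assms by (auto simp: mcong_def scalar_prod_def intro!: cong_sum cong_mult)
qed

lemma mcong_transpose: "mcong X Y \<Longrightarrow> mcong (transpose_mat X) (transpose_mat Y)"
  by (auto simp: mcong_def)

lemma mcong_theta: "mcong (map_mat \<theta> X) X"
  by (auto simp: mcong_def cong_theta)

lemma EM_carrier: "Z \<in> EM r c \<Longrightarrow> Z \<in> carrier_mat r c"
  by (simp add: EM_def)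

lemma mcong_EM: "X - Y \<in> EM r c \<Longrightarrow> X \<in> carrier_mat r c \<Longrightarrow> Y \<in> carrier_mat r c \<Longrightarrow> mcong X Y"
  using cong_EE by (fastforce simp: EM_def mcong_def cong_def right_diff_distrib)

lemma EM_mult_right: "Z \<in> EM r c \<Longrightarrow> X \<in> carrier_mat c d \<Longrightarrow> Z * X \<in> EM r d"
  by (auto simp: EM_def scalar_prod_def intro!: EE_sum EE_mult)

lemma EM_mult_left: "X \<in> carrier_mat r c \<Longrightarrow> Z \<in> EM c d \<Longrightarrow> X * Z \<in> EM r d"
  by (auto simp: EM_def scalar_prod_def intro!: EE_sum EE_mult_left)

lemma EM_add: "Z \<in> EM r c \<Longrightarrow> Z' \<in> EM r c \<Longrightarrow> Z + Z' \<in> EM r c"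
  by (auto simp: EM_def EE_add)

lemma EM_uminus: "Z \<in> EM r c \<Longrightarrow> - Z \<in> EM r c"
  by (auto simp: EM_def EE_uminus)

lemma EM_zero: "0\<^sub>m r c \<in> EM r c"
  by (auto simp: EM_def EE_zero)

lemma EM_smult: "\<delta> \<in> \<E> \<theta> \<Longrightarrow> X \<in> carrier_mat r c \<Longrightarrow> \<delta> \<cdot>\<^sub>m X \<in> EM r c"
  by (auto simp: EM_def EE_mult)

lemma EM_transpose: "Z \<in> EM r c \<Longrightarrow> transpose_mat Z \<in> EM c r"
  by (auto simp: EM_def)

lemma mcong_mult_EM:
  assumes "mcong X Y" "X \<in> carrier_mat r c" "Z \<in> EM c d"
  shows "X * Z = Y * Z"
proof (rule eq_matI)
  have Y: "Y \<in> carrier_mat r c" using assms by (auto simp: mcong_def)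
  fix i j assume "i < dim_row (Y * Z)" "j < dim_col (Y * Z)"
  then have ij: "i < r" "j < d" using Y assms by (auto simp: EM_def)
  have "X $$ (i, k) * Z $$ (k, j) = Y $$ (i, k) * Z $$ (k, j)" if "k < c" for k
    using congD[OF mcong_index[OF assms(1,2) ij(1) that], of "Z $$ (k, j)"] assms(3) ij that
    by (simp add: EM_def mult.commute)
  then show "(X * Z) $$ (i, j) = (Y * Z) $$ (i, j)"
    using ij assms Y by (auto simp: EM_def scalar_prod_def)
qed (use assms in \<open>auto simp: mcong_def EM_def\<close>)

lemma EM_mult_mcong:
  assumes "mcong X Y" "X \<in> carrier_mat c d" "Z \<in> EM r c"
  shows "Z * X = Z * Y"
proof -
  have Y: "Y \<in> carrier_mat c d" using assms by (auto simp: mcong_def)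
  have "transpose_mat X * transpose_mat Z = transpose_mat Y * transpose_mat Z"
    using mcong_mult_EM[OF mcong_transpose[OF assms(1)], of d c "transpose_mat Z" r]
      assms EM_transpose by simp
  then have "transpose_mat (Z * X) = transpose_mat (Z * Y)"
    using assms Y by (simp add: transpose_mult[of _ r c _ d] EM_carrier)
  then show ?thesis by (metis transpose_transpose)
qed

text \<open>The form of \<open>Q m\<close> without conjugation. It is only applied to corrections or
  compared modulo the annihilator of \<E>, where conjugation is invisible, and being bilinear it
  keeps all later identities polynomial. Taking the size from \<open>p\<close> lets one definition
  serve both values of n.\<close>

definition gram :: "'a mat \<Rightarrow> 'a mat \<Rightarrow> 'a mat" where
  "gram p z = transpose_mat p * Q (dim_row p) * z"

lemma gram_carrier: "m \<in> {4, 5} \<Longrightarrow> p \<in> carrier_mat m k \<Longrightarrow> z \<in> carrier_mat m l \<Longrightarrow>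
    gram p z \<in> carrier_mat k l"
  by (auto simp: gram_def Q4_rows Q5_rows)

lemma gram_EM: "m \<in> {4, 5} \<Longrightarrow> p \<in> carrier_mat m k \<Longrightarrow> z \<in> EM m l \<Longrightarrow> gram p z \<in> EM k l"
  unfolding gram_def by (rule EM_mult_left) (auto simp: Q4_rows Q5_rows)

lemma gram_add:
  assumes "m \<in> {4, 5}" "p \<in> carrier_mat m k" "z \<in> carrier_mat m l" "z' \<in> carrier_mat m l"
  shows "gram p (z + z') = gram p z + gram p z'"
proof -
  have "transpose_mat p * Q m \<in> carrier_mat k m" using assms by (auto simp: Q4_rows Q5_rows)
  then show ?thesis using assms by (auto simp: gram_def mult_add_distrib_mat)
qed

text \<open>The entries of \<open>Q m * (A * z)\<close> lie in \<E>, so the transpose of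
  \<open>A\<close> in front of it may be conjugated; then unitarity in the form of
  \<open>SU_transpose\<close> applies.\<close>

lemma SU_gram_EM:
  assumes m: "m \<in> {4, 5}" and A: "A \<in> carrier (SU \<theta> m)"
    and p: "p \<in> carrier_mat m k" and z: "z \<in> EM m l"
  shows "gram (A * p) (A * z) = gram p z"
proof -
  have A': "A \<in> carrier_mat m m" "det A = 1" "A * Q m * transpose_mat (map_mat \<theta> A) = Q m"
    using A by (auto simp: in_SU)
  have Q: "(Q m :: 'a mat) \<in> carrier_mat m m" using m by (auto simp: Q4_rows Q5_rows)
  have zc: "z \<in> carrier_mat m l" using z by (rule EM_carrier)
  have "transpose_mat A * (Q m * (A * z)) = transpose_mat (map_mat \<theta> A) * (Q m * (A * z))"
    by (rule mcong_mult_EM[OF mcong_transpose[OF mcong_sym[OF mcong_theta]]])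
      (use A' Q z in \<open>auto intro!: EM_mult_left\<close>)
  also have "\<dots> = transpose_mat (map_mat \<theta> A) * Q m * A * z"
    using A' Q zc by (simp add: mat_assoc)
  also have "\<dots> = Q m * z" by (simp only: SU_transpose[OF A'(3,1,2) m])
  finally have *: "transpose_mat A * (Q m * (A * z)) = Q m * z" .
  have "gram (A * p) (A * z) = transpose_mat p * (transpose_mat A * (Q m * (A * z)))"
    using A' Q zc p by (simp add: gram_def mat_assoc transpose_mult[of _ m m _ k])
  then show ?thesis using Q zc p unfolding * by (simp add: gram_def mat_assoc)
qed

text \<open>Multiplying \<open>z\<close> by an element of \<E> reduces this congruence to the exact
  invariance on \<open>EM\<close>.\<close>

lemma SU_gram_mcong:
  assumes m: "m \<in> {4, 5}" and A: "A \<in> carrier (SU \<theta> m)"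
    and p: "p \<in> carrier_mat m k" and z: "z \<in> carrier_mat m l"
  shows "mcong (gram (A * p) (A * z)) (gram p z)"
proof -
  have A': "A \<in> carrier_mat m m" using A by (auto simp: in_SU)
  have G: "gram (A * p) (A * z) \<in> carrier_mat k l" "gram p z \<in> carrier_mat k l"
    using gram_carrier[OF m] A' p z by auto
  have Q: "(Q m :: 'a mat) \<in> carrier_mat m m" using m by (auto simp: Q4_rows Q5_rows)
  have s: "gram p (e \<cdot>\<^sub>m z) = e \<cdot>\<^sub>m gram p z" if "p \<in> carrier_mat m k" "z \<in> carrier_mat m l" for p z e
    using that Q by (simp add: gram_def mat_assoc mat_smult)
  have eq: "e \<cdot>\<^sub>m gram (A * p) (A * z) = e \<cdot>\<^sub>m gram p z" if "e \<in> \<E> \<theta>" for e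
    using SU_gram_EM[OF m A p EM_smult[OF that z]] s[OF p z] s[of "A * p" "A * z"] A' p z
    by (simp add: mat_smult)
  have "e * gram (A * p) (A * z) $$ (i, j) = e * gram p z $$ (i, j)"
    if "e \<in> \<E> \<theta>" "i < k" "j < l" for e i j
    using eq[OF that(1)] that(2,3) G by (metis carrier_matD index_smult_mat(1))
  then show ?thesis using G by (auto simp: mcong_def cong_def)
qed

end

lemma mat_add_mult:
  "dim_row A = dim_row B \<Longrightarrow> dim_col A = dim_col B \<Longrightarrow> dim_col A = dim_row C \<Longrightarrow>
    (A + B) * C = A * C + B * (C :: 'a::semiring_0 mat)"
  by (rule add_mult_distrib_mat) auto

section \<open>The elementary subgroup\<close>

lemma det_unitriangular4:
  "det (mat_of_rows_list 4 [[1,a,b,c],[0,1,d,e],[0,0,1,f],[0,0,0,1]]) = (1 :: 'a::comm_ring_1)"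
  by (subst det_upper_triangular[of _ 4])
    (auto simp: upper_triangular_def diag_mat_def upt_small less_Suc_eq numeral_eq_Suc)

lemma det_unitriangular5:
  "det (mat_of_rows_list 5 [[1,a,b,c,d],[0,1,e,f,g],[0,0,1,h,i],[0,0,0,1,j],[0,0,0,0,1]])
    = (1 :: 'a::comm_ring_1)"
  by (subst det_upper_triangular[of _ 5])
    (auto simp: upper_triangular_def diag_mat_def upt_small less_Suc_eq numeral_eq_Suc)

context involution_ring
begin

lemma root_SU3:
  "x3_1 \<theta> t \<in> carrier (SU \<theta> 4)" "transpose_mat (x3_1 \<theta> t) \<in> carrier (SU \<theta> 4)"
  "x3_3 \<theta> t \<in> carrier (SU \<theta> 4)" "transpose_mat (x3_3 \<theta> t) \<in> carrier (SU \<theta> 4)"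
  "s \<in> sym_part \<theta> \<Longrightarrow> x3_2 s \<in> carrier (SU \<theta> 4)"
  "s \<in> sym_part \<theta> \<Longrightarrow> transpose_mat (x3_2 s) \<in> carrier (SU \<theta> 4)"
  "s \<in> sym_part \<theta> \<Longrightarrow> x3_4 s \<in> carrier (SU \<theta> 4)"
  "s \<in> sym_part \<theta> \<Longrightarrow> transpose_mat (x3_4 s) \<in> carrier (SU \<theta> 4)"
  unfolding in_SU
  by (intro conjI; ((simp add: det_transpose[of _ 4] x3_1_rows x3_2_rows x3_3_rows x3_4_rows
      det_unitriangular4; fail) | simp add: root_rows Q4_rows mat_eval theta_simps sym_part_def))+

lemma root_SU4:
  "x4_1 \<theta> t \<in> carrier (SU \<theta> 5)" "transpose_mat (x4_1 \<theta> t) \<in> carrier (SU \<theta> 5)"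
  "x4_4 \<theta> t \<in> carrier (SU \<theta> 5)" "transpose_mat (x4_4 \<theta> t) \<in> carrier (SU \<theta> 5)"
  "(t, u) \<in> \<A> \<theta> \<Longrightarrow> x4_2 \<theta> t u \<in> carrier (SU \<theta> 5)"
  "(t, u) \<in> \<A> \<theta> \<Longrightarrow> transpose_mat (x4_2 \<theta> t u) \<in> carrier (SU \<theta> 5)"
  "(t, u) \<in> \<A> \<theta> \<Longrightarrow> x4_3 \<theta> t u \<in> carrier (SU \<theta> 5)"
  "(t, u) \<in> \<A> \<theta> \<Longrightarrow> transpose_mat (x4_3 \<theta> t u) \<in> carrier (SU \<theta> 5)"
  unfolding in_SU
  by (intro conjI; ((simp add: det_transpose[of _ 5] x4_1_rows x4_2_rows x4_3_rows x4_4_rows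
      det_unitriangular5; fail) | simp add: root_rows Q5_rows mat_eval theta_simps \<A>_def
          algebra_simps))+

lemma root_elements_SU: "n \<in> {3, 4} \<Longrightarrow> root_elements \<theta> n \<subseteq> carrier (SU \<theta> (n + 1))"
  using root_SU3 root_SU4 by (auto simp: root_elements_def positive_root_elements_def)

lemma SU_4_5: "n \<in> {3, 4} \<Longrightarrow> n + 1 \<in> {4, 5}" for n :: nat
  by auto

lemma subgroup_E: "n \<in> {3, 4} \<Longrightarrow> subgroup (carrier (E_sc \<theta> n)) (SU \<theta> (n + 1))"
  using group.generate_is_subgroup[OF group_SU[OF SU_4_5] root_elements_SU, of n]
  by (simp add: E_sc_def)

lemma E_simps [simp]: "monoid.mult (E_sc \<theta> n) = (*)" "\<one>\<^bsub>E_sc \<theta> n\<^esub> = 1\<^sub>m (n + 1)"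
  by (simp_all add: E_sc_def SU_simps)

lemma E_eq: "(SU \<theta> (n + 1))\<lparr>carrier := carrier (E_sc \<theta> n)\<rparr> = E_sc \<theta> n"
  by (simp add: E_sc_def)

lemma group_E: "n \<in> {3, 4} \<Longrightarrow> group (E_sc \<theta> n)"
  using subgroup.subgroup_is_group[OF subgroup_E group_SU[OF SU_4_5], of n] E_eq by metis

lemma E_generated:
  assumes "n \<in> {3, 4}"
  shows "carrier (E_sc \<theta> n) = generate (E_sc \<theta> n) (root_elements \<theta> n)"
proof -
  have "root_elements \<theta> n \<subseteq> carrier (E_sc \<theta> n)"
    by (auto simp: E_sc_def intro: generate.incl)
  from group.generate_consistent[OF group_SU[OF SU_4_5[OF assms]] this subgroup_E[OF assms]]
  show ?thesis by (simp add: E_eq) (simp add: E_sc_def)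
qed

lemma root_E: "x \<in> root_elements \<theta> n \<Longrightarrow> x \<in> carrier (E_sc \<theta> n)"
  by (auto simp: E_sc_def intro: generate.incl)

lemma E_SU: "n \<in> {3, 4} \<Longrightarrow> A \<in> carrier (E_sc \<theta> n) \<Longrightarrow> A \<in> carrier (SU \<theta> (n + 1))"
  using subgroup.subset[OF subgroup_E] by blast

lemma E_carrier: "n \<in> {3, 4} \<Longrightarrow> A \<in> carrier (E_sc \<theta> n) \<Longrightarrow> A \<in> carrier_mat (n + 1) (n + 1)"
  using E_SU by (auto simp: in_SU)

lemma E_mult: "n \<in> {3, 4} \<Longrightarrow> A \<in> carrier (E_sc \<theta> n) \<Longrightarrow> B \<in> carrier (E_sc \<theta> n) \<Longrightarrow>
    A * B \<in> carrier (E_sc \<theta> n)"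
  using monoid.m_closed[OF group.is_monoid[OF group_E]] by simp

lemma E_inv:
  assumes "n \<in> {3, 4}" "A \<in> carrier (E_sc \<theta> n)"
  shows "inv\<^bsub>E_sc \<theta> n\<^esub> A \<in> carrier (E_sc \<theta> n)"
    "inv\<^bsub>E_sc \<theta> n\<^esub> A * A = 1\<^sub>m (n + 1)" "A * inv\<^bsub>E_sc \<theta> n\<^esub> A = 1\<^sub>m (n + 1)"
  using group.inv_closed[OF group_E] group.l_inv[OF group_E] group.r_inv[OF group_E] assms
  by fastforce+

lemma E_inv_GL:
  assumes "n \<in> {3, 4}" "A \<in> carrier (E_sc \<theta> n)"
  shows "inv\<^bsub>GL (n + 1)\<^esub> A = inv\<^bsub>E_sc \<theta> n\<^esub> A"
proof (rule group.inv_equality[OF group_GL])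
  have "carrier (E_sc \<theta> n) \<subseteq> carrier (GL (n + 1))"
    using E_SU[OF assms(1)] by (auto simp: SU_def)
  then show "A \<in> carrier (GL (n + 1))" "inv\<^bsub>E_sc \<theta> n\<^esub> A \<in> carrier (GL (n + 1))"
    using assms E_inv(1)[OF assms] by auto
qed (use E_inv[OF assms] in simp)

lemma gram_mcong_EM:
  assumes m: "m \<in> {4, 5}" and pp: "mcong p p'" and p: "p \<in> carrier_mat m k" and z: "z \<in> EM m l"
  shows "gram p z = gram p' z"
proof -
  have Q: "(Q m :: 'a mat) \<in> carrier_mat m m" using m by (auto simp: Q4_rows Q5_rows)
  have t: "transpose_mat p \<in> carrier_mat k m" using p by simp
  have d: "dim_row p = m" "dim_row p' = m" using pp p by (auto simp: mcong_def)
  show ?thesis unfolding gram_def d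
    by (rule mcong_mult_EM[OF mcong_mult[OF mcong_transpose[OF pp] mcong_refl t Q]
          mult_carrier_mat[OF t Q] z])
qed

lemma gram_uminus:
  assumes "m \<in> {4, 5}" "p \<in> carrier_mat m k" "z \<in> carrier_mat m l"
  shows "gram p (- z) = - gram p z"
proof -
  have "transpose_mat p * Q m \<in> carrier_mat k m" using assms by (auto simp: Q4_rows Q5_rows)
  then show ?thesis using assms by (auto simp: gram_def uminus_mult_right_mat)
qed

end

text \<open>\<Psi> turns a correction Z into the function p |-> \<Psi> (gram p p) (gram p (Z p)),
  which is compared with the failure of \<open>K\<close> to be invariant. Linearity and
  \<open>Psi_cong\<close> make the comparison compatible with products, \<open>faithful\<close>
  makes images unique, \<open>K_scale\<close> and \<open>centre_scalar\<close> take care of the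
  centre. The columns of \<open>p\<close> are k test vectors: three for n = 3, one for n =
  4.\<close>

locale cocycle_data = involution_ring \<theta> for \<theta> :: "'a::comm_ring_1 \<Rightarrow> 'a" +
  fixes n k :: nat and K :: "'a mat \<Rightarrow> 'a" and \<Psi> :: "'a mat \<Rightarrow> 'a mat \<Rightarrow> 'a"
  assumes n: "n \<in> {3, 4}"
    and K_cong: "\<And>p p'. p \<in> carrier_mat (n + 1) k \<Longrightarrow> mcong p p' \<Longrightarrow> cong (K p) (K p')"
    and K_scale: "\<And>c p. p \<in> carrier_mat (n + 1) k \<Longrightarrow> cong (c * c) 1 \<Longrightarrow> cong (K (c \<cdot>\<^sub>m p)) (K p)"
    and Psi_add: "\<And>H N N'. N \<in> carrier_mat k k \<Longrightarrow> N' \<in> carrier_mat k k \<Longrightarrow>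
      \<Psi> H (N + N') = \<Psi> H N + \<Psi> H N'"
    and Psi_smult: "\<And>H N c. N \<in> carrier_mat k k \<Longrightarrow> \<Psi> H (c \<cdot>\<^sub>m N) = c * \<Psi> H N"
    and Psi_cong: "\<And>H H' N. H \<in> carrier_mat k k \<Longrightarrow> mcong H H' \<Longrightarrow> N \<in> EM k k \<Longrightarrow> \<Psi> H N = \<Psi> H' N"
    and faithful: "\<And>Z. Z \<in> EM (n + 1) (n + 1) \<Longrightarrow> 1\<^sub>m (n + 1) + Z \<in> carrier (SU \<theta> (n + 1)) \<Longrightarrow>
      (\<And>p. p \<in> carrier_mat (n + 1) k \<Longrightarrow> \<Psi> (gram p p) (gram p (Z * p)) = 0) \<Longrightarrow> Z = 0\<^sub>m (n + 1) (n + 1)"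
    and centre_scalar: "\<And>z. z \<in> centre (E_sc \<theta> n) \<Longrightarrow> \<exists>c. z = c \<cdot>\<^sub>m 1\<^sub>m (n + 1) \<and> c * \<theta> c = 1"
begin

abbreviation "m \<equiv> n + 1"
abbreviation "E \<equiv> E_sc \<theta> n"

lemmas EC = E_carrier[OF n]
lemmas m45 = SU_4_5[OF n]

lemma Psi_zero: "\<Psi> H (0\<^sub>m k k) = 0"
  using Psi_add[of "0\<^sub>m k k" "0\<^sub>m k k" H] by simp

lemma Psi_uminus:
  assumes N: "N \<in> carrier_mat k k" shows "\<Psi> H (- N) = - \<Psi> H N"
proof -
  have "\<Psi> H (N + - N) = \<Psi> H N + \<Psi> H (- N)" using Psi_add N by simp
  moreover have "N + - N = 0\<^sub>m k k" using N by (intro eq_matI) auto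
  ultimately show ?thesis using Psi_zero by (simp add: eq_neg_iff_add_eq_0 add.commute)
qed

text \<open>\<open>Rel \<delta> A B\<close> says that $B - A$ trivializes the failure of $\delta K$ to be invariant under $A$.\<close>

definition Rel :: "'a \<Rightarrow> 'a mat \<Rightarrow> 'a mat \<Rightarrow> bool" where
  "Rel \<delta> A B \<longleftrightarrow> A \<in> carrier E \<and> B \<in> carrier E \<and> B - A \<in> EM m m \<and>
     (\<forall>p \<in> carrier_mat m k. \<delta> * K (A * p) = \<delta> * K p + \<Psi> (gram p p) (gram (A * p) ((B - A) * p)))"

lemma RelD:
  assumes "Rel \<delta> A B"
  shows "A \<in> carrier E" "B \<in> carrier E" "B - A \<in> EM m m"
    and "\<And>p. p \<in> carrier_mat m k \<Longrightarrow>
      \<delta> * K (A * p) = \<delta> * K p + \<Psi> (gram p p) (gram (A * p) ((B - A) * p))"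
  using assms by (auto simp: Rel_def)

text \<open>Elements of the group preserve Gram matrices modulo the annihilator, and the first
  argument of \<Psi> matters only up to that. This is the equivariance behind the rules for products
  and inverses.\<close>

lemma Psi_gram:
  assumes "A \<in> carrier E" "p \<in> carrier_mat m k" "N \<in> EM k k"
  shows "\<Psi> (gram (A * p) (A * p)) N = \<Psi> (gram p p) N"
proof (rule Psi_cong)
  show "mcong (gram (A * p) (A * p)) (gram p p)"
    using SU_gram_mcong[OF m45 E_SU[OF n assms(1)] assms(2,2)] .
  show "gram (A * p) (A * p) \<in> carrier_mat k k"
    using EC[OF assms(1)] assms(2) by (intro gram_carrier[OF m45]) auto
qed (rule assms)

lemma Rel_mult:
  assumes 1: "Rel \<delta> A B" and 2: "Rel \<delta> A' B'"
  shows "Rel \<delta> (A * A') (B * B')"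
proof -
  note A = RelD(1)[OF 1] and B = RelD(2)[OF 1] and A' = RelD(1)[OF 2] and B' = RelD(2)[OF 2]
  note c = EC[OF A] EC[OF B] EC[OF A'] EC[OF B']
  define C C' where "C = B - A" and "C' = B' - A'"
  have C: "C \<in> EM m m" "C' \<in> EM m m" using RelD(3) 1 2 by (auto simp: C_def C'_def)
  note Cc = EM_carrier[OF C(1)] EM_carrier[OF C(2)]
  \<comment> \<open>\<open>C * C'\<close> vanishes, because its entries are sums of products of two
    elements of \<E>.\<close>
  have "C * B' = C * A'"
    by (rule EM_mult_mcong[OF mcong_EM]) (use C c C'_def in auto)
  moreover have "B * B' - A * A' = C * B' + A * C'"
    using c by (intro eq_matI)
      (auto simp: C_def C'_def minus_mult_distrib_mat[of _ m m] mult_minus_distrib_mat[of _ m m])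
  ultimately have D: "B * B' - A * A' = C * A' + A * C'" by simp
  have "B * B' - A * A' \<in> EM m m"
    unfolding D using C c by (intro EM_add EM_mult_right EM_mult_left)
  moreover have "\<delta> * K (A * A' * p) = \<delta> * K p +
      \<Psi> (gram p p) (gram (A * A' * p) ((B * B' - A * A') * p))" if p: "p \<in> carrier_mat m k" for p
  proof -
    define q where "q = A' * p"
    have q: "q \<in> carrier_mat m k" using c p by (simp add: q_def)
    have Aq: "A * A' * p = A * q" "A * q \<in> carrier_mat m k"
        using c p q by (simp_all add: q_def mat_assoc)
    have Cp: "C' * p \<in> EM m k" "C * q \<in> EM m k" "A * (C' * p) \<in> EM m k"
      using C p q c by (auto intro: EM_mult_right EM_mult_left)
    note Cpc = Cp[THEN EM_carrier]
    have "(B * B' - A * A') * p = C * q + A * (C' * p)"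
      unfolding D q_def using c p Cc by (simp add: add_mult_distrib_mat[of _ m m] mat_assoc)
    then have "gram (A * A' * p) ((B * B' - A * A') * p)
        = gram (A * q) (C * q) + gram (A * q) (A * (C' * p))"
      using gram_add[OF m45 Aq(2)] Cpc Aq by simp
    \<comment> \<open>The correction of the inner factor is moved past the isometry
      \<open>A\<close>; what remains is the term in the relation for \<open>A'\<close> at
      \<open>p\<close>.\<close>
    also have "gram (A * q) (A * (C' * p)) = gram q (C' * p)"
      by (rule SU_gram_EM[OF m45 E_SU[OF n A] q Cp(1)])
    finally have g: "gram (A * A' * p) ((B * B' - A * A') * p)
        = gram (A * q) (C * q) + gram q (C' * p)" .
    have G: "gram (A * q) (C * q) \<in> EM k k" "gram q (C' * p) \<in> EM k k"
      using gram_EM[OF m45] q Aq Cp by auto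
    have "\<Psi> (gram p p) (gram (A * A' * p) ((B * B' - A * A') * p))
        = \<Psi> (gram q q) (gram (A * q) (C * q)) + \<Psi> (gram p p) (gram q (C' * p))"
      unfolding g using Psi_add[OF G[THEN EM_carrier]] Psi_gram[OF A' p G(1)] by (simp add: q_def)
    then show ?thesis
      using RelD(4)[OF 1 q] RelD(4)[OF 2 p] Aq(1)
      by (simp add: C_def C'_def q_def)
  qed
  ultimately show ?thesis using A B A' B' E_mult[OF n] by (simp add: Rel_def)
qed

text \<open>In general B^-1 - A^-1 = - B^-1 (B - A) A^-1, and next to the correction B - A the
  inverse of \<open>B\<close> acts like that of \<open>A\<close>.\<close>

lemma inv_diff:
  assumes A: "A \<in> carrier E" and B: "B \<in> carrier E" and C: "B - A \<in> EM m m"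
  shows "inv\<^bsub>E\<^esub> B - inv\<^bsub>E\<^esub> A = - (inv\<^bsub>E\<^esub> A * ((B - A) * inv\<^bsub>E\<^esub> A))"
    and "inv\<^bsub>E\<^esub> B - inv\<^bsub>E\<^esub> A \<in> EM m m"
proof -
  define a b where "a = inv\<^bsub>E\<^esub> A" and "b = inv\<^bsub>E\<^esub> B"
  have a: "a \<in> carrier_mat m m" "a * A = 1\<^sub>m m" "A * a = 1\<^sub>m m"
    and b: "b \<in> carrier_mat m m" "b * B = 1\<^sub>m m" "B * b = 1\<^sub>m m"
    using E_inv[OF n A] E_inv[OF n B] EC by (simp_all add: a_def b_def)
  note c = EC[OF A] EC[OF B] a(1) b(1)
  note Cc = EM_carrier[OF C]
  have "b * ((B - A) * a) = b * (B * a - A * a)"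
    using c by (simp add: minus_mult_distrib_mat[of _ m m])
  also have "\<dots> = b * (B * a) - b * (A * a)"
    using c by (intro mult_minus_distrib_mat[of _ m m]) auto
  also have "\<dots> = a - b" using c a b by (simp flip: mat_assoc)
  finally have "b - a = - (b * ((B - A) * a))" using a(1) b(1) by (intro eq_matI) auto
  moreover have Ca: "(B - A) * a \<in> EM m m" by (rule EM_mult_right[OF C a(1)])
  ultimately show EM: "inv\<^bsub>E\<^esub> B - inv\<^bsub>E\<^esub> A \<in> EM m m"
    using EM_uminus[OF EM_mult_left[OF b(1) Ca]] by (simp add: a_def b_def)
  have "b * ((B - A) * a) = a * ((B - A) * a)"
    by (rule mcong_mult_EM[OF mcong_EM _ Ca]) (use EM a b in \<open>auto simp: a_def b_def\<close>)
  with \<open>b - a = - (b * ((B - A) * a))\<close>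
  show "inv\<^bsub>E\<^esub> B - inv\<^bsub>E\<^esub> A = - (inv\<^bsub>E\<^esub> A * ((B - A) * inv\<^bsub>E\<^esub> A))"
    by (simp add: a_def b_def)
qed

text \<open>The relation for \<open>A\<close> at the test vectors q = A^-1 p, read backwards, is the
  relation for the inverse at \<open>p\<close>.\<close>

lemma Rel_inv:
  assumes 1: "Rel \<delta> A B"
  shows "Rel \<delta> (inv\<^bsub>E\<^esub> A) (inv\<^bsub>E\<^esub> B)"
proof -
  note A = RelD(1)[OF 1] and B = RelD(2)[OF 1] and C = RelD(3)[OF 1]
  define a where "a = inv\<^bsub>E\<^esub> A"
  have a: "a \<in> carrier E" "a * A = 1\<^sub>m m" "A * a = 1\<^sub>m m"
    using E_inv[OF n A] by (simp_all add: a_def)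
  note c = EC[OF A] EC[OF B] EC[OF a(1)]
  have "\<delta> * K (a * p) = \<delta> * K p +
      \<Psi> (gram p p) (gram (a * p) ((inv\<^bsub>E\<^esub> B - a) * p))" if p: "p \<in> carrier_mat m k" for p
  proof -
    define q where "q = a * p"
    have q: "q \<in> carrier_mat m k" using c p by (simp add: q_def)
    have Aq: "A * q = p" using c p a by (simp add: q_def flip: mat_assoc)
    have Cq: "(B - A) * q \<in> EM m k" by (rule EM_mult_right[OF C q])
    have G: "gram p ((B - A) * q) \<in> EM k k" by (rule gram_EM[OF m45 p Cq])
    have "(inv\<^bsub>E\<^esub> B - a) * p = - (a * ((B - A) * a)) * p"
      using inv_diff(1)[OF A B C] by (simp add: a_def)
    also have "\<dots> = a * (- ((B - A) * q))"
      using c p EM_carrier[OF Cq] EM_carrier[OF C] q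
      by (simp add: q_def mat_assoc)
    finally have "gram (a * p) ((inv\<^bsub>E\<^esub> B - a) * p) = gram p (- ((B - A) * q))"
      using SU_gram_EM[OF m45 E_SU[OF n a(1)] p EM_uminus[OF Cq]] by simp
    also have "\<dots> = - gram p ((B - A) * q)"
      by (rule gram_uminus[OF m45 p EM_carrier[OF Cq]])
    finally have "\<Psi> (gram p p) (gram (a * p) ((inv\<^bsub>E\<^esub> B - a) * p))
        = - \<Psi> (gram p p) (gram p ((B - A) * q))"
      using Psi_uminus[OF EM_carrier[OF G]] by simp
    also have "\<Psi> (gram p p) (gram p ((B - A) * q)) = \<Psi> (gram q q) (gram p ((B - A) * q))"
      using Psi_gram[OF A q G] Aq by simp
    finally show ?thesis using RelD(4)[OF 1 q] Aq by (simp add: q_def)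
  qed
  then show ?thesis
    using a(1) E_inv(1)[OF n B] inv_diff(2)[OF A B C] by (simp add: Rel_def a_def)
qed

lemma Rel_refl:
  assumes "A \<in> carrier E" "\<And>p. p \<in> carrier_mat m k \<Longrightarrow> \<delta> * K (A * p) = \<delta> * K p"
  shows "Rel \<delta> A A"
proof -
  have 0: "A - A = 0\<^sub>m m m" using EC[OF assms(1)] by (intro eq_matI) auto
  have "gram (A * p) (0\<^sub>m m m * p) = 0\<^sub>m k k" if "p \<in> carrier_mat m k" for p
    using that EC[OF assms(1)] m45 by (auto simp: gram_def Q4_rows Q5_rows)
  then show ?thesis using assms Psi_zero by (simp add: Rel_def 0 EM_zero)
qed

lemma Rel_zero: "A \<in> carrier E \<Longrightarrow> Rel 0 A A"
  by (rule Rel_refl) simp_all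

lemma Rel_centre:
  assumes "\<delta> \<in> \<E> \<theta>" "z \<in> centre E" shows "Rel \<delta> z z"
proof -
  obtain c where z: "z = c \<cdot>\<^sub>m 1\<^sub>m m" and c: "c * \<theta> c = 1" using centre_scalar[OF assms(2)] by blast
  have "cong (c * c) (c * \<theta> c)" by (intro cong_mult cong_refl cong_sym[OF cong_theta])
  then have "cong (c * c) 1" by (simp add: c)
  moreover have "z * p = c \<cdot>\<^sub>m p" if "p \<in> carrier_mat m k" for p
    using that by (simp add: z mat_smult)
  ultimately show ?thesis
    using assms K_scale congD by (intro Rel_refl) (auto simp: centre_def)
qed

text \<open>Since \<open>A\<close> and \<open>B\<close> are congruent, \<open>B\<close> may be
  replaced by \<open>A\<close> in the second relation, both under \<open>K\<close> and in the Gram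
  matrix. The two relations then add up, with total correction C - A.\<close>

lemma Rel_add:
  assumes \<delta>: "\<delta> \<in> \<E> \<theta>" and \<epsilon>: "\<epsilon> \<in> \<E> \<theta>" and 1: "Rel \<epsilon> A B" and 2: "Rel \<delta> B C"
  shows "Rel (\<delta> + \<epsilon>) A C"
proof -
  note A = RelD(1)[OF 1] and B = RelD(2)[OF 1] and C = RelD(2)[OF 2]
  note X = RelD(3)[OF 1] and Y = RelD(3)[OF 2]
  note c = EC[OF A] EC[OF B] EC[OF C]
  have D: "C - A = (C - B) + (B - A)" using c by (intro eq_matI) auto
  have BA: "mcong B A" by (rule mcong_EM[OF X c(2,1)])
  have "(\<delta> + \<epsilon>) * K (A * p) = (\<delta> + \<epsilon>) * K p + \<Psi> (gram p p) (gram (A * p) ((C - A) * p))"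
    if p: "p \<in> carrier_mat m k" for p
  proof -
    have Ap: "A * p \<in> carrier_mat m k" "B * p \<in> carrier_mat m k" using c p by auto
    have BAp: "mcong (B * p) (A * p)" by (rule mcong_mult[OF BA mcong_refl c(2) p])
    have E: "(C - B) * p \<in> EM m k" "(B - A) * p \<in> EM m k"
      using EM_mult_right X Y p by auto
    have "\<delta> * K (B * p) = \<delta> * K (A * p)"
      by (rule congD[OF K_cong[OF Ap(2) BAp] \<delta>])
    moreover have "gram (B * p) ((C - B) * p) = gram (A * p) ((C - B) * p)"
      by (rule gram_mcong_EM[OF m45 BAp Ap(2) E(1)])
    moreover have "gram (A * p) ((C - A) * p) = gram (A * p) ((C - B) * p) + gram (A * p) ((B - A) * p)"
      unfolding D using c p gram_add[OF m45 Ap(1) EM_carrier[OF E(1)] EM_carrier[OF E(2)]]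
      by (simp add: mat_add_mult)
    moreover have "gram (A * p) ((C - B) * p) \<in> carrier_mat k k" "gram (A * p) ((B -
        A) * p) \<in> carrier_mat k k"
      using gram_carrier[OF m45 Ap(1) EM_carrier] E by auto
    ultimately show ?thesis
      using RelD(4)[OF 1 p] RelD(4)[OF 2 p] Psi_add by (simp add: distrib_right)
  qed
  moreover have "C - A \<in> EM m m" unfolding D by (rule EM_add[OF Y X])
  ultimately show ?thesis using A C by (simp add: Rel_def)
qed

text \<open>Subtracting the two relations eliminates \<open>K\<close>. The difference is moved to
  the identity as Z = (B' - B) B^-1, so that 1 + Z = B' B^-1 is unitary and \<open>faithful\<close>
  applies.\<close>

lemma Rel_unique:
  assumes 1: "Rel \<delta> A B" and 2: "Rel \<delta> A B'"
  shows "B = B'"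
proof -
  note A = RelD(1)[OF 1] and B = RelD(2)[OF 1] and B' = RelD(2)[OF 2]
  note X = RelD(3)[OF 1] and X' = RelD(3)[OF 2]
  define a b where "a = inv\<^bsub>E\<^esub> A" and "b = inv\<^bsub>E\<^esub> B"
  have a: "a \<in> carrier E" "A * a = 1\<^sub>m m" and b: "b \<in> carrier E" "b * B = 1\<^sub>m m" "B * b = 1\<^sub>m m"
    using E_inv[OF n A] E_inv[OF n B] by (simp_all add: a_def b_def)
  note c = EC[OF A] EC[OF B] EC[OF B'] EC[OF a(1)] EC[OF b(1)]
  have D: "B' - B = (B' - A) + - (B - A)" using c by (intro eq_matI) auto
  have DE: "B' - B \<in> EM m m" unfolding D by (rule EM_add[OF X' EM_uminus[OF X]])
  define Z where "Z = (B' - B) * b"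
  have Z: "Z \<in> EM m m" unfolding Z_def by (rule EM_mult_right[OF DE c(5)])
  \<comment> \<open>The inverses of \<open>A\<close> and \<open>B\<close> agree next to a
    correction. With \<open>a\<close> in place of \<open>b\<close>, Z p becomes (B' - B) q for the
    vectors q with A q = p at which the relations are read.\<close>
  have Za: "Z = (B' - B) * a" unfolding Z_def
    by (rule EM_mult_mcong[OF mcong_EM[OF _ c(5,4)] c(5) DE])
      (use inv_diff(2)[OF A B X] in \<open>simp add: a_def b_def\<close>)
  have "1\<^sub>m m + Z = B' * b"
    unfolding Z_def using c b by (intro eq_matI) (auto simp: minus_mult_distrib_mat[of _ m m])
  then have "1\<^sub>m m + Z \<in> carrier (SU \<theta> m)"
    using E_SU[OF n E_mult[OF n B' b(1)]] by simp
  moreover have "\<Psi> (gram p p) (gram p (Z * p)) = 0" if p: "p \<in> carrier_mat m k" for p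
  proof -
    define q where "q = a * p"
    have q: "q \<in> carrier_mat m k" using c p by (simp add: q_def)
    have Aq: "A * q = p" using c p a by (simp add: q_def flip: mat_assoc)
    have Zp: "Z * p = (B' - B) * q" unfolding Za q_def using c p by (simp add: mat_assoc)
    have E: "(B' - B) * q \<in> EM m k" "(B - A) * q \<in> EM m k"
      using EM_mult_right[OF _ q] DE X by auto
    have G: "gram p ((B' - B) * q) \<in> EM k k" "gram p ((B - A) * q) \<in> EM k k"
      using gram_EM[OF m45 p] E by auto
    have "B' - A = (B' - B) + (B - A)" using c by (intro eq_matI) auto
    then have "gram p ((B' - A) * q) = gram p ((B' - B) * q) + gram p ((B - A) * q)"
      using c q gram_add[OF m45 p EM_carrier[OF E(1)] EM_carrier[OF E(2)]]
      by (simp add: mat_add_mult)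
    then have "\<Psi> (gram q q) (gram p ((B' - B) * q)) = 0"
      using RelD(4)[OF 1 q] RelD(4)[OF 2 q] Aq Psi_add[OF G[THEN EM_carrier]] by simp
    then show ?thesis using Psi_gram[OF A q G(1)] Aq Zp by simp
  qed
  ultimately have "Z = 0\<^sub>m m m" by (rule faithful[OF Z])
  then have "(B' - B) * b * B = 0\<^sub>m m m" using c by (simp add: Z_def)
  moreover have "(B' - B) * b * B = B' - B" using c b by (simp add: mat_assoc)
  ultimately have "B' - B = 0\<^sub>m m m" by simp
  then have "(B' - B) $$ (i, j) = 0" if "i < m" "j < m" for i j using that by simp
  then show "B = B'" using c by (intro eq_matI) auto
qed

text \<open>With \<open>A'\<close> and \<open>X\<close> chosen polynomial in the parameter of a root
  element, both the conjugation and \<delta> disappear. A generator is then settled by a polynomial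
  congruence and by membership of its image in the elementary group.\<close>

lemma Rel_intro:
  assumes \<delta>: "\<delta> \<in> \<E> \<theta>" and A: "A \<in> carrier E" and B: "B \<in> carrier E"
    and D: "B - A = \<delta> \<cdot>\<^sub>m X" "X \<in> carrier_mat m m" and A': "mcong A A'"
    and K: "\<And>p. p \<in> carrier_mat m k \<Longrightarrow>
      cong (K (A' * p)) (K p + \<Psi> (gram p p) (gram (A' * p) (X * p)))"
  shows "Rel \<delta> A B"
proof -
  have c: "A \<in> carrier_mat m m" "A' \<in> carrier_mat m m" using EC[OF A] A' by (auto simp: mcong_def)
  have Q: "(Q m :: 'a mat) \<in> carrier_mat m m" using m45 by (auto simp: Q4_rows Q5_rows)
  have DE: "\<delta> \<cdot>\<^sub>m X \<in> EM m m" by (rule EM_smult[OF \<delta> D(2)])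
  have "\<delta> * K (A * p) = \<delta> * K p + \<Psi> (gram p p) (gram (A * p) (\<delta> \<cdot>\<^sub>m X * p))"
    if p: "p \<in> carrier_mat m k" for p
  proof -
    have Ap: "A * p \<in> carrier_mat m k" "A' * p \<in> carrier_mat m k" "X * p \<in> carrier_mat m k"
      using c D(2) p by auto
    have AA: "mcong (A * p) (A' * p)" by (rule mcong_mult[OF A' mcong_refl c(1) p])
    have E: "\<delta> \<cdot>\<^sub>m X * p \<in> EM m k" by (rule EM_mult_right[OF DE p])
    have "gram (A * p) (\<delta> \<cdot>\<^sub>m X * p) = gram (A' * p) (\<delta> \<cdot>\<^sub>m X * p)"
      by (rule gram_mcong_EM[OF m45 AA Ap(1) E])
    also have "\<dots> = \<delta> \<cdot>\<^sub>m gram (A' * p) (X * p)"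
      using Ap D(2) p Q c by (simp add: gram_def mat_assoc mat_smult)
    finally have "\<Psi> (gram p p) (gram (A * p) (\<delta> \<cdot>\<^sub>m X * p))
        = \<delta> * \<Psi> (gram p p) (gram (A' * p) (X * p))"
      using Psi_smult[OF gram_carrier[OF m45 Ap(2,3)]] by simp
    moreover have "\<delta> * K (A * p) = \<delta> * K (A' * p)"
      by (rule congD[OF K_cong[OF Ap(1) AA] \<delta>])
    moreover have "\<delta> * K (A' * p) = \<delta> * (K p + \<Psi> (gram p p) (gram (A' * p) (X * p)))"
      by (rule congD[OF K[OF p] \<delta>])
    ultimately show ?thesis by (simp add: distrib_left)
  qed
  then show ?thesis using A B D DE by (simp add: Rel_def)
qed

lemma conj_by_E:
  assumes w: "w \<in> carrier E" and "X * w = w * A" "X \<in> carrier_mat m m"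
  shows "conj_by m w A = X" "w * A * inv\<^bsub>E\<^esub> w = X"
proof -
  have i: "inv\<^bsub>GL m\<^esub> w = inv\<^bsub>E\<^esub> w" by (rule E_inv_GL[OF n w])
  have "w * A * inv\<^bsub>E\<^esub> w = X * (w * inv\<^bsub>E\<^esub> w)"
    using EC[OF w] EC[OF E_inv(1)[OF n w]] assms(3) by (simp add: mat_assoc flip: assms(2))
  then show "w * A * inv\<^bsub>E\<^esub> w = X" using E_inv(3)[OF n w] assms(3) by simp
  then show "conj_by m w A = X" unfolding conj_by_def i .
qed

text \<open>A Weyl element that is its own image transports relations from one root to another, in
  the same way as the prescription transports values.\<close>

lemma Rel_conj:
  assumes "Rel \<delta> w w" "Rel \<delta> A B" "A' * w = w * A" "A' \<in> carrier_mat m m"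
  shows "Rel \<delta> A' (conj_by m w B)"
proof -
  have w: "w \<in> carrier E" using assms(1) by (rule RelD)
  have i: "inv\<^bsub>GL m\<^esub> w = inv\<^bsub>E\<^esub> w" by (rule E_inv_GL[OF n w])
  show ?thesis
    using Rel_mult[OF Rel_mult[OF assms(1,2)] Rel_inv[OF assms(1)]] conj_by_E(2)[OF w assms(3,4)]
    unfolding conj_by_def i by simp
qed

lemma relation_familyI:
  assumes "\<And>\<delta> x. \<delta> \<in> \<E> \<theta> \<Longrightarrow> x \<in> root_elements \<theta> n \<Longrightarrow> \<exists>y. Rel \<delta> x y"
    and "\<And>\<delta> f. \<delta> \<in> \<E> \<theta> \<Longrightarrow> prescription \<theta> n \<delta> f \<longleftrightarrow> (\<forall>x \<in> root_elements \<theta> n. Rel \<delta> x (f x))"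
  shows "relation_family E (\<E> \<theta>) Rel (root_elements \<theta> n) (prescription \<theta> n)"
proof (rule relation_family.intro)
  show "group E" by (rule group_E[OF n])
  show "carrier E = generate E (root_elements \<theta> n)" by (rule E_generated[OF n])
  show "root_elements \<theta> n \<subseteq> carrier E" using root_E by blast
  show "A \<in> carrier E \<and> B \<in> carrier E" if "Rel \<delta> A B" for \<delta> A B using RelD(1,2)[OF that] by blast
  show "Rel \<delta> (A \<otimes>\<^bsub>E\<^esub> A') (B \<otimes>\<^bsub>E\<^esub> B')" if "Rel \<delta> A B" "Rel \<delta> A' B'" for \<delta> A B A' B'
    using Rel_mult[OF that] by simp
  show "B = B'" if "Rel \<delta> A B" "Rel \<delta> A B'" for \<delta> A B B' by (rule Rel_unique[OF that])
qed (rule EE_zero EE_uminus EE_add Rel_inv Rel_zero Rel_add Rel_centre assms; assumption)+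

end

section \<open>The case $n = 3$\<close>

text \<open>The group reduces to $\mathrm{Sp}_4(3)$. Its four-dimensional Weil representation over $\mathbb{Z}[\omega]$
  permutes, up to scalars, certain lifts $v + \sqrt{-3} f(v)$ of the vectors $v \in \mathbb{F}_3^4$, and the
  bivector $v \wedge f(v)$ turns out to be a polynomial of degree four in $v$. The function \<open>k3\<close> evaluates
  this bivector on $u$ and $w$ by means of the symplectic form; \<open>k3_lo\<close> and \<open>k3_hi\<close> are its parts
  of degree two and four in $v$.\<close>

definition k3_lo :: "'a::comm_ring_1 \<Rightarrow> 'a \<Rightarrow> 'a \<Rightarrow> 'a \<Rightarrow> 'a \<Rightarrow> 'a \<Rightarrow> 'a \<Rightarrow> 'a \<Rightarrow> 'a \<Rightarrow> 'a \<Rightarrow> 'a \<Rightarrow> 'a \<Rightarrow> 'a" where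
  "k3_lo v1 v2 v3 v4 u1 u2 u3 u4 w1 w2 w3 w4 =
     - (v1 * v3 + v2 * v4) * (u3 * w4 - u4 * w3) - (v1 * v2 - v3 * v4) * (u2 * w4 - u4 * w2)
     + (v2\<^sup>2 + v3\<^sup>2 - v1\<^sup>2 - v4\<^sup>2) * ((u1 * w4 - u4 * w1) + (u2 * w3 - u3 * w2))
     - (v3 * v4 - v1 * v2) * (u1 * w3 - u3 * w1) - (v1 * v3 + v2 * v4) * (u1 * w2 - u2 * w1)"

definition k3_hi :: "'a::comm_ring_1 \<Rightarrow> 'a \<Rightarrow> 'a \<Rightarrow> 'a \<Rightarrow> 'a \<Rightarrow> 'a \<Rightarrow> 'a \<Rightarrow> 'a \<Rightarrow> 'a \<Rightarrow> 'a \<Rightarrow> 'a \<Rightarrow> 'a \<Rightarrow> 'a" where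
  "k3_hi v1 v2 v3 v4 u1 u2 u3 u4 w1 w2 w3 w4 =
     - (v1 * v2\<^sup>2 * v3 + v1\<^sup>2 * v2 * v4) * (u3 * w4 - u4 * w3)
     - (v1 * v2 * v3\<^sup>2 - v1\<^sup>2 * v3 * v4) * (u2 * w4 - u4 * w2)
     + (v1\<^sup>2 * v4\<^sup>2 - v2\<^sup>2 * v3\<^sup>2) * ((u1 * w4 - u4 * w1) + (u2 * w3 - u3 * w2))
     - (v2\<^sup>2 * v3 * v4 - v1 * v2 * v4\<^sup>2) * (u1 * w3 - u3 * w1)
     - (v2 * v3\<^sup>2 * v4 + v1 * v3 * v4\<^sup>2) * (u1 * w2 - u2 * w1)"

definition k3 :: "'a::comm_ring_1 \<Rightarrow> 'a \<Rightarrow> 'a \<Rightarrow> 'a \<Rightarrow> 'a \<Rightarrow> 'a \<Rightarrow> 'a \<Rightarrow> 'a \<Rightarrow> 'a \<Rightarrow> 'a \<Rightarrow> 'a \<Rightarrow> 'a \<Rightarrow> 'a" where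
  "k3 v1 v2 v3 v4 u1 u2 u3 u4 w1 w2 w3 w4 =
     k3_lo v1 v2 v3 v4 u1 u2 u3 u4 w1 w2 w3 w4 + k3_hi v1 v2 v3 v4 u1 u2 u3 u4 w1 w2 w3 w4"

definition K3 :: "'a::comm_ring_1 mat \<Rightarrow> 'a" where
  "K3 p = k3 (p $$ (0, 0)) (p $$ (1, 0)) (p $$ (2, 0)) (p $$ (3, 0))
             (p $$ (0, 1)) (p $$ (1, 1)) (p $$ (2, 1)) (p $$ (3, 1))
             (p $$ (0, 2)) (p $$ (1, 2)) (p $$ (2, 2)) (p $$ (3, 2))"

text \<open>For columns v, u, w of \<open>p\<close> and N = gram (A p) (X p) this is <v,w><Au,Xv> -
  <v,u><Aw,Xv>. Up to the isometry \<open>A\<close> it is the bivector Av wedge Xv evaluated on Au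
  and Aw, the change of v wedge f(v) under a correction of the lift.\<close>

definition Psi3 :: "'a::comm_ring_1 mat \<Rightarrow> 'a mat \<Rightarrow> 'a" where
  "Psi3 H N = H $$ (0, 2) * N $$ (1, 0) - H $$ (0, 1) * N $$ (2, 0)"

text \<open>The right-hand sides of \<open>k3_x1\<close> and \<open>k3_x2\<close> lie in the ideal generated by $3$ and all $x^3 - x$, which
  annihilates $\mathcal{E}(R,\theta)$.\<close>

lemma k3_x1:
  fixes t :: "'a::comm_ring_1"
  shows "k3 (v1 + t * v2) v2 (v3 + t * v4) v4 (u1 + t * u2) u2 (u3 + t * u4) u4 (w1 +
      t * w2) w2 (w3 + t * w4) w4 -
      (k3 v1 v2 v3 v4 u1 u2 u3 u4 w1 w2 w3 w4 + ((v1 * w4 - v2 * w3 + v3 * w2 - v4 * w1) * ((u1 +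
          t * u2) * (- t * v2) - u2 * (- t * v1 - t ^ 2 * v2) + (u3 + t * u4) * (- t * v4) -
          u4 * (- t * v3 - t ^ 2 * v4)) -
        (v1 * u4 - v2 * u3 + v3 * u2 - v4 * u1) * ((w1 + t * w2) * (- t * v2) - w2 * (- t * v1 -
            t ^ 2 * v2) + (w3 + t * w4) * (- t * v4) - w4 * (- t * v3 - t ^ 2 * v4))))
    = 3 * (t * u1 * v1 * v2 * v4 ^ 2 * w4 - t * u1 * v1 * v4 * w2 - t * u1 * v2 * v3 * v4 ^ 2 * w2 -
      t * u1 * v2 ^ 2 * v3 * v4 * w4 + t * u2 * v1 * v2 * v4 ^ 2 * w3 + t * u2 * v1 * v4 * w1 + t *
      u2 * v1 ^ 2 * v4 ^ 2 * w4 - t * u2 * v1 ^ 2 * w4 + t * u2 * v2 * v3 * v4 ^ 2 * w1 - t * u2 * v2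
      ^ 2 * v3 * v4 * w3 - t * u2 * v2 ^ 2 * v3 ^ 2 * w4 + t * u2 * v3 ^ 2 * w4 - t * u3 * v1 * v2 *
      v4 ^ 2 * w2 - t * u3 * v1 * v2 ^ 2 * v4 * w4 - t * u3 * v2 * v3 * w4 + t * u3 * v2 ^ 2 * v3 *
      v4 * w2 - t * u4 * v1 * v2 * v4 ^ 2 * w1 + t * u4 * v1 * v2 ^ 2 * v4 * w3 - t * u4 * v1 ^ 2 *
      v4 ^ 2 * w2 + t * u4 * v1 ^ 2 * w2 + t * u4 * v2 * v3 * w3 + t * u4 * v2 ^ 2 * v3 * v4 * w1 + t
      * u4 * v2 ^ 2 * v3 ^ 2 * w2 - t * u4 * v3 ^ 2 * w2 - t ^ 2 * u1 * v2 * v4 * w2 + 2 * t ^ 2 * u2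
      * v1 * v2 * v4 ^ 2 * w4 - t ^ 2 * u2 * v1 * v2 * w4 + t ^ 2 * u2 * v2 * v4 * w1 - 2 * t ^ 2 *
      u2 * v2 ^ 2 * v3 * v4 * w4 + t ^ 2 * u2 * v3 * v4 * w4 - t ^ 2 * u3 * v2 * v4 * w4 - 2 * t ^ 2
      * u4 * v1 * v2 * v4 ^ 2 * w2 + t ^ 2 * u4 * v1 * v2 * w2 + t ^ 2 * u4 * v2 * v4 * w3 + 2 * t ^
      2 * u4 * v2 ^ 2 * v3 * v4 * w2 - t ^ 2 * u4 * v3 * v4 * w2) + (t ^ 3 - t) * (- u2 * v2 ^ 2 * w4
      + u2 * v4 ^ 2 * w4 + u4 * v2 ^ 2 * w2 - u4 * v4 ^ 2 * w2) + (v2 ^ 3 - v2) * (- t * u3 * v3 * w4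
      + t * u4 * v3 * w3 - 2 * t ^ 2 * u3 * v4 * w4 + 2 * t ^ 2 * u4 * v4 * w3) + (v4 ^ 3 - v4) * (-
      t * u1 * v1 * w2 + t * u2 * v1 * w1 - 2 * t ^ 2 * u1 * v2 * w2 + 2 * t ^ 2 * u2 * v2 * w1)"
  by (simp add: k3_def k3_lo_def k3_hi_def power2_eq_square power3_eq_cube algebra_simps)

lemma k3_x2:
  fixes t :: "'a::comm_ring_1"
  shows "k3 v1 (v2 + t * v3) v3 v4 u1 (u2 + t * u3) u3 u4 w1 (w2 + t * w3) w3 w4 -
      (k3 v1 v2 v3 v4 u1 u2 u3 u4 w1 w2 w3 w4 + ((v1 * w4 - v2 * w3 + v3 * w2 -
          v4 * w1) * (u1 * (2 * t * v4) - (u2 + t * u3) * (t * v3) + u3 * (t * v2 + t ^ 2 * v3) -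
          u4 * (2 * t * v1)) -
        (v1 * u4 - v2 * u3 + v3 * u2 - v4 * u1) * (w1 * (2 * t * v4) - (w2 + t * w3) * (t * v3) +
            w3 * (t * v2 + t ^ 2 * v3) - w4 * (2 * t * v1))))
    = 3 * (- t * u1 * v2 * v3 ^ 2 * v4 * w3 - t * u1 * v3 * v4 * w2 - t * u2 * v1 * v3 * w4 + t * u2
      * v3 * v4 * w1 - t * u3 * v1 * v2 * v3 ^ 2 * w4 + t * u3 * v2 * v3 ^ 2 * v4 * w1 + t * u4 * v1
      * v2 * v3 ^ 2 * w3 + t * u4 * v1 * v3 * w2 - t ^ 2 * u1 * v3 * v4 * w3 - t ^ 2 * u3 * v1 * v3 *
      w4 + t ^ 2 * u3 * v3 * v4 * w1 + t ^ 2 * u4 * v1 * v3 * w3) + (v3 ^ 3 - v3) * (- 2 * t * u1 *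
      v2 * w4 - t * u1 * v4 * w2 - t * u2 * v1 * w4 - 2 * t * u2 * v2 * w3 + t * u2 * v4 * w1 + 2 * t
      * u3 * v2 * w2 + t * u4 * v1 * w2 + 2 * t * u4 * v2 * w1 - t ^ 2 * u1 * v3 * w4 - 2 * t ^ 2 *
      u1 * v4 * w3 - t ^ 2 * u2 * v3 * w3 - 2 * t ^ 2 * u3 * v1 * w4 + t ^ 2 * u3 * v3 * w2 + 2 * t ^
      2 * u3 * v4 * w1 + 2 * t ^ 2 * u4 * v1 * w3 + t ^ 2 * u4 * v3 * w1)"
  by (simp add: k3_def k3_lo_def k3_hi_def power2_eq_square power3_eq_cube algebra_simps)

lemma k3_w1:
  "k3 v2 (- v1) v4 (- v3) u2 (- u1) u4 (- u3) w2 (- w1) w4 (- w3) =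
    k3 v1 v2 v3 v4 u1 u2 u3 u4 w1 w2 w3 w4"
  by (simp add: k3_def k3_lo_def k3_hi_def power2_eq_square algebra_simps)

lemma k3_w2:
  "k3 v1 v3 (- v2) v4 u1 u3 (- u2) u4 w1 w3 (- w2) w4 = k3 v1 v2 v3 v4 u1 u2 u3 u4 w1 w2 w3 w4"
  by (simp add: k3_def k3_lo_def k3_hi_def power2_eq_square algebra_simps)

text \<open>The total degrees in v, u, w are four and six. Both are even, so a scalar whose square
  is congruent to 1 has no effect.\<close>

lemma k3_scale:
  "k3 (c * v1) (c * v2) (c * v3) (c * v4) (c * u1) (c * u2) (c * u3) (c * u4) (c * w1) (c * w2) (c *
      w3) (c * w4)
    = (c * c) * (c * c) * k3_lo v1 v2 v3 v4 u1 u2 u3 u4 w1 w2 w3 w4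
      + (c * c) * (c * c) * (c * c) * k3_hi v1 v2 v3 v4 u1 u2 u3 u4 w1 w2 w3 w4"
  by (simp add: k3_def k3_lo_def k3_hi_def power2_eq_square power3_eq_cube algebra_simps)

lemma carrier_mat_4_3:
  assumes "p \<in> carrier_mat 4 3"
  obtains v1 v2 v3 v4 u1 u2 u3 u4 w1 w2 w3 w4 where
    "p = mat_of_rows_list 3 [[v1, u1, w1], [v2, u2, w2], [v3, u3, w3], [v4, u4, w4]]"
  using mat_eq_rows_list[OF assms] by (simp add: upt_small)

lemma K3_rows: "K3 (mat_of_rows_list 3 [[v1, u1, w1], [v2, u2, w2], [v3, u3, w3], [v4, u4, w4]]) =
    k3 v1 v2 v3 v4 u1 u2 u3 u4 w1 w2 w3 w4"
  by (simp add: K3_def numeral_eq_Suc)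

lemma plus_mat_of_rows_list:
  assumes "length ss = length rs" "list_all (\<lambda>r. length r = n) rs" "list_all (\<lambda>r. length r = n) ss"
  shows "mat_of_rows_list n rs + mat_of_rows_list n ss =
    mat_of_rows_list n (map2 (map2 (+)) rs ss)"
  using assms by (intro eq_matI) (auto simp: list_all_length)

lemma zero_mat4_rows:
  "0\<^sub>m 4 4 = mat_of_rows_list 4 [[0,0,0,0],[0,0,0,0],[0,0,0,0],[0,0,0,0]]"
  by (subst rows4[of "0\<^sub>m 4 4"]) (simp_all add: rows_eval)

section \<open>The cocycle data for n = 3\<close>

context involution_ring
begin

lemma gram_rows4: "length rs = 4 \<Longrightarrow>
    gram (mat_of_rows_list k rs) z = transpose_mat (mat_of_rows_list k rs) * Q 4 * z"
  by (simp add: gram_def)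

lemma Psi3_rows:
  "Psi3 (gram (mat_of_rows_list 3 [[v1, u1, w1], [v2, u2, w2], [v3, u3, w3], [v4, u4,
      w4]]) (mat_of_rows_list 3 [[v1, u1, w1], [v2, u2, w2], [v3, u3, w3], [v4, u4, w4]]))
      (gram (mat_of_rows_list 3 [[p1, a1, b1], [p2, a2, b2], [p3, a3, b3], [p4, a4,
          b4]]) (mat_of_rows_list 3 [[x1, y1, z1], [x2, y2, z2], [x3, y3, z3], [x4, y4, z4]]))
    = (v1 * w4 - v2 * w3 + v3 * w2 - v4 * w1) * (a1 * x4 - a2 * x3 + a3 * x2 - a4 * x1) - (v1 * u4 -
        v2 * u3 + v3 * u2 - v4 * u1) * (b1 * x4 - b2 * x3 + b3 * x2 - b4 * x1)"
  by (simp add: Psi3_def gram_rows4 Q4_rows mat_eval algebra_simps)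

lemma cong_diffI:
  assumes "f - g = z" "cong z 0" shows "cong f g"
proof -
  have "cong (z + g) (0 + g)" by (intro cong_intros assms)
  then show ?thesis using assms(1) by (simp add: algebra_simps)
qed

lemma cong_zero_ideal:
  "cong a 0 \<Longrightarrow> cong b 0 \<Longrightarrow> cong (a + b) 0" "cong a 0 \<Longrightarrow> cong (a * h) 0"
  using cong_add[of a 0 b 0] cong_mult[of a 0 h h] cong_refl by auto

lemma cong_cube_diff: "cong (x ^ 3 - x) 0"
  using cong_diff[OF cong_cube[of x] cong_refl[of x]] by simp

lemmas cong_cert = cong_zero_ideal cong_cube_diff cong_three

lemma K3_cong:
  assumes p: "p \<in> carrier_mat 4 3" and pp: "mcong p p'"
  shows "cong (K3 p) (K3 p')"
proof -
  have "cong (p $$ (i, j)) (p' $$ (i, j))" if "i < 4" "j < 3" for i j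
    by (rule mcong_index[OF pp p that])
  then show ?thesis
    unfolding K3_def k3_def k3_lo_def k3_hi_def by (intro cong_intros) simp_all
qed

lemma K3_scale:
  assumes p: "p \<in> carrier_mat 4 3" and c: "cong (c * c) 1"
  shows "cong (K3 (c \<cdot>\<^sub>m p)) (K3 p)"
proof -
  obtain v1 v2 v3 v4 u1 u2 u3 u4 w1 w2 w3 w4 where
    p: "p = mat_of_rows_list 3 [[v1, u1, w1], [v2, u2, w2], [v3, u3, w3], [v4, u4, w4]]"
    using p by (rule carrier_mat_4_3)
  have "cong ((c * c) * (c * c) * k3_lo v1 v2 v3 v4 u1 u2 u3 u4 w1 w2 w3 w4
      + (c * c) * (c * c) * (c * c) * k3_hi v1 v2 v3 v4 u1 u2 u3 u4 w1 w2 w3 w4)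
     (1 * 1 * k3_lo v1 v2 v3 v4 u1 u2 u3 u4 w1 w2 w3 w4 +
         1 * 1 * 1 * k3_hi v1 v2 v3 v4 u1 u2 u3 u4 w1 w2 w3 w4)"
    by (intro cong_add cong_mult c cong_refl)
  then show ?thesis
    by (simp add: p mat_eval K3_rows k3_scale) (simp add: k3_def)
qed

text \<open>Vanishing for all u and w says that v wedge Zv is zero, so every vector is an
  eigenvector and Z is a scalar l. The determinant then gives 1 + 4 l = 1, and 4 l = l because 3 l =
  0.\<close>

lemma faithful3:
  assumes Z: "Z \<in> EM 4 4" and SU: "1\<^sub>m 4 + Z \<in> carrier (SU \<theta> 4)"
    and P: "\<And>p. p \<in> carrier_mat 4 3 \<Longrightarrow> Psi3 (gram p p) (gram p (Z * p)) = 0"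
  shows "Z = 0\<^sub>m 4 4"
proof -
  define z where "z i j = Z $$ (i, j)" for i j
  have Zr: "Z = mat_of_rows_list 4 [[z 0 0, z 0 1, z 0 2, z 0 3], [z 1 0, z 1 1, z 1 2, z 1 3],
      [z 2 0, z 2 1, z 2 2, z 2 3], [z 3 0, z 3 1, z 3 2, z 3 3]]"
    using mat_eq_rows_list[OF EM_carrier[OF Z]] by (simp add: upt_small z_def)
  have zE: "z i j \<in> \<E> \<theta>" if "i < 4" "j < 4" for i j
    using Z that by (simp add: EM_def z_def)
  have ev: "(v1 * w4 - v2 * w3 + v3 * w2 - v4 * w1) * (u1 * (z 3 0 * v1 + z 3 1 * v2 + z 3 2 * v3 +
      z 3 3 * v4) - u2 * (z 2 0 * v1 + z 2 1 * v2 + z 2 2 * v3 + z 2 3 * v4) + u3 * (z 1 0 * v1 +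
      z 1 1 * v2 + z 1 2 * v3 + z 1 3 * v4) - u4 * (z 0 0 * v1 + z 0 1 * v2 + z 0 2 * v3 +
      z 0 3 * v4)) - (v1 * u4 - v2 * u3 + v3 * u2 - v4 * u1) * (w1 * (z 3 0 * v1 + z 3 1 * v2 +
      z 3 2 * v3 + z 3 3 * v4) - w2 * (z 2 0 * v1 + z 2 1 * v2 + z 2 2 * v3 + z 2 3 * v4) +
      w3 * (z 1 0 * v1 + z 1 1 * v2 + z 1 2 * v3 + z 1 3 * v4) - w4 * (z 0 0 * v1 + z 0 1 * v2 +
      z 0 2 * v3 + z 0 3 * v4)) = 0"
    for v1 v2 v3 v4 u1 u2 u3 u4 w1 w2 w3 w4
  proof -
    have "Psi3 (gram (mat_of_rows_list 3 [[v1, u1, w1], [v2, u2, w2], [v3, u3, w3], [v4, u4,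
        w4]]) (mat_of_rows_list 3 [[v1, u1, w1], [v2, u2, w2], [v3, u3, w3], [v4, u4, w4]]))
      (gram (mat_of_rows_list 3 [[v1, u1, w1], [v2, u2, w2], [v3, u3, w3], [v4, u4,
          w4]]) (Z * mat_of_rows_list 3 [[v1, u1, w1], [v2, u2, w2], [v3, u3, w3], [v4, u4, w4]])) = 0"
      by (rule P) simp
    then show ?thesis unfolding Zr by (simp add: mat_eval Psi3_rows algebra_simps)
  qed
  \<comment> \<open>The variables of \<open>ev\<close> are filled in their order of occurrence, v1
    w4 v2 w3 v3 w2 v4 w1 u1 u2 u3 u4. Here v is a basis vector, u the basis vector paired with it,
    and w a basis vector orthogonal to v, possibly v itself.\<close>
  have off: "z 3 0 = 0" "z 2 0 = 0" "z 1 0 = 0" "z 3 1 = 0" "z 2 1 = 0" "z 0 1 = 0" "z 3 2 = 0"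
      "z 1 2 = 0" "z 0 2 = 0" "z 2 3 = 0" "z 1 3 = 0" "z 0 3 = 0"
    using ev[of 1 0 0 0 0 0 0 1 0 0 0 1]
      ev[of 1 0 0 0 0 1 0 0 0 0 0 1]
      ev[of 1 0 0 1 0 0 0 0 0 0 0 1]
      ev[of 0 0 1 0 0 0 0 1 0 0 1 0]
      ev[of 0 0 1 0 0 1 0 0 0 0 1 0]
      ev[of 0 1 1 0 0 0 0 0 0 0 1 0]
      ev[of 0 0 0 0 1 0 0 1 0 1 0 0]
      ev[of 0 0 0 1 1 0 0 0 0 1 0 0]
      ev[of 0 1 0 0 1 0 0 0 0 1 0 0]
      ev[of 0 0 0 0 0 1 1 0 1 0 0 0]
      ev[of 0 0 0 1 0 0 1 0 1 0 0 0]
      ev[of 0 1 0 0 0 0 1 0 1 0 0 0] by simp_all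
  \<comment> \<open>Now v is the sum of the first and another basis vector, u is the fourth, and w
    is orthogonal to v; this isolates a difference of two diagonal entries.\<close>
  have diag: "z 1 1 = z 0 0" "z 2 2 = z 0 0" "z 3 3 = z 0 0"
    using ev[of 1 1 1 1 0 0 0 0 0 0 0 1]
      ev[of 1 "- 1" 0 0 1 1 0 0 0 0 0 1]
      ev[of 1 1 0 0 0 0 1 1 0 0 0 1] by (simp_all add: off off[unfolded One_nat_def] algebra_simps)
  define l where "l = z 0 0"
  have l: "l \<in> \<E> \<theta>" using zE by (simp add: l_def)
  have "1\<^sub>m 4 + Z = (1 + l) \<cdot>\<^sub>m 1\<^sub>m 4"
    by (simp add: Zr off[unfolded One_nat_def] diag[unfolded One_nat_def] l_def one_mat_rows
        plus_mat_of_rows_list mat_eval)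
  then have "(1 + l) ^ 4 = 1"
    using SU by (simp add: in_SU det_smult)
  moreover have sq: "(1 + x) * (1 + x) = 1 + (x + x)" if "x \<in> \<E> \<theta>" for x
    using EE_EE[OF that that] by (simp add: algebra_simps)
  have "(1 + l) ^ 4 = (1 + l) * (1 + l) * ((1 + l) * (1 + l))"
    by (simp add: power4_eq_xxxx mult.assoc)
  then have "(1 + l) ^ 4 = 1 + (l + l + (l + l))" by (simp only: sq[OF l] sq[OF EE_add[OF l l]])
  moreover have "l + l + (l + l) = 3 * l + l" by simp
  ultimately have "l = 0" using EE_three[OF l] by simp
  then show ?thesis
    by (simp add: Zr off[unfolded One_nat_def] diag[unfolded One_nat_def] l_def zero_mat4_rows)
qed

text \<open>Commuting with x_2(1), x_4(1) and their transposes leaves a diagonal matrix with two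
  pairs of equal entries; x_1(1) identifies the pairs, and unitarity gives norm one.\<close>

lemma centre3:
  assumes z: "z \<in> centre (E_sc \<theta> 3)"
  shows "\<exists>c. z = c \<cdot>\<^sub>m 1\<^sub>m 4 \<and> c * \<theta> c = 1"
proof -
  have zE: "z \<in> carrier (E_sc \<theta> 3)" using z by (simp add: centre_def)
  have comm: "z * x = x * z" if "x \<in> root_elements \<theta> 3" for x
    using z root_E[OF that] by (simp add: centre_def)
  have zc: "z \<in> carrier_mat 4 4" using E_carrier[OF _ zE] by simp
  define y where "y i j = z $$ (i, j)" for i j
  have zr: "z = mat_of_rows_list 4 [[y 0 0, y 0 1, y 0 2, y 0 3], [y 1 0, y 1 1, y 1 2, y 1 3],
      [y 2 0, y 2 1, y 2 2, y 2 3], [y 3 0, y 3 1, y 3 2, y 3 3]]"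
    using mat_eq_rows_list[OF zc] by (simp add: upt_small y_def)
  have roots: "x3_2 1 \<in> root_elements \<theta> 3" "transpose_mat (x3_2 1) \<in> root_elements \<theta> 3"
    "x3_4 1 \<in> root_elements \<theta> 3" "transpose_mat (x3_4 1) \<in> root_elements \<theta> 3"
    "x3_1 \<theta> 1 \<in> root_elements \<theta> 3"
    by (auto simp: root_elements_def positive_root_elements_def sym_part_def theta_one)
  have c: "(z * x) $$ (i, j) = (x * z) $$ (i, j)" if "x \<in> root_elements \<theta> 3" for x i j
    using comm[OF that] by simp
  have off: "y 0 1 = 0" "y 0 2 = 0" "y 0 3 = 0" "y 1 0 = 0" "y 1 2 = 0" "y 1 3 = 0" "y 2 0 = 0"
      "y 2 1 = 0" "y 2 3 = 0" "y 3 0 = 0" "y 3 1 = 0" "y 3 2 = 0"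
    using c[OF roots(1), of 0 2]
      c[OF roots(2), of 0 1]
      c[OF roots(4), of 0 0]
      c[OF roots(2), of 2 0]
      c[OF roots(2), of 1 1]
      c[OF roots(2), of 2 3]
      c[OF roots(1), of 1 0]
      c[OF roots(1), of 2 2]
      c[OF roots(1), of 1 3]
      c[OF roots(3), of 3 3]
      c[OF roots(1), of 3 2]
      c[OF roots(2), of 3 1]
    by (simp_all add: zr x3_2_rows x3_2_transpose_rows x3_4_rows x3_4_transpose_rows mat_eval)
  have diag: "y 1 1 = y 0 0" "y 2 2 = y 0 0" "y 3 3 = y 0 0"
    using c[OF roots(1), of 1 2] c[OF roots(3), of 0 3] c[OF roots(5), of 0 1]
    by (simp_all add: zr x3_1_rows x3_2_rows x3_4_rows mat_eval off[unfolded One_nat_def] theta_one)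
  have "z = y 0 0 \<cdot>\<^sub>m 1\<^sub>m 4"
    by (simp add: zr off[unfolded One_nat_def] diag[unfolded One_nat_def] one_mat_rows mat_eval)
  moreover have "y 0 0 * \<theta> (y 0 0) = 1"
  proof -
    have "(z * Q 4 * transpose_mat (map_mat \<theta> z)) $$ (0, 3) = Q 4 $$ (0, 3)"
      using E_SU[OF _ zE] by (simp add: in_SU)
    then show ?thesis unfolding zr by (simp add: off[unfolded One_nat_def] diag[unfolded
        One_nat_def] theta_zero Q4_rows mat_eval)
  qed
  ultimately show ?thesis by blast
qed

lemma cocycle_data3: "cocycle_data \<theta> 3 3 K3 Psi3"
proof (rule cocycle_data.intro[OF involution_ring_axioms cocycle_data_axioms.intro], simp_all)
  fix H N N' :: "'a mat" and c assume N: "N \<in> carrier_mat 3 3"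
  then show "Psi3 H (c \<cdot>\<^sub>m N) = c * Psi3 H N" by (simp add: Psi3_def algebra_simps)
  assume "N' \<in> carrier_mat 3 3"
  then show "Psi3 H (N + N') = Psi3 H N + Psi3 H N'" using N by (simp add: Psi3_def algebra_simps)
next
  fix H H' N :: "'a mat" assume H: "H \<in> carrier_mat 3 3" "mcong H H'" and N: "N \<in> EM 3 3"
  have "N $$ (i, 0) * H $$ (0, j) = N $$ (i, 0) * H' $$ (0, j)" if "i < 3" "j < 3" for i j
    using congD[OF mcong_index[OF H(2,1), of 0 j], of "N $$ (i, 0)"] N that by (simp add: EM_def)
  from this[of 1 2] this[of 2 1] show "Psi3 H N = Psi3 H' N" by (simp add: Psi3_def mult.commute)
qed (use K3_cong K3_scale faithful3 centre3 in blast)+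

end

section \<open>The prescribed images for n = 3\<close>

context involution_ring
begin

interpretation n3: cocycle_data \<theta> 3 3 K3 Psi3
  rewrites "3 + (1::nat) = 4"
  by (rule cocycle_data3) simp

lemma root3_E:
  "x3_1 \<theta> t \<in> carrier (E_sc \<theta> 3)" "transpose_mat (x3_1 \<theta> t) \<in> carrier (E_sc \<theta> 3)"
  "x3_3 \<theta> t \<in> carrier (E_sc \<theta> 3)" "transpose_mat (x3_3 \<theta> t) \<in> carrier (E_sc \<theta> 3)"
  "s \<in> sym_part \<theta> \<Longrightarrow> x3_2 s \<in> carrier (E_sc \<theta> 3)"
  "s \<in> sym_part \<theta> \<Longrightarrow> transpose_mat (x3_2 s) \<in> carrier (E_sc \<theta> 3)"
  by (auto intro!: root_E simp: root_elements_def positive_root_elements_def)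

lemma E3_mult: "A \<in> carrier (E_sc \<theta> 3) \<Longrightarrow> B \<in> carrier (E_sc \<theta> 3) \<Longrightarrow> A * B \<in> carrier (E_sc \<theta> 3)"
  by (rule E_mult) simp_all

lemma w3_E: "w1_3 \<in> carrier (E_sc \<theta> 3)" "w2_3 \<in> carrier (E_sc \<theta> 3)"
proof -
  have "w1_3 = x3_1 \<theta> 1 * transpose_mat (x3_1 \<theta> (- 1)) * x3_1 \<theta> 1"
    by (simp add: w1_3_rows x3_1_rows x3_1_transpose_rows mat_eval theta_simps)
  then show "w1_3 \<in> carrier (E_sc \<theta> 3)" using E3_mult root3_E by metis
  have one: "1 \<in> sym_part \<theta>" "- 1 \<in> sym_part \<theta>" by (simp_all add: sym_part_def theta_simps)
  have "w2_3 = x3_2 1 * transpose_mat (x3_2 (- 1)) * x3_2 1"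
    by (simp add: w2_3_rows x3_2_rows x3_2_transpose_rows mat_eval)
  then show "w2_3 \<in> carrier (E_sc \<theta> 3)"
    using E3_mult root3_E(5,6) one by metis
qed

text \<open>In the upper block, e^2 = 0 makes the commutator of x_1(1) and x_{-1}(e) equal to diag(1
  + e, 1 - e) x_1(-e), and the last factor x_1(e) removes the unipotent part. The lower block is the
  same with \<open>e\<close> replaced by its conjugate -e.\<close>

lemma diag3_E:
  assumes "e \<in> \<E> \<theta>"
  shows "mat_of_rows_list 4 [[1 + e, 0, 0, 0], [0, 1 - e, 0, 0], [0, 0, 1 - e, 0], [0, 0, 0, 1 + e]]
    \<in> carrier (E_sc \<theta> 3)" (is "?D \<in> _")
proof -
  have "?D = x3_1 \<theta> 1 * transpose_mat (x3_1 \<theta> e) * x3_1 \<theta> (- 1) * transpose_mat (x3_1 \<theta> (- e)) *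
      x3_1 \<theta> e"
    using EE_EE[OF assms assms]
    by (simp add: x3_1_rows x3_1_transpose_rows mat_eval theta_simps theta_EE[OF assms] algebra_simps)
  then show ?thesis by (simp add: E3_mult root3_E)
qed

definition y3_1 :: "'a \<Rightarrow> 'a \<Rightarrow> 'a mat" where
  "y3_1 \<delta> t = 1\<^sub>m 4 + t \<cdot>\<^sub>m E4 1 2 + \<theta> t \<cdot>\<^sub>m E4 3 4
     - plus_part \<theta> t * \<delta> \<cdot>\<^sub>m (E4 1 3 + E4 2 4 + E4 3 1 + E4 4 2)
     - (plus_part \<theta> t)\<^sup>2 * \<delta> \<cdot>\<^sub>m (E4 1 4 + E4 3 2)"

definition y3_1n :: "'a \<Rightarrow> 'a \<Rightarrow> 'a mat" where
  "y3_1n \<delta> t = 1\<^sub>m 4 + t \<cdot>\<^sub>m E4 2 1 + \<theta> t \<cdot>\<^sub>m E4 4 3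
     + plus_part \<theta> t * \<delta> \<cdot>\<^sub>m (E4 1 3 + E4 2 4 + E4 3 1 + E4 4 2)
     + (plus_part \<theta> t)\<^sup>2 * \<delta> \<cdot>\<^sub>m (E4 2 3 + E4 4 1)"

definition y3_2 :: "'a \<Rightarrow> 'a \<Rightarrow> 'a mat" where
  "y3_2 \<delta> s = (1 + 2 * s * \<delta>) \<cdot>\<^sub>m (E4 1 1 + E4 4 4) + (1 + s * \<delta>) \<cdot>\<^sub>m (E4 2 2 + E4 3 3)
     + (s + s\<^sup>2 * \<delta>) \<cdot>\<^sub>m E4 2 3"

definition y3_2n :: "'a \<Rightarrow> 'a \<Rightarrow> 'a mat" where
  "y3_2n \<delta> s = (1 - 2 * s * \<delta>) \<cdot>\<^sub>m (E4 1 1 + E4 4 4) + (1 - s * \<delta>) \<cdot>\<^sub>m (E4 2 2 + E4 3 3)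
     + (s - s\<^sup>2 * \<delta>) \<cdot>\<^sub>m E4 3 2"

lemma plus_part_mult:
  assumes "\<delta> \<in> \<E> \<theta>"
  shows "plus_part \<theta> t * \<delta> = \<delta> * t" "(plus_part \<theta> t)\<^sup>2 * \<delta> = \<delta> * t\<^sup>2"
  using congD[OF cong_plus_part assms] congD[OF cong_power[OF cong_plus_part] assms]
  by (simp_all add: mult.commute)

lemma y3_1_rows:
  assumes "\<delta> \<in> \<E> \<theta>"
  shows "y3_1 \<delta> t = mat_of_rows_list 4 [[1, t, - (\<delta> * t), - (\<delta> * t\<^sup>2)], [0, 1, 0, - (\<delta> * t)],
    [- (\<delta> * t), - (\<delta> * t\<^sup>2), 1, \<theta> t], [0, - (\<delta> * t), 0, 1]]"
  by (subst rows4) (simp_all add: y3_1_def rows_eval plus_part_mult[OF assms])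

lemma y3_1n_rows:
  assumes "\<delta> \<in> \<E> \<theta>"
  shows "y3_1n \<delta> t = mat_of_rows_list 4 [[1, 0, \<delta> * t, 0], [t, 1, \<delta> * t\<^sup>2, \<delta> * t],
    [\<delta> * t, 0, 1, 0], [\<delta> * t\<^sup>2, \<delta> * t, \<theta> t, 1]]"
  by (subst rows4) (simp_all add: y3_1n_def rows_eval plus_part_mult[OF assms])

lemma y3_2_rows:
  "y3_2 \<delta> s = mat_of_rows_list 4 [[1 + 2 * s * \<delta>, 0, 0, 0], [0, 1 + s * \<delta>, s + s\<^sup>2 * \<delta>, 0],
    [0, 0, 1 + s * \<delta>, 0], [0, 0, 0, 1 + 2 * s * \<delta>]]"
  by (subst rows4) (simp_all add: y3_2_def rows_eval)

lemma y3_2n_rows: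
  "y3_2n \<delta> s = mat_of_rows_list 4 [[1 - 2 * s * \<delta>, 0, 0, 0], [0, 1 - s * \<delta>, 0, 0],
    [0, s - s\<^sup>2 * \<delta>, 1 - s * \<delta>, 0], [0, 0, 0, 1 - 2 * s * \<delta>]]"
  by (subst rows4) (simp_all add: y3_2n_def rows_eval)

lemma mcong_rows:
  assumes "list_all2 (list_all2 cong) rs ss" "list_all (\<lambda>r. length r = n) rs"
  shows "mcong (mat_of_rows_list n rs) (mat_of_rows_list n ss)"
  using assms by (auto simp: mcong_def list_all2_conv_all_nth list_all_length)

text \<open>The image must lie in the elementary subgroup and not merely in the unitary group; its
  correction is a product of root elements with parameter e = \<delta> t.\<close>

lemma y3_1_E:
  assumes \<delta>: "\<delta> \<in> \<E> \<theta>"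
  shows "y3_1 \<delta> t \<in> carrier (E_sc \<theta> 3)"
proof -
  define e f where "e = \<delta> * t" and "f = \<delta> * t\<^sup>2"
  have e: "e \<in> \<E> \<theta>" by (simp add: e_def EE_mult[OF \<delta>])
  have f: "f \<in> \<E> \<theta>" by (simp add: f_def EE_mult[OF \<delta>])
  have r: "e * e = 0" "f * e = 0" "e * f = 0" "\<theta> e = - e" "t * e = f" "e * t = f"
    using EE_EE[OF e e] EE_EE[OF e f] EE_EE[OF f e] theta_EE[OF e] by (simp_all add: e_def f_def
        power2_eq_square mult_ac)
  then have "e * \<theta> t = f" "\<theta> t * e = f"
    using EE_mult_theta[OF e, of t] by (simp_all add: mult.commute)
  then have "y3_1 \<delta> t = x3_1 \<theta> t * x3_3 \<theta> e * transpose_mat (x3_3 \<theta> e)"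
    unfolding y3_1_rows[OF \<delta>] e_def[symmetric] f_def[symmetric]
    by (simp add: x3_1_rows x3_3_rows x3_3_transpose_rows mat_eval r)
  then show ?thesis by (simp add: E3_mult root3_E)
qed

lemma y3_2_E:
  assumes \<delta>: "\<delta> \<in> \<E> \<theta>" and s: "s \<in> sym_part \<theta>"
  shows "y3_2 \<delta> s \<in> carrier (E_sc \<theta> 3)"
proof -
  define e f where "e = - (\<delta> * s)" and "f = \<delta> * s\<^sup>2"
  have e: "e \<in> \<E> \<theta>" by (simp add: e_def EE_mult EE_uminus \<delta>)
  have "3 * e = 0" by (rule EE_three[OF e])
  \<comment> \<open>Because 3 \<delta> = 0, the two coefficients 2 s \<delta> and s \<delta> of the
    prescription are opposite, which gives the diagonal of \<open>diag3_E\<close>.\<close>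
  moreover have "2 * s * \<delta> = e - 3 * e" by (simp add: e_def algebra_simps)
  ultimately have r: "2 * s * \<delta> = e" "s * \<delta> = - e" "s\<^sup>2 * \<delta> = f" "s * e = - f"
    by (simp_all add: e_def f_def power2_eq_square mult_ac)
  have "y3_2 \<delta> s = x3_2 s *
    mat_of_rows_list 4 [[1 + e, 0, 0, 0], [0, 1 - e, 0, 0], [0, 0, 1 - e, 0], [0, 0, 0, 1 + e]]"
    unfolding y3_2_rows r by (simp add: x3_2_rows mat_eval right_diff_distrib r)
  then show ?thesis using diag3_E[OF e] s by (simp add: E3_mult root3_E)
qed

text \<open>\<open>K3\<close> is exactly invariant under both Weyl elements, so they need no
  correction.\<close>

lemma Rel3_w:
  "n3.Rel \<delta> w1_3 w1_3" "n3.Rel \<delta> w2_3 w2_3"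
proof -
  have "K3 (w1_3 * p) = K3 p" "K3 (w2_3 * p) = K3 p" if p: "p \<in> carrier_mat 4 3" for p :: "'a mat"
  proof -
    obtain v1 v2 v3 v4 u1 u2 u3 u4 w1 w2 w3 w4 where
      p: "p = mat_of_rows_list 3 [[v1, u1, w1], [v2, u2, w2], [v3, u3, w3], [v4, u4, w4]]"
      using p by (rule carrier_mat_4_3)
    show "K3 (w1_3 * p) = K3 p" "K3 (w2_3 * p) = K3 p"
      by (simp_all add: p w1_3_rows w2_3_rows mat_eval K3_rows k3_w1 k3_w2)
  qed
  then show "n3.Rel \<delta> w1_3 w1_3" "n3.Rel \<delta> w2_3 w2_3"
    by (simp_all add: n3.Rel_refl w3_E)
qed

lemma Rel3_1:
  assumes \<delta>: "\<delta> \<in> \<E> \<theta>"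
  shows "n3.Rel \<delta> (x3_1 \<theta> t) (y3_1 \<delta> t)"
proof (rule n3.Rel_intro[OF \<delta> root3_E(1) y3_1_E[OF \<delta>], where
    A' = "mat_of_rows_list 4 [[1, t, 0, 0], [0, 1, 0, 0], [0, 0, 1, t], [0, 0, 0, 1]]" and
    X = "mat_of_rows_list 4 [[0, 0, - t, - (t ^ 2)], [0, 0, 0, - t], [- t, - (t ^ 2), 0, 0], [0, -
        t, 0, 0]]"])
  fix p :: "'a mat" assume "p \<in> carrier_mat 4 3"
  then obtain v1 v2 v3 v4 u1 u2 u3 u4 w1 w2 w3 w4 where
    p: "p = mat_of_rows_list 3 [[v1, u1, w1], [v2, u2, w2], [v3, u3, w3], [v4, u4, w4]]"
    by (rule carrier_mat_4_3)
  have A: "mat_of_rows_list 4 [[1, t, 0, 0], [0, 1, 0, 0], [0, 0, 1, t], [0, 0, 0, 1]] * p =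
      mat_of_rows_list 3 [[(v1 + t * v2), (u1 + t * u2), (w1 + t * w2)], [v2, u2, w2], [(v3 +
          t * v4), (u3 + t * u4), (w3 + t * w4)], [v4, u4, w4]]"
    by (simp add: p mat_eval)
  have X: "mat_of_rows_list 4 [[0, 0, - t, - (t ^ 2)], [0, 0, 0, - t], [- t, - (t ^ 2), 0, 0], [0, -
      t, 0, 0]] * p =
      mat_of_rows_list 3 [[(- t * v3 - t ^ 2 * v4), (- t * u3 - t ^ 2 * u4), (- t * w3 -
          t ^ 2 * w4)], [(- t * v4), (- t * u4), (- t * w4)], [(- t * v1 - t ^ 2 * v2), (- t * u1 -
          t ^ 2 * u2), (- t * w1 - t ^ 2 * w2)], [(- t * v2), (- t * u2), (- t * w2)]]"
    by (simp add: p mat_eval)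
  show "cong (K3 (mat_of_rows_list 4 [[1, t, 0, 0], [0, 1, 0, 0], [0, 0, 1, t], [0, 0, 0, 1]] * p))
    (K3 p + Psi3 (gram p p) (gram (mat_of_rows_list 4 [[1, t, 0, 0], [0, 1, 0, 0], [0, 0, 1, t], [0,
        0, 0, 1]] * p) (mat_of_rows_list 4 [[0, 0, - t, - (t ^ 2)], [0, 0, 0, - t], [- t, - (t ^ 2),
        0, 0], [0, - t, 0, 0]] * p)))"
    unfolding A X unfolding p K3_rows Psi3_rows
    by (rule cong_diffI[OF k3_x1]) (intro cong_cert)
qed (simp_all add: x3_1_rows y3_1_rows[OF \<delta>] mat_eval mcong_rows cong_refl cong_sym[OF cong_theta]
    cong_theta)

lemma Rel3_2:
  assumes \<delta>: "\<delta> \<in> \<E> \<theta>" and s: "t \<in> sym_part \<theta>"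
  shows "n3.Rel \<delta> (x3_2 t) (y3_2 \<delta> t)"
proof (rule n3.Rel_intro[OF \<delta> root3_E(5)[OF s] y3_2_E[OF \<delta> s], where
    A' = "mat_of_rows_list 4 [[1, 0, 0, 0], [0, 1, t, 0], [0, 0, 1, 0], [0, 0, 0, 1]]" and
    X = "mat_of_rows_list 4 [[2 * t, 0, 0, 0], [0, t, t ^ 2, 0], [0, 0, t, 0], [0, 0, 0, 2 * t]]"])
  fix p :: "'a mat" assume "p \<in> carrier_mat 4 3"
  then obtain v1 v2 v3 v4 u1 u2 u3 u4 w1 w2 w3 w4 where
    p: "p = mat_of_rows_list 3 [[v1, u1, w1], [v2, u2, w2], [v3, u3, w3], [v4, u4, w4]]"
    by (rule carrier_mat_4_3)
  have A: "mat_of_rows_list 4 [[1, 0, 0, 0], [0, 1, t, 0], [0, 0, 1, 0], [0, 0, 0, 1]] * p =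
      mat_of_rows_list 3 [[v1, u1, w1], [(v2 + t * v3), (u2 + t * u3), (w2 + t * w3)], [v3, u3, w3],
          [v4, u4, w4]]"
    by (simp add: p mat_eval)
  have X: "mat_of_rows_list 4 [[2 * t, 0, 0, 0], [0, t, t ^ 2, 0], [0, 0, t, 0], [0, 0, 0, 2 * t]] * p =
      mat_of_rows_list 3 [[(2 * t * v1), (2 * t * u1), (2 * t * w1)], [(t * v2 + t ^ 2 * v3),
          (t * u2 + t ^ 2 * u3), (t * w2 + t ^ 2 * w3)], [(t * v3), (t * u3), (t * w3)],
          [(2 * t * v4), (2 * t * u4), (2 * t * w4)]]"
    by (simp add: p mat_eval)
  show "cong (K3 (mat_of_rows_list 4 [[1, 0, 0, 0], [0, 1, t, 0], [0, 0, 1, 0], [0, 0, 0, 1]] * p))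
    (K3 p + Psi3 (gram p p) (gram (mat_of_rows_list 4 [[1, 0, 0, 0], [0, 1, t, 0], [0, 0, 1, 0], [0,
        0, 0, 1]] * p) (mat_of_rows_list 4 [[2 * t, 0, 0, 0], [0, t, t ^ 2, 0], [0, 0, t, 0], [0, 0,
        0, 2 * t]] * p)))"
    unfolding A X unfolding p K3_rows Psi3_rows
    by (rule cong_diffI[OF k3_x2]) (intro cong_cert)
qed (simp_all add: x3_2_rows y3_2_rows mat_eval mcong_rows cong_refl mult_ac)

text \<open>Conjugation by w_1 carries x_1(-t) to x_{-1}(t) and the prescribed images accordingly,
  so one polynomial identity serves both signs.\<close>

lemma Rel3_1n:
  assumes \<delta>: "\<delta> \<in> \<E> \<theta>"
  shows "n3.Rel \<delta> (transpose_mat (x3_1 \<theta> t)) (y3_1n \<delta> t)"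
proof -
  have "conj_by 4 w1_3 (y3_1 \<delta> (- t)) = y3_1n \<delta> t"
    by (rule n3.conj_by_E(1)[OF w3_E(1)])
      (simp_all add: y3_1_rows[OF \<delta>] y3_1n_rows[OF \<delta>] w1_3_rows mat_eval theta_uminus)
  moreover have "n3.Rel \<delta> (transpose_mat (x3_1 \<theta> t)) (conj_by 4 w1_3 (y3_1 \<delta> (- t)))"
    by (rule n3.Rel_conj[OF Rel3_w(1) Rel3_1[OF \<delta>]])
      (simp_all add: x3_1_rows x3_1_transpose_rows w1_3_rows mat_eval theta_uminus)
  ultimately show ?thesis by simp
qed

lemma Rel3_2n:
  assumes \<delta>: "\<delta> \<in> \<E> \<theta>" and s: "s \<in> sym_part \<theta>"
  shows "n3.Rel \<delta> (transpose_mat (x3_2 s)) (y3_2n \<delta> s)"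
proof -
  have s': "- s \<in> sym_part \<theta>" using s by (simp add: sym_part_def theta_uminus)
  have "conj_by 4 w2_3 (y3_2 \<delta> (- s)) = y3_2n \<delta> s"
    by (rule n3.conj_by_E(1)[OF w3_E(2)])
      (simp_all add: y3_2_rows y3_2n_rows w2_3_rows mat_eval)
  moreover have "n3.Rel \<delta> (transpose_mat (x3_2 s)) (conj_by 4 w2_3 (y3_2 \<delta> (- s)))"
    by (rule n3.Rel_conj[OF Rel3_w(2) Rel3_2[OF \<delta> s']])
      (simp_all add: x3_2_rows x3_2_transpose_rows w2_3_rows mat_eval)
  ultimately show ?thesis by simp
qed

lemma Rel3_3:
  assumes \<delta>: "\<delta> \<in> \<E> \<theta>"
  shows "n3.Rel \<delta> (x3_3 \<theta> t) (conj_by 4 w2_3 (y3_1 \<delta> t))"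
    "n3.Rel \<delta> (transpose_mat (x3_3 \<theta> t)) (conj_by 4 w2_3 (y3_1n \<delta> t))"
  by (rule n3.Rel_conj[OF Rel3_w(2) Rel3_1[OF \<delta>]] n3.Rel_conj[OF Rel3_w(2) Rel3_1n[OF \<delta>]];
      simp add: x3_1_rows x3_3_rows x3_1_transpose_rows x3_3_transpose_rows w2_3_rows mat_eval)+

lemma Rel3_4:
  assumes \<delta>: "\<delta> \<in> \<E> \<theta>" and s: "s \<in> sym_part \<theta>"
  shows "n3.Rel \<delta> (x3_4 s) (conj_by 4 w1_3 (y3_2 \<delta> s))"
    "n3.Rel \<delta> (transpose_mat (x3_4 s)) (conj_by 4 w1_3 (y3_2n \<delta> s))"
  by (rule n3.Rel_conj[OF Rel3_w(1) Rel3_2[OF \<delta> s]] n3.Rel_conj[OF Rel3_w(1) Rel3_2n[OF \<delta> s]];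
      simp add: x3_2_rows x3_4_rows x3_2_transpose_rows x3_4_transpose_rows w1_3_rows mat_eval)+

text \<open>By uniqueness of images a relation for a generator is an equation for the value of
  \<open>f\<close>; the prescription is thereby the same as the relation on all generators.\<close>

lemma relation_family3:
  "relation_family (E_sc \<theta> 3) (\<E> \<theta>) n3.Rel (root_elements \<theta> 3) (prescription \<theta> 3)"
proof (rule n3.relation_familyI)
  fix \<delta> x assume \<delta>: "\<delta> \<in> \<E> \<theta>" and "x \<in> root_elements \<theta> 3"
  then show "\<exists>y. n3.Rel \<delta> x y"
    using Rel3_1[OF \<delta>] Rel3_1n[OF \<delta>] Rel3_2[OF \<delta>] Rel3_2n[OF \<delta>] Rel3_3[OF \<delta>] Rel3_4[OF \<delta>]
    by (fastforce simp: root_elements_def positive_root_elements_def)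
next
  fix \<delta> f assume \<delta>: "\<delta> \<in> \<E> \<theta>"
  have iff: "n3.Rel \<delta> x z \<longleftrightarrow> z = y" if "n3.Rel \<delta> x y" for x y z
    using that n3.Rel_unique by blast
  note iffs = iff[OF Rel3_1[OF \<delta>]] iff[OF Rel3_1n[OF \<delta>]] iff[OF Rel3_2[OF \<delta>]] iff[OF Rel3_2n[OF \<delta>]]
    iff[OF Rel3_3(1)[OF \<delta>]] iff[OF Rel3_3(2)[OF \<delta>]] iff[OF Rel3_4(1)[OF \<delta>]] iff[OF Rel3_4(2)[OF \<delta>]]
  have "prescription \<theta> 3 \<delta> f \<longleftrightarrow>
      (\<forall>t. f (x3_1 \<theta> t) = y3_1 \<delta> t \<and> f (transpose_mat (x3_1 \<theta> t)) = y3_1n \<delta> t) \<and>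
      (\<forall>s \<in> sym_part \<theta>. f (x3_2 s) = y3_2 \<delta> s \<and> f (transpose_mat (x3_2 s)) = y3_2n \<delta> s) \<and>
      (\<forall>t. f (x3_3 \<theta> t) = conj_by 4 w2_3 (f (x3_1 \<theta> t)) \<and>
        f (transpose_mat (x3_3 \<theta> t)) = conj_by 4 w2_3 (f (transpose_mat (x3_1 \<theta> t)))) \<and>
      (\<forall>s \<in> sym_part \<theta>. f (x3_4 s) = conj_by 4 w1_3 (f (x3_2 s)) \<and>
        f (transpose_mat (x3_4 s)) = conj_by 4 w1_3 (f (transpose_mat (x3_2 s))))"
    by (simp only: prescription_def prescription3_def Let_def y3_1_def y3_1n_def y3_2_def y3_2n_def
        if_True simp_thms)
  also have "\<dots> \<longleftrightarrow> (\<forall>x \<in> root_elements \<theta> 3. n3.Rel \<delta> x (f x))"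
    by (simp add: root_elements_def positive_root_elements_def ball_Un iffs cong: ball_cong) auto
  finally show "prescription \<theta> 3 \<delta> f \<longleftrightarrow> (\<forall>x \<in> root_elements \<theta> 3. n3.Rel \<delta> x (f x))" .
qed

end

section \<open>The case $n = 4$\<close>

text \<open>The group reduces to $\Omega_5(3)$, whose five-dimensional Weil representation over $\mathbb{Z}[\omega]$
  leaves a quartic form invariant. Modulo $3$, the values of this form at vectors over $\mathbb{F}_3$ are
  $q(v)^2 - q(v) + \sqrt{-3} k(v)$, where $q$ is the invariant quadratic form and $k$ is the
  polynomial \<open>k4\<close>.\<close>

definition k4 :: "'a::comm_ring_1 \<Rightarrow> 'a \<Rightarrow> 'a \<Rightarrow> 'a \<Rightarrow> 'a \<Rightarrow> 'a" where
  "k4 v1 v2 v3 v4 v5 = (v1 + v5) * (v2 - v4) * (v1 * v5 + v2 * v4)"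

definition K4 :: "'a::comm_ring_1 mat \<Rightarrow> 'a" where
  "K4 p = k4 (p $$ (0, 0)) (p $$ (1, 0)) (p $$ (2, 0)) (p $$ (3, 0)) (p $$ (4, 0))"

text \<open>To be homogeneous of degree four, the term -q has to be read as minus the pairing of v
  with the vector of its cubed coordinates. Cubes have derivative zero modulo 3, so the derivative
  of the form at v along z is (q(v) - 1) <v,z>; brought to the other side of the invariance equation
  it yields the factor 1 - q.\<close>

definition Psi4 :: "'a::comm_ring_1 mat \<Rightarrow> 'a mat \<Rightarrow> 'a" where
  "Psi4 H N = (1 - H $$ (0, 0)) * N $$ (0, 0)"

text \<open>The factor after 1 - q is the pairing of Av with Xv, for the matrices A and X that
  belong to x_1(t). The right-hand side is a certificate of membership in the ideal generated by 3
  and all x^3 - x.\<close>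

lemma k4_x1:
  fixes t :: "'a::comm_ring_1"
  shows "k4 (v1 + t * v2) v2 v3 (v4 + t * v5) v5 -
      (k4 v1 v2 v3 v4 v5 + (1 - (v1 * v5 - v2 * v4 + v3 * v3 - v4 * v2 + v5 * v1)) *
        ((v1 + t * v2) * (t * v5) - v2 * (t * v4 + t ^ 2 * v5) + v3 * (- t * v3) - (v4 +
            t * v5) * (t * v2) + v5 * (t * v1 + t ^ 2 * v2)))
    = 3 * (- 4 * t * v1 * v2 * v4 * v5 + t * v1 * v2 ^ 2 * v5 - t * v1 * v5 + t * v1 ^ 2 * v5 ^ 2 + t
      * v2 * v4 - t * v2 * v4 * v5 ^ 2 + t * v2 ^ 2 * v4 ^ 2 - t ^ 2 * v1 * v2 * v5 ^ 2 - t ^ 2 * v2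
      ^ 2 * v4 * v5) + (t ^ 3 - t) * (- 2 * v2 ^ 2 * v5 ^ 2) + (v2 ^ 3 - v2) * (t * v4 + 2 * t ^ 2 *
      v5) + (v3 ^ 3 - v3) * (- t * v3) + (v5 ^ 3 - v5) * (- t * v1 - 2 * t ^ 2 * v2)"
  by (simp add: k4_def power2_eq_square power3_eq_cube algebra_simps)

text \<open>The same for x_2(t, u), whose entry u is replaced by its residue -t^2 modulo the
  annihilator of \<E>.\<close>

lemma k4_x2:
  fixes t :: "'a::comm_ring_1"
  shows "k4 v1 (v2 + (t * v3 - t ^ 2 * v4)) (v3 + t * v4) v4 v5 -
      (k4 v1 v2 v3 v4 v5 + (1 - (v1 * v5 - v2 * v4 + v3 * v3 - v4 * v2 + v5 * v1)) *
        (v1 * (- t * v3 + t ^ 2 * v4) - (v2 + (t * v3 - t ^ 2 * v4)) * 0 + (v3 +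
            t * v4) * (- t * v1 - t * v5) - v4 * (t ^ 2 * v1 + t ^ 2 * v5) + v5 * (- t * v3 +
            t ^ 2 * v4)))
    = 3 * (2 * t * v1 * v2 * v3 * v4 - t * v1 * v3 * v4 ^ 2 - t * v1 * v3 * v5 ^ 2 - t * v1 ^ 2 * v3
      * v5 + 2 * t * v2 * v3 * v4 * v5 - t * v3 * v4 ^ 2 * v5 + t ^ 2 * v1 * v4 - t ^ 2 * v1 * v4 *
      v5 ^ 2 - t ^ 2 * v1 ^ 2 * v4 * v5 + t ^ 2 * v4 * v5) + (t ^ 3 - t) * (t * v1 * v4 ^ 3 + t * v4
      ^ 3 * v5 - 2 * v1 * v3 * v4 ^ 2 - 2 * v3 * v4 ^ 2 * v5) + (v3 ^ 3 - v3) * (- 2 * t * v1 - 2 * t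
      * v5) + (v4 ^ 3 - v4) * (2 * t ^ 2 * v1 + 2 * t ^ 2 * v5)"
  by (simp add: k4_def power2_eq_square power3_eq_cube algebra_simps)

lemma carrier_mat_5_1:
  assumes "p \<in> carrier_mat 5 1"
  obtains v1 v2 v3 v4 v5 where "p = mat_of_rows_list 1 [[v1], [v2], [v3], [v4], [v5]]"
  using mat_eq_rows_list[OF assms] by (simp add: upt_small)

lemma K4_rows: "K4 (mat_of_rows_list 1 [[v1], [v2], [v3], [v4], [v5]]) = k4 v1 v2 v3 v4 v5"
  by (simp add: K4_def numeral_eq_Suc)

lemma zero_mat5_rows:
  "0\<^sub>m 5 5 = mat_of_rows_list 5 [[0,0,0,0,0],[0,0,0,0,0],[0,0,0,0,0],[0,0,0,0,0],[0,0,0,0,0]]"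
  by (subst rows5[of "0\<^sub>m 5 5"]) (simp_all add: rows_eval)

lemma mat_diag_rows:
  "mat_diag 5 ((!) [a, b, c, d, e]) =
    mat_of_rows_list 5 [[a,0,0,0,0],[0,b,0,0,0],[0,0,c,0,0],[0,0,0,d,0],[0,0,0,0,e]]"
  by (subst rows5[of "mat_diag 5 ((!) [a, b, c, d, e])"]) (simp_all add: rows_eval mat_diag_def)

section \<open>The cocycle data for n = 4\<close>

context involution_ring
begin

lemma gram_rows5: "length rs = 5 \<Longrightarrow>
    gram (mat_of_rows_list k rs) z = transpose_mat (mat_of_rows_list k rs) * Q 5 * z"
  by (simp add: gram_def)

lemma Psi4_rows:
  "Psi4 (gram (mat_of_rows_list 1 [[v1], [v2], [v3], [v4], [v5]]) (mat_of_rows_list 1 [[v1], [v2],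
      [v3], [v4], [v5]]))
      (gram (mat_of_rows_list 1 [[p1], [p2], [p3], [p4], [p5]]) (mat_of_rows_list 1 [[x1], [x2],
          [x3], [x4], [x5]]))
    = (1 - (v1 * v5 - v2 * v4 + v3 * v3 - v4 * v2 + v5 * v1)) * (p1 * x5 - p2 * x4 + p3 * x3 -
        p4 * x2 + p5 * x1)"
  by (simp add: Psi4_def gram_rows5 Q5_rows mat_eval algebra_simps)

lemma K4_cong:
  assumes p: "p \<in> carrier_mat 5 1" and pp: "mcong p p'"
  shows "cong (K4 p) (K4 p')"
proof -
  have "cong (p $$ (i, 0)) (p' $$ (i, 0))" if "i < 5" for i
    by (rule mcong_index[OF pp p that]) simp
  then show ?thesis
    unfolding K4_def k4_def by (intro cong_intros) simp_all
qed

lemma K4_scale: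
  assumes p: "p \<in> carrier_mat 5 1" and c: "cong (c * c) 1"
  shows "cong (K4 (c \<cdot>\<^sub>m p)) (K4 p)"
proof -
  obtain v1 v2 v3 v4 v5 where p: "p = mat_of_rows_list 1 [[v1], [v2], [v3], [v4], [v5]]"
    using p by (rule carrier_mat_5_1)
  have "k4 (c * v1) (c * v2) (c * v3) (c * v4) (c * v5) = (c * c) * (c * c) * k4 v1 v2 v3 v4 v5"
    by (simp add: k4_def algebra_simps)
  moreover have "cong ((c * c) * (c * c) * k4 v1 v2 v3 v4 v5) (1 * 1 * k4 v1 v2 v3 v4 v5)"
    by (intro cong_mult c cong_refl)
  ultimately show ?thesis by (simp add: p mat_eval K4_rows[unfolded One_nat_def])
qed

lemma unit_cancel:
  fixes c x :: 'a
  assumes "c dvd 1" "c * x = 0" shows "x = 0"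
proof -
  obtain r where r: "c * r = 1" using assms(1) by (metis dvdE)
  have "x = c * r * x" by (simp only: r mult_1_left)
  also have "\<dots> = r * (c * x)" by (simp only: mult_ac)
  finally show ?thesis by (simp only: assms(2) mult_zero_right)
qed

lemma double_zero: "x + x = 0 \<Longrightarrow> x = (0::'a)"
  by (rule two_cancel) (simp only: mult_2 mult_zero_right)

text \<open>The three sums are values of one quadratic form at vectors that differ by signs; they
  suffice because 2 is invertible.\<close>

lemma three_forms_zero:
  fixes a x y :: 'a
  assumes "a + (x + x) + (y + y) = 0" "a - (x + x) - (y + y) = 0" "a + (x + x) - (y + y) = 0"
  shows "a = 0" "x = 0" "y = 0"
proof -
  have "a + a = (a + (x + x) + (y + y)) + (a - (x + x) - (y + y))" by simp
  also have "\<dots> = 0" by (simp only: assms add_0)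
  finally show a: "a = 0" by (rule double_zero)
  have "(x + x) + (x + x) = (a + (x + x) + (y + y)) + (a + (x + x) - (y + y)) - (a + a)" by simp
  also have "\<dots> = 0" by (simp only: assms) (simp add: a)
  finally show x: "x = 0" by (rule double_zero[OF double_zero])
  have "y + y = 0" using assms(1) a x by simp
  then show "y = 0" by (rule double_zero)
qed

text \<open>The test yields <v,Zv> = 0 only where 1 - q(v) is a unit, so the vectors must be chosen
  with care. Since conjugation is -1 on \<E>, unitarity makes Q Z symmetric rather than skew, and a
  symmetric form that vanishes at enough vectors is zero.\<close>

lemma faithful4:
  assumes Z: "Z \<in> EM 5 5" and SU: "1\<^sub>m 5 + Z \<in> carrier (SU \<theta> 5)"
    and P: "\<And>p. p \<in> carrier_mat 5 1 \<Longrightarrow> Psi4 (gram p p) (gram p (Z * p)) = 0"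
  shows "Z = 0\<^sub>m 5 5"
proof -
  define z where "z i j = Z $$ (i, j)" for i j
  \<comment> \<open>N is \<open>Q 5 * Z\<close>: the reversed row index and the alternating sign are
    the entries of \<open>Q 5\<close>.\<close>
  define N where "N i j = (if even i then z (4 - i) j else - z (4 - i) j)" for i j
  have Zr: "Z = mat_of_rows_list 5 [[N 4 0, N 4 1, N 4 2, N 4 3, N 4 4], [- N 3 0, - N 3 1, - N 3 2,
      - N 3 3, - N 3 4], [N 2 0, N 2 1, N 2 2, N 2 3, N 2 4], [- N 1 0, - N 1 1, - N 1 2, - N 1 3, -
      N 1 4], [N 0 0, N 0 1, N 0 2, N 0 3, N 0 4]]"
    using mat_eq_rows_list[OF EM_carrier[OF Z]] by (simp add: upt_small z_def N_def)
  have NE: "N i j \<in> \<E> \<theta>" if "i < 5" "j < 5" for i j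
    using Z that by (simp add: EM_def N_def z_def EE_uminus)
  have th: "\<theta> (N i j) = - N i j" if "i < 5" "j < 5" for i j
    by (rule theta_EE[OF NE[OF that]])
  have "((1\<^sub>m 5 + Z) * Q 5 * transpose_mat (map_mat \<theta> (1\<^sub>m 5 + Z))) $$ (i, j) = Q 5 $$ (i, j)" for i j
    using SU by (simp add: in_SU)
  note u = this[unfolded Zr one_mat5_rows Q5_rows]
  have sym: "N 1 0 = N 0 1" "N 2 0 = N 0 2" "N 3 0 = N 0 3" "N 4 0 = N 0 4" "N 2 1 = N 1 2" "N 3 1 =
      N 1 3" "N 4 1 = N 1 4" "N 3 2 = N 2 3" "N 4 2 = N 2 4" "N 4 3 = N 3 4"
    using u[of 4 3]
      u[of 4 2]
      u[of 4 1]
      u[of 4 0]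
      u[of 3 2]
      u[of 3 1]
      u[of 3 0]
      u[of 2 1]
      u[of 2 0]
      u[of 1 0]
    by (simp_all add: mat_eval plus_mat_of_rows_list theta_simps th EE_EE[OF NE NE] algebra_simps)
  have ev: "v1 * v1 * N 0 0 + v1 * v2 * N 0 1 + v1 * v3 * N 0 2 + v1 * v4 * N 0 3 +
      v1 * v5 * N 0 4 + v2 * v1 * N 1 0 + v2 * v2 * N 1 1 + v2 * v3 * N 1 2 + v2 * v4 * N 1 3 +
      v2 * v5 * N 1 4 + v3 * v1 * N 2 0 + v3 * v2 * N 2 1 + v3 * v3 * N 2 2 + v3 * v4 * N 2 3 +
      v3 * v5 * N 2 4 + v4 * v1 * N 3 0 + v4 * v2 * N 3 1 + v4 * v3 * N 3 2 + v4 * v4 * N 3 3 +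
      v4 * v5 * N 3 4 + v5 * v1 * N 4 0 + v5 * v2 * N 4 1 + v5 * v3 * N 4 2 + v5 * v4 * N 4 3 +
      v5 * v5 * N 4 4 = 0"
    if "(1 - (v1 * v5 - v2 * v4 + v3 * v3 - v4 * v2 + v5 * v1)) dvd 1" for v1 v2 v3 v4 v5
  proof -
    have "Psi4 (gram (mat_of_rows_list 1 [[v1], [v2], [v3], [v4], [v5]]) (mat_of_rows_list 1 [[v1],
        [v2], [v3], [v4], [v5]])) (gram (mat_of_rows_list 1 [[v1], [v2], [v3], [v4],
        [v5]]) (Z * mat_of_rows_list 1 [[v1], [v2], [v3], [v4], [v5]])) = 0"
      by (rule P) simp
    then have "(1 - (v1 * v5 - v2 * v4 + v3 * v3 - v4 * v2 + v5 * v1)) * (v1 * v1 * N 0 0 +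
        v1 * v2 * N 0 1 + v1 * v3 * N 0 2 + v1 * v4 * N 0 3 + v1 * v5 * N 0 4 + v2 * v1 * N 1 0 +
        v2 * v2 * N 1 1 + v2 * v3 * N 1 2 + v2 * v4 * N 1 3 + v2 * v5 * N 1 4 + v3 * v1 * N 2 0 +
        v3 * v2 * N 2 1 + v3 * v3 * N 2 2 + v3 * v4 * N 2 3 + v3 * v5 * N 2 4 + v4 * v1 * N 3 0 +
        v4 * v2 * N 3 1 + v4 * v3 * N 3 2 + v4 * v4 * N 3 3 + v4 * v5 * N 3 4 + v5 * v1 * N 4 0 +
        v5 * v2 * N 4 1 + v5 * v3 * N 4 2 + v5 * v4 * N 4 3 + v5 * v5 * N 4 4) = 0"
      unfolding Zr by (simp add: mat_eval Psi4_rows[unfolded One_nat_def] algebra_simps)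
    then show ?thesis by (rule unit_cancel[OF that])
  qed
  have two: "(2::'a) dvd 1" using two_half by (metis dvd_triv_left)
  \<comment> \<open>The variables of \<open>ev\<close> are filled in the order v1 v5 v2 v4 v3. The
    third basis vector cannot be used, as q = 1 there.\<close>
  have d: "N 0 0 = 0" "N 1 1 = 0" "N 3 3 = 0" "N 4 4 = 0"
    using ev[of 1 0 0 0 0] ev[of 0 0 1 0 0] ev[of 0 0 0 1 0] ev[of 0 1 0 0 0] by simp_all
  \<comment> \<open>The sign in the last vector matters: e_2 - e_4 has q = 2, whereas e_2 + e_4
    would give 1 - q = 3, possibly a non-unit.\<close>
  have o: "N 0 1 = 0" "N 0 3 = 0" "N 1 4 = 0" "N 3 4 = 0" "N 0 4 = 0" "N 1 3 = 0"
    using ev[of 1 0 1 0 0]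
      ev[of 1 0 0 1 0]
      ev[of 0 1 1 0 0]
      ev[of 0 1 0 1 0]
      ev[of 1 1 0 0 0]
      ev[of 0 0 1 "- 1" 0]
    by - (rule double_zero, simp add: sym[unfolded One_nat_def] d[unfolded One_nat_def])+
  \<comment> \<open>All vectors used here and in the next step have q = 3 or q = -1, so that 1 - q
    is -2 or 2.\<close>
  have "N 2 2 = 0" "N 0 2 = 0" "N 2 4 = 0"
    by - (rule three_forms_zero[of "N 2 2" "N 0 2" "N 2 4"];
      use ev[of 1 1 0 0 1] ev[of "- 1" "- 1" 0 0 1] ev[of 1 "- 1"
          0 0 1] in \<open>simp add: sym[unfolded One_nat_def] d[unfolded One_nat_def] o[unfolded
          One_nat_def] two algebra_simps\<close>)+
  moreover have "N 1 2 = 0" "N 2 3 = 0"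
    by - (rule three_forms_zero[of "N 2 2" "N 1 2" "N 2 3"];
      use ev[of 0 0 1 1 1] ev[of 0 0 "- 1" "- 1" 1] ev[of 0 0 1 "- 1"
          1] in \<open>simp add: sym[unfolded One_nat_def] d[unfolded One_nat_def] o[unfolded One_nat_def]
          two algebra_simps\<close>)+
  ultimately show ?thesis
    by (simp add: Zr zero_mat5_rows sym[unfolded One_nat_def] d[unfolded One_nat_def] o[unfolded
        One_nat_def])
qed

lemma one_half_A: "(1, half) \<in> \<A> \<theta>"
  using double_half[of 1] by (simp add: \<A>_def theta_one theta_half)

text \<open>x_1(1), x_4(1) and their transposes force a diagonal matrix but do not involve the third
  coordinate; the pair (1, 1/2) provides a root element x_2 that ties the middle entry to the
  others.\<close>

lemma centre4:
  assumes z: "z \<in> centre (E_sc \<theta> 4)"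
  shows "\<exists>c. z = c \<cdot>\<^sub>m 1\<^sub>m 5 \<and> c * \<theta> c = 1"
proof -
  have zE: "z \<in> carrier (E_sc \<theta> 4)" using z by (simp add: centre_def)
  have comm: "z * x = x * z" if "x \<in> root_elements \<theta> 4" for x
    using z root_E[OF that] by (simp add: centre_def)
  have zc: "z \<in> carrier_mat 5 5" using E_carrier[OF _ zE] by simp
  define y where "y i j = z $$ (i, j)" for i j
  have zr: "z = mat_of_rows_list 5 [[y 0 0, y 0 1, y 0 2, y 0 3, y 0 4], [y 1 0, y 1 1, y 1 2,
      y 1 3, y 1 4], [y 2 0, y 2 1, y 2 2, y 2 3, y 2 4], [y 3 0, y 3 1, y 3 2, y 3 3, y 3 4],
      [y 4 0, y 4 1, y 4 2, y 4 3, y 4 4]]"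
    using mat_eq_rows_list[OF zc] by (simp add: upt_small y_def)
  have roots: "x4_1 \<theta> 1 \<in> root_elements \<theta> 4" "transpose_mat (x4_1 \<theta> 1) \<in> root_elements \<theta> 4"
    "x4_4 \<theta> 1 \<in> root_elements \<theta> 4" "transpose_mat (x4_4 \<theta> 1) \<in> root_elements \<theta> 4"
    "x4_2 \<theta> 1 half \<in> root_elements \<theta> 4"
    using one_half_A by (auto simp: root_elements_def positive_root_elements_def)
  have c: "(z * x) $$ (i, j) = (x * z) $$ (i, j)" if "x \<in> root_elements \<theta> 4" for x i j
    using comm[OF that] by simp
  have off1: "y 1 0 = 0" "y 1 3 = 0" "y 2 0 = 0" "y 2 3 = 0" "y 4 0 = 0" "y 4 3 = 0" "y 1 2 = 0"
      "y 4 2 = 0" "y 0 1 = 0" "y 0 4 = 0" "y 2 1 = 0" "y 2 4 = 0" "y 3 1 = 0" "y 3 4 = 0" "y 0 2 =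
      0" "y 3 2 = 0"
    using c[OF roots(1), of 1 1]
      c[OF roots(1), of 1 4]
      c[OF roots(1), of 2 1]
      c[OF roots(1), of 2 4]
      c[OF roots(1), of 4 1]
      c[OF roots(1), of 4 4]
      c[OF roots(1), of 0 2]
      c[OF roots(1), of 3 2]
      c[OF roots(2), of 0 0]
      c[OF roots(2), of 0 3]
      c[OF roots(2), of 2 0]
      c[OF roots(2), of 2 3]
      c[OF roots(2), of 3 0]
      c[OF roots(2), of 3 3]
      c[OF roots(2), of 1 2]
      c[OF roots(2), of 4 2]
    by (simp_all add: zr x4_1_rows x4_1_transpose_rows mat_eval theta_one)
  have off2: "y 0 3 = 0" "y 3 0 = 0" "y 1 4 = 0" "y 4 1 = 0"
    using c[OF roots(3), of 3 3] c[OF roots(4), of 0 0] c[OF roots(1), of 0 4] c[OF roots(1), of 3 1]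
    by (simp_all add: zr x4_1_rows x4_4_rows x4_4_transpose_rows mat_eval theta_one off1[unfolded
        One_nat_def])
  note off = off1 off2
  have diag: "y 1 1 = y 0 0" "y 2 2 = y 0 0" "y 3 3 = y 0 0" "y 4 4 = y 0 0"
    using c[OF roots(1), of 0 1] c[OF roots(5), of 1 2] c[OF roots(3), of 0 3] c[OF roots(3), of 1 4]
    by (simp_all add: zr x4_1_rows x4_2_rows x4_4_rows mat_eval off[unfolded One_nat_def] theta_one)
  have "z = y 0 0 \<cdot>\<^sub>m 1\<^sub>m 5"
    by (simp add: zr off[unfolded One_nat_def] diag[unfolded One_nat_def] one_mat_rows mat_eval)
  moreover have "y 0 0 * \<theta> (y 0 0) = 1"
  proof -
    have "(z * Q 5 * transpose_mat (map_mat \<theta> z)) $$ (0, 4) = Q 5 $$ (0, 4)"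
      using E_SU[OF _ zE] by (simp add: in_SU)
    then show ?thesis unfolding zr by (simp add: off[unfolded One_nat_def] diag[unfolded
        One_nat_def] theta_zero Q5_rows mat_eval)
  qed
  ultimately show ?thesis by blast
qed

lemma cocycle_data4: "cocycle_data \<theta> 4 1 K4 Psi4"
proof (rule cocycle_data.intro[OF involution_ring_axioms cocycle_data_axioms.intro], simp_all)
  fix H N N' :: "'a mat" and c assume N: "N \<in> carrier_mat (Suc 0) (Suc 0)"
  then show "Psi4 H (c \<cdot>\<^sub>m N) = c * Psi4 H N" by (simp add: Psi4_def algebra_simps)
  assume "N' \<in> carrier_mat (Suc 0) (Suc 0)"
  then show "Psi4 H (N + N') = Psi4 H N + Psi4 H N'" using N by (simp add: Psi4_def algebra_simps)
next
  fix H H' N :: "'a mat"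
  assume H: "H \<in> carrier_mat (Suc 0) (Suc 0)" "mcong H H'" and N: "N \<in> EM (Suc 0) (Suc 0)"
  have "N $$ (0, 0) * H $$ (0, 0) = N $$ (0, 0) * H' $$ (0, 0)"
    using congD[OF mcong_index[OF H(2,1), of 0 0], of "N $$ (0, 0)"] N by (simp add: EM_def)
  then show "Psi4 H N = Psi4 H' N" by (simp add: Psi4_def algebra_simps)
qed (use K4_cong K4_scale faithful4 centre4 in \<open>simp_all\<close>)

end

section \<open>The prescribed images for n = 4\<close>

context involution_ring
begin

interpretation n4: cocycle_data \<theta> 4 1 K4 Psi4
  rewrites "4 + (1::nat) = 5"
  by (rule cocycle_data4) simp

lemma root4_E:
  "x4_1 \<theta> t \<in> carrier (E_sc \<theta> 4)" "transpose_mat (x4_1 \<theta> t) \<in> carrier (E_sc \<theta> 4)"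
  "x4_4 \<theta> t \<in> carrier (E_sc \<theta> 4)" "transpose_mat (x4_4 \<theta> t) \<in> carrier (E_sc \<theta> 4)"
  "(t, u) \<in> \<A> \<theta> \<Longrightarrow> x4_2 \<theta> t u \<in> carrier (E_sc \<theta> 4)"
  "(t, u) \<in> \<A> \<theta> \<Longrightarrow> transpose_mat (x4_2 \<theta> t u) \<in> carrier (E_sc \<theta> 4)"
  "(t, u) \<in> \<A> \<theta> \<Longrightarrow> x4_3 \<theta> t u \<in> carrier (E_sc \<theta> 4)"
  "(t, u) \<in> \<A> \<theta> \<Longrightarrow> transpose_mat (x4_3 \<theta> t u) \<in> carrier (E_sc \<theta> 4)"
proof -
  have E: "x \<in> carrier (E_sc \<theta> 4)" "transpose_mat x \<in> carrier (E_sc \<theta> 4)"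
    if "x \<in> positive_root_elements \<theta> 4" for x
    using that by (auto intro!: root_E simp: root_elements_def)
  have P: "x4_1 \<theta> t \<in> positive_root_elements \<theta> 4" "x4_4 \<theta> t \<in> positive_root_elements \<theta> 4"
    "(t, u) \<in> \<A> \<theta> \<Longrightarrow> x4_2 \<theta> t u \<in> positive_root_elements \<theta> 4"
    "(t, u) \<in> \<A> \<theta> \<Longrightarrow> x4_3 \<theta> t u \<in> positive_root_elements \<theta> 4"
    by (auto simp: positive_root_elements_def)
  show "x4_1 \<theta> t \<in> carrier (E_sc \<theta> 4)" "transpose_mat (x4_1 \<theta> t) \<in> carrier (E_sc \<theta> 4)"
    "x4_4 \<theta> t \<in> carrier (E_sc \<theta> 4)" "transpose_mat (x4_4 \<theta> t) \<in> carrier (E_sc \<theta> 4)"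
    "(t, u) \<in> \<A> \<theta> \<Longrightarrow> x4_2 \<theta> t u \<in> carrier (E_sc \<theta> 4)"
    "(t, u) \<in> \<A> \<theta> \<Longrightarrow> transpose_mat (x4_2 \<theta> t u) \<in> carrier (E_sc \<theta> 4)"
    "(t, u) \<in> \<A> \<theta> \<Longrightarrow> x4_3 \<theta> t u \<in> carrier (E_sc \<theta> 4)"
    "(t, u) \<in> \<A> \<theta> \<Longrightarrow> transpose_mat (x4_3 \<theta> t u) \<in> carrier (E_sc \<theta> 4)"
    by (rule E P | assumption)+
qed

lemma E4_mult: "A \<in> carrier (E_sc \<theta> 4) \<Longrightarrow> B \<in> carrier (E_sc \<theta> 4) \<Longrightarrow> A * B \<in> carrier (E_sc \<theta> 4)"
  by (rule E_mult) simp_all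

lemma w4_E: "w1_4 \<in> carrier (E_sc \<theta> 4)" "v2_4 \<in> carrier (E_sc \<theta> 4)"
proof -
  have "w1_4 = x4_1 \<theta> 1 * transpose_mat (x4_1 \<theta> (- 1)) * x4_1 \<theta> 1"
    by (simp add: w1_4_rows x4_1_rows x4_1_transpose_rows mat_eval theta_simps)
  then show "w1_4 \<in> carrier (E_sc \<theta> 4)" using E4_mult root4_E by metis
  obtain h :: 'a where h: "h = half" by blast
  have hh: "2 * h = 1" "h * 2 = 1" "h + h = 1"
    using two_half double_half[of 1] by (simp_all add: h mult.commute)
  have A: "(- 2, 2) \<in> \<A> \<theta>" by (simp add: \<A>_def theta_simps)
  have "v2_4 = x4_2 \<theta> 1 h * transpose_mat (x4_2 \<theta> (- 2) 2) * x4_2 \<theta> 1 h"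
    by (simp add: v2_4_rows x4_2_rows x4_2_transpose_rows mat_eval theta_simps hh flip: h)
  then show "v2_4 \<in> carrier (E_sc \<theta> 4)"
    unfolding h using E4_mult root4_E(5,6) A one_half_A by metis
qed

lemma EE_two: "e \<in> \<E> \<theta> \<Longrightarrow> 2 * e = - e"
proof -
  assume "e \<in> \<E> \<theta>"
  moreover have "2 * e = 3 * e - e" by simp
  ultimately show ?thesis using EE_three by simp
qed

lemma EE_half: "e \<in> \<E> \<theta> \<Longrightarrow> half * e = - e"
proof (rule two_cancel)
  assume e: "e \<in> \<E> \<theta>"
  have "2 * (half * e) = (2 * half) * e" by (simp only: mult.assoc)
  then show "2 * (half * e) = 2 * - e"
    using EE_two[OF EE_uminus[OF e]] by (simp only: two_half mult_1_left minus_minus)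
qed

text \<open>\<open>?D2 e\<close> is the scalar 1 - e on the middle three coordinates: its norm is
  one since \<open>e\<close> is skew, and its determinant is 1 - 3 e = 1. \<open>?D3 e\<close> is
  its conjugate by w_1. In the product at -e the third entry becomes (1 + e)^2 = 1 + 2 e = 1 -
  e.\<close>

lemma diag4_E:
  assumes e: "e \<in> \<E> \<theta>"
  shows "mat_of_rows_list 5 [[1 + e,0,0,0,0],[0,1 + e,0,0,0],[0,0,1 - e,0,0],[0,0,0,1 +
      e,0],[0,0,0,0,1 + e]]
    \<in> carrier (E_sc \<theta> 4)" (is "?D \<in> _")
proof -
  let ?D2 = "\<lambda>e. mat_of_rows_list 5 [[1,0,0,0,0],[0,1 - e,0,0,0],[0,0,1 - e,0,0],[0,0,0,1 -
      e,0],[0,0,0,0,1]]"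
  let ?D3 = "\<lambda>e. mat_of_rows_list 5 [[1 - e,0,0,0,0],[0,1,0,0,0],[0,0,1 -
      e,0,0],[0,0,0,1,0],[0,0,0,0,1 - e]]"
  have D2: "?D2 e \<in> carrier (E_sc \<theta> 4)" if e: "e \<in> \<E> \<theta>" for e
  proof -
    obtain h :: 'a where h: "h = half" by blast
    have th: "\<theta> e = - e" by (rule theta_EE[OF e])
    have r: "e * e = 0" "h * e = - e" "e * h = - e"
      using EE_EE[OF e e] EE_half[OF e] by (simp_all add: h mult.commute)
    have r3: "3 * e = 0" "2 * e = - e" "e * 2 = - e"
        using EE_three[OF e] EE_two[OF e] by (simp_all add: mult.commute)
    have s: "e + e = - e" "e + (e + x) = x - e" "- e - e = e" "x - e - e = x + e" for x
    proof -
      show 1: "e + e = - e" using r3(2) by simp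
      then show "e + (e + x) = x - e" by (simp add: add.assoc[symmetric])
      have "- e - e = - (e + e)" by simp
      then show 2: "- e - e = e" by (simp only: 1 minus_minus)
      have "x - e - e = x + (- e - e)" by simp
      then show "x - e - e = x + e" by (simp only: 2)
    qed
    have h1: "h + h = 1" "2 * h = 1" using double_half[of 1] two_half by (simp_all add: h)
    have th_h: "\<theta> h = h" by (simp add: h theta_half)
    \<comment> \<open>The commutator of x_{-2}(1, 1/2) and x_2(e, 0), followed by x_{-2}(0, e),
      which removes its unipotent part.\<close>
    have "?D2 e = transpose_mat (x4_2 \<theta> 1 h) * x4_2 \<theta> e 0 * transpose_mat (x4_2 \<theta> (- 1) h) *
        (x4_2 \<theta> (- e) 0 * transpose_mat (x4_2 \<theta> 0 e))"
      by (simp add: x4_2_rows x4_2_transpose_rows mat_eval theta_simps th r r3 s h1 algebra_simps)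
    moreover have "(- 1, h) \<in> \<A> \<theta>" "(1, h) \<in> \<A> \<theta>" "(e, 0) \<in> \<A> \<theta>" "(- e, 0) \<in> \<A> \<theta>" "(0, e) \<in> \<A> \<theta>"
      using h1 by (simp_all add: \<A>_def theta_simps th r th_h)
    ultimately show ?thesis using E4_mult root4_E(5,6) by metis
  qed
  have D3: "?D3 e \<in> carrier (E_sc \<theta> 4)" if e: "e \<in> \<E> \<theta>" for e
  proof -
    have "w1_4 * ?D2 e * inv\<^bsub>E_sc \<theta> 4\<^esub> w1_4 = ?D3 e"
      by (rule n4.conj_by_E(2)[OF w4_E(1)]) (simp_all add: w1_4_rows mat_eval)
    then show ?thesis using E4_mult D2[OF e] w4_E(1) E_inv(1)[OF _ w4_E(1)] by (metis insertI1 insertI2)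
  qed
  have r: "e * e = 0" by (rule EE_EE[OF e e])
  have "?D = ?D2 (- e) * ?D3 (- e)"
    by (simp add: mat_eval r EE_two[OF e] distrib_left distrib_right add.assoc)
  then show ?thesis using E4_mult D2[OF EE_uminus[OF e]] D3[OF EE_uminus[OF e]] by metis
qed

definition y4_1 :: "'a \<Rightarrow> 'a \<Rightarrow> 'a mat" where
  "y4_1 \<delta> t = mat_diag 5 ((!) [1 + plus_part \<theta> t * \<delta>, 1 + plus_part \<theta> t * \<delta>, 1 - plus_part \<theta> t * \<delta>,
     1 + plus_part \<theta> t * \<delta>, 1 + plus_part \<theta> t * \<delta>]) * x4_1 \<theta> t"

definition y4_1n :: "'a \<Rightarrow> 'a \<Rightarrow> 'a mat" where
  "y4_1n \<delta> t = mat_diag 5 ((!) [1 - plus_part \<theta> t * \<delta>, 1 - plus_part \<theta> t * \<delta>, 1 + plus_part \<theta> t * \<delta>,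
     1 - plus_part \<theta> t * \<delta>, 1 - plus_part \<theta> t * \<delta>]) * transpose_mat (x4_1 \<theta> t)"

definition y4_2 :: "'a \<Rightarrow> 'a \<Rightarrow> 'a \<Rightarrow> 'a mat" where
  "y4_2 \<delta> t u = x4_2 \<theta> t u
     - plus_part \<theta> t * \<delta> \<cdot>\<^sub>m (E5 1 3 + E5 5 3 + E5 3 1 + E5 3 5)
     + (plus_part \<theta> t)\<^sup>2 * \<delta> \<cdot>\<^sub>m (E5 1 4 + E5 5 4 + E5 2 1 + E5 2 5)"

definition y4_2n :: "'a \<Rightarrow> 'a \<Rightarrow> 'a \<Rightarrow> 'a mat" where
  "y4_2n \<delta> t u = transpose_mat (x4_2 \<theta> t u)
     + plus_part \<theta> t * \<delta> \<cdot>\<^sub>m (E5 1 3 + E5 5 3 + E5 3 1 + E5 3 5)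
     - (plus_part \<theta> t)\<^sup>2 * \<delta> \<cdot>\<^sub>m (E5 1 2 + E5 5 2 + E5 4 1 + E5 4 5)"

lemma EE_mult_mult:
  assumes "\<delta> \<in> \<E> \<theta>"
  shows "\<delta> * t * t = \<delta> * t\<^sup>2" "\<delta> * t * \<theta> t = \<delta> * t\<^sup>2"
  using EE_mult_theta[OF EE_mult[OF assms, of t], of t] by (simp_all add: power2_eq_square mult.assoc)

lemma y4_1_rows:
  assumes "\<delta> \<in> \<E> \<theta>"
  shows "y4_1 \<delta> t = mat_of_rows_list 5 [[1 + \<delta> * t, t + \<delta> * t\<^sup>2, 0, 0, 0], [0, 1 + \<delta> * t, 0, 0, 0],
    [0, 0, 1 - \<delta> * t, 0, 0], [0, 0, 0, 1 + \<delta> * t, \<theta> t + \<delta> * t\<^sup>2], [0, 0, 0, 0, 1 + \<delta> * t]]"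
  by (simp add: y4_1_def mat_diag_rows x4_1_rows mat_eval plus_part_mult[OF assms] EE_mult_mult[OF
      assms]
      distrib_right)

lemma y4_1n_rows:
  assumes "\<delta> \<in> \<E> \<theta>"
  shows "y4_1n \<delta> t = mat_of_rows_list 5 [[1 - \<delta> * t, 0, 0, 0, 0], [t - \<delta> * t\<^sup>2, 1 - \<delta> * t, 0, 0, 0],
    [0, 0, 1 + \<delta> * t, 0, 0], [0, 0, 0, 1 - \<delta> * t, 0], [0, 0, 0, \<theta> t - \<delta> * t\<^sup>2, 1 - \<delta> * t]]"
  by (simp add: y4_1n_def mat_diag_rows x4_1_transpose_rows mat_eval plus_part_mult[OF assms]
      EE_mult_mult[OF assms] left_diff_distrib)

lemma y4_2_rows:
  assumes "\<delta> \<in> \<E> \<theta>"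
  shows "y4_2 \<delta> t u = mat_of_rows_list 5 [[1, 0, - (\<delta> * t), \<delta> * t\<^sup>2, 0], [\<delta> * t\<^sup>2, 1, t, u, \<delta> * t\<^sup>2],
    [- (\<delta> * t), 0, 1, \<theta> t, - (\<delta> * t)], [0, 0, 0, 1, 0], [0, 0, - (\<delta> * t), \<delta> * t\<^sup>2, 1]]"
  by (subst rows5) (simp_all add: y4_2_def x4_2_rows rows_eval plus_part_mult[OF assms])

lemma y4_2n_rows:
  assumes "\<delta> \<in> \<E> \<theta>"
  shows "y4_2n \<delta> t u = mat_of_rows_list 5 [[1, - (\<delta> * t\<^sup>2), \<delta> * t, 0, 0], [0, 1, 0, 0, 0],
    [\<delta> * t, t, 1, 0, \<delta> * t], [- (\<delta> * t\<^sup>2), u, \<theta> t, 1, - (\<delta> * t\<^sup>2)], [0, - (\<delta> * t\<^sup>2), \<delta> * t, 0, 1]]"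
  by (subst rows5) (simp_all add: y4_2n_def x4_2_transpose_rows rows_eval plus_part_mult[OF assms])

lemma y4_1_E:
  assumes \<delta>: "\<delta> \<in> \<E> \<theta>"
  shows "y4_1 \<delta> t \<in> carrier (E_sc \<theta> 4)"
proof -
  have e: "\<delta> * t \<in> \<E> \<theta>" by (rule EE_mult[OF \<delta>])
  show ?thesis unfolding y4_1_def mat_diag_rows plus_part_mult(1)[OF \<delta>]
    by (rule E4_mult[OF diag4_E[OF e] root4_E(1)])
qed

text \<open>Modulo the annihilator the equation defining \<A> reads 2 u \<equiv> t^2, and 2 \<equiv>
  -1. Hence corrections attached to x_2(t, u) can be expressed in t alone.\<close>

lemma A_mult_EE:
  assumes e: "e \<in> \<E> \<theta>" and tu: "(t, u) \<in> \<A> \<theta>"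
  shows "e * u = - (e * t\<^sup>2)"
proof -
  have "2 * (e * u) = e * (u + \<theta> u)" by (simp only: EE_mult_theta[OF e] distrib_left mult_2)
  also have "\<dots> = e * (t * \<theta> t)" using tu by (simp add: \<A>_def)
  also have "\<dots> = e * t\<^sup>2" using EE_mult_mult(2)[OF e] by (simp add: mult.assoc)
  finally have "- (e * u) = e * t\<^sup>2" using EE_two[OF EE_mult[OF e]] by simp
  then show ?thesis by (metis minus_minus)
qed

lemma y4_2_E:
  assumes \<delta>: "\<delta> \<in> \<E> \<theta>" and tu: "(t, u) \<in> \<A> \<theta>"
  shows "y4_2 \<delta> t u \<in> carrier (E_sc \<theta> 4)"
proof -
  define e f where "e = \<delta> * t" and "f = \<delta> * t\<^sup>2"
  have e: "e \<in> \<E> \<theta>" and f: "f \<in> \<E> \<theta>" by (simp_all add: e_def f_def EE_mult[OF \<delta>])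
  have z: "e * e = 0" "f * e = 0" "e * f = 0" "f * f = 0" "\<theta> e = - e" "\<theta> f = - f"
    using EE_EE e f theta_EE by auto
  have et: "e * t = f" by (simp add: e_def f_def power2_eq_square mult.assoc)
  \<comment> \<open>Here the relation \<delta> t^3 = \<delta> t closes the computation:
    multiplication by \<open>t\<close> interchanges \<open>e\<close> and \<open>f\<close>.\<close>
  have ft: "f * t = e"
    using EE_cube[OF \<delta>, of t] by (simp add: e_def f_def power2_eq_square power3_eq_cube mult.assoc)
  have tt: "e * \<theta> t = f" "f * \<theta> t = e" using EE_mult_theta e f et ft by auto
  have eu: "e * u = - e" "f * u = - f"
    using A_mult_EE[OF e tu] A_mult_EE[OF f tu] by (simp_all add: power2_eq_square et ft flip:
        mult.assoc)
  have "y4_2 \<delta> t u = x4_3 \<theta> (- e) 0 * transpose_mat (x4_3 \<theta> (- e) 0) *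
      (transpose_mat (x4_1 \<theta> f) * x4_4 \<theta> (- f)) * x4_2 \<theta> t u"
    unfolding y4_2_rows[OF \<delta>] e_def[symmetric] f_def[symmetric]
    by (simp add: x4_3_rows x4_3_transpose_rows x4_1_transpose_rows x4_4_rows x4_2_rows mat_eval
        theta_simps z et ft tt eu EE_two[OF f])
  moreover have "(- e, 0) \<in> \<A> \<theta>" by (simp add: \<A>_def theta_simps z)
  ultimately show ?thesis using E4_mult root4_E tu by metis
qed

lemma cong_two: "cong 2 (- 1)"
  using EE_two by (simp add: cong_def mult.commute)

lemma cong_half: "cong half (- 1)"
  using EE_half by (simp add: cong_def mult.commute)

text \<open>Both 1/2 and 2 are congruent to -1, so v_2 is congruent to the signed permutation matrix
  \<open>?V\<close>, under which \<open>K4\<close> is exactly invariant, as it is under w_1.\<close>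

lemma Rel4_w:
  assumes \<delta>: "\<delta> \<in> \<E> \<theta>"
  shows "n4.Rel \<delta> w1_4 w1_4" "n4.Rel \<delta> v2_4 v2_4"
proof -
  let ?V = "mat_of_rows_list 5 [[1, 0, 0, 0, 0], [0, 0, 0, - 1, 0], [0, 0, - 1, 0, 0], [0, - 1, 0,
      0, 0], [0, 0, 0, 0, 1]]"
  have "mcong v2_4 ?V"
    unfolding v2_4_rows by (rule mcong_rows) (simp_all add: cong_refl cong_half cong_two)
  moreover have "v2_4 \<in> carrier_mat 5 5" by (simp add: v2_4_rows)
  ultimately have V: "mcong (v2_4 * p) (?V * p)" "v2_4 * p \<in> carrier_mat 5 1"
      if "p \<in> carrier_mat 5 1" for p
    using mcong_mult[OF _ mcong_refl _ that] mult_carrier_mat[OF _ that] by blast+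
  have "K4 (w1_4 * p) = K4 p" "K4 (?V * p) = K4 p" if p: "p \<in> carrier_mat 5 1" for p :: "'a mat"
  proof -
    obtain v1 v2 v3 v4 v5 where p: "p = mat_of_rows_list 1 [[v1], [v2], [v3], [v4], [v5]]"
      using p by (rule carrier_mat_5_1)
    show "K4 (w1_4 * p) = K4 p" "K4 (?V * p) = K4 p"
      by (simp_all add: p w1_4_rows mat_eval K4_rows[unfolded One_nat_def] k4_def algebra_simps)
  qed
  then show "n4.Rel \<delta> w1_4 w1_4" "n4.Rel \<delta> v2_4 v2_4"
    using congD[OF K4_cong[OF V(2,1)] \<delta>] by (auto intro!: n4.Rel_refl w4_E simp del: One_nat_def)
qed

lemma Rel4_1:
  assumes \<delta>: "\<delta> \<in> \<E> \<theta>"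
  shows "n4.Rel \<delta> (x4_1 \<theta> t) (y4_1 \<delta> t)"
proof (rule n4.Rel_intro[OF \<delta> root4_E(1) y4_1_E[OF \<delta>], where
    A' = "mat_of_rows_list 5 [[1, t, 0, 0, 0], [0, 1, 0, 0, 0], [0, 0, 1, 0, 0], [0, 0, 0, 1, t],
        [0, 0, 0, 0, 1]]" and
    X = "mat_of_rows_list 5 [[t, t ^ 2, 0, 0, 0], [0, t, 0, 0, 0], [0, 0, - t, 0, 0], [0, 0, 0, t,
        t ^ 2], [0, 0, 0, 0, t]]"])
  fix p :: "'a mat" assume "p \<in> carrier_mat 5 1"
  then obtain v1 v2 v3 v4 v5 where p: "p = mat_of_rows_list 1 [[v1], [v2], [v3], [v4], [v5]]"
    by (rule carrier_mat_5_1)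
  have A: "mat_of_rows_list 5 [[1, t, 0, 0, 0], [0, 1, 0, 0, 0], [0, 0, 1, 0, 0], [0, 0, 0, 1, t],
      [0, 0, 0, 0, 1]] * p =
      mat_of_rows_list 1 [[(v1 + t * v2)], [v2], [v3], [(v4 + t * v5)], [v5]]"
    by (simp add: p mat_eval)
  have X: "mat_of_rows_list 5 [[t, t ^ 2, 0, 0, 0], [0, t, 0, 0, 0], [0, 0, - t, 0, 0], [0, 0, 0, t,
      t ^ 2], [0, 0, 0, 0, t]] * p =
      mat_of_rows_list 1 [[(t * v1 + t ^ 2 * v2)], [(t * v2)], [(- t * v3)], [(t * v4 +
          t ^ 2 * v5)], [(t * v5)]]"
    by (simp add: p mat_eval)
  show "cong (K4 (mat_of_rows_list 5 [[1, t, 0, 0, 0], [0, 1, 0, 0, 0], [0, 0, 1, 0, 0], [0, 0, 0,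
      1, t], [0, 0, 0, 0, 1]] * p))
    (K4 p + Psi4 (gram p p) (gram (mat_of_rows_list 5 [[1, t, 0, 0, 0], [0, 1, 0, 0, 0], [0, 0, 1,
        0, 0], [0, 0, 0, 1, t], [0, 0, 0, 0, 1]] * p) (mat_of_rows_list 5 [[t, t ^ 2, 0, 0, 0], [0,
        t, 0, 0, 0], [0, 0, - t, 0, 0], [0, 0, 0, t, t ^ 2], [0, 0, 0, 0, t]] * p)))"
    unfolding A X unfolding p K4_rows Psi4_rows
    by (rule cong_diffI[OF k4_x1]) (intro cong_cert)
qed (simp_all add: x4_1_rows y4_1_rows[OF \<delta>] mat_eval mcong_rows cong_refl cong_theta)

lemma Rel4_2:
  assumes \<delta>: "\<delta> \<in> \<E> \<theta>" and tu: "(t, u) \<in> \<A> \<theta>"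
  shows "n4.Rel \<delta> (x4_2 \<theta> t u) (y4_2 \<delta> t u)"
proof (rule n4.Rel_intro[OF \<delta> root4_E(5)[OF tu] y4_2_E[OF \<delta> tu], where
    A' = "mat_of_rows_list 5 [[1, 0, 0, 0, 0], [0, 1, t, - (t ^ 2), 0], [0, 0, 1, t, 0], [0, 0, 0,
        1, 0], [0, 0, 0, 0, 1]]" and
    X = "mat_of_rows_list 5 [[0, 0, - t, t ^ 2, 0], [t ^ 2, 0, 0, 0, t ^ 2], [- t, 0, 0, 0, - t],
        [0, 0, 0, 0, 0], [0, 0, - t, t ^ 2, 0]]"])
  fix p :: "'a mat" assume "p \<in> carrier_mat 5 1"
  then obtain v1 v2 v3 v4 v5 where p: "p = mat_of_rows_list 1 [[v1], [v2], [v3], [v4], [v5]]"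
    by (rule carrier_mat_5_1)
  have A: "mat_of_rows_list 5 [[1, 0, 0, 0, 0], [0, 1, t, - (t ^ 2), 0], [0, 0, 1, t, 0], [0, 0, 0,
      1, 0], [0, 0, 0, 0, 1]] * p =
      mat_of_rows_list 1 [[v1], [(v2 + (t * v3 - t ^ 2 * v4))], [(v3 + t * v4)], [v4], [v5]]"
    by (simp add: p mat_eval)
  have X: "mat_of_rows_list 5 [[0, 0, - t, t ^ 2, 0], [t ^ 2, 0, 0, 0, t ^ 2], [- t, 0, 0, 0, - t],
      [0, 0, 0, 0, 0], [0, 0, - t, t ^ 2, 0]] * p =
      mat_of_rows_list 1 [[(- t * v3 + t ^ 2 * v4)], [(t ^ 2 * v1 + t ^ 2 * v5)], [(- t * v1 -
          t * v5)], [0], [(- t * v3 + t ^ 2 * v4)]]"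
    by (simp add: p mat_eval)
  show "cong (K4 (mat_of_rows_list 5 [[1, 0, 0, 0, 0], [0, 1, t, - (t ^ 2), 0], [0, 0, 1, t, 0], [0,
      0, 0, 1, 0], [0, 0, 0, 0, 1]] * p))
    (K4 p + Psi4 (gram p p) (gram (mat_of_rows_list 5 [[1, 0, 0, 0, 0], [0, 1, t, - (t ^ 2), 0], [0,
        0, 1, t, 0], [0, 0, 0, 1, 0], [0, 0, 0, 0, 1]] * p) (mat_of_rows_list 5 [[0, 0, - t, t ^ 2,
        0], [t ^ 2, 0, 0, 0, t ^ 2], [- t, 0, 0, 0, - t], [0, 0, 0, 0, 0], [0, 0, - t, t ^ 2,
        0]] * p)))"
    unfolding A X unfolding p K4_rows Psi4_rows
    by (rule cong_diffI[OF k4_x2]) (intro cong_cert)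
next
  have "cong u (- (t ^ 2))" using A_mult_EE[OF _ tu] by (simp add: cong_def)
  then show "mcong (x4_2 \<theta> t u) (mat_of_rows_list 5 [[1, 0, 0, 0, 0], [0, 1, t, - (t ^ 2), 0], [0,
      0, 1, t, 0], [0, 0, 0, 1, 0], [0, 0, 0, 0, 1]])"
    unfolding x4_2_rows by (intro mcong_rows) (simp_all add: cong_refl cong_theta)
qed (simp_all add: x4_2_rows y4_2_rows[OF \<delta>] mat_eval)

lemma Rel4_1n:
  assumes \<delta>: "\<delta> \<in> \<E> \<theta>"
  shows "n4.Rel \<delta> (transpose_mat (x4_1 \<theta> t)) (y4_1n \<delta> t)"
proof -
  have "conj_by 5 w1_4 (y4_1 \<delta> (- t)) = y4_1n \<delta> t"
    by (rule n4.conj_by_E(1)[OF w4_E(1)])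
      (simp_all add: y4_1_rows[OF \<delta>] y4_1n_rows[OF \<delta>] w1_4_rows mat_eval theta_uminus)
  moreover have "n4.Rel \<delta> (transpose_mat (x4_1 \<theta> t)) (conj_by 5 w1_4 (y4_1 \<delta> (- t)))"
    by (rule n4.Rel_conj[OF Rel4_w(1)[OF \<delta>] Rel4_1[OF \<delta>]])
      (simp_all add: x4_1_rows x4_1_transpose_rows w1_4_rows mat_eval theta_uminus)
  ultimately show ?thesis by simp
qed

lemma Rel4_2n:
  assumes \<delta>: "\<delta> \<in> \<E> \<theta>" and tu: "(t, u) \<in> \<A> \<theta>"
  shows "n4.Rel \<delta> (transpose_mat (x4_2 \<theta> t u)) (y4_2n \<delta> t u)"
proof -
  obtain h :: 'a where h: "h = half" by blast
  have hx: "2 * h = 1" "\<theta> h = h" using two_half theta_half by (simp_all add: h)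
  have h2: "2 * (h * x) = x" "h * (2 * x) = x" for x
    using hx(1) by (simp_all add: mult.commute[of h 2] flip: mult.assoc)
  \<comment> \<open>Chosen so that v_2 conjugates x_2(t', u') to x_{-2}(t, u). Since -1/2 is
    congruent to 1, t' acts on \<delta> like t and the corrections match.\<close>
  define t' u' where "t' = - (h * \<theta> t)" and "u' = h * (h * u)"
  have tt: "\<theta> t' = - (h * t)" by (simp add: t'_def theta_simps hx)
  have "t' * \<theta> t' = t' * - (h * t)" by (simp only: tt)
  also have "\<dots> = h * (h * (t * \<theta> t))" by (simp add: t'_def mult_ac)
  also have "\<dots> = u' + \<theta> u'" using tu by (simp add: \<A>_def u'_def theta_simps hx distrib_left)
  finally have tu': "(t', u') \<in> \<A> \<theta>" by (simp add: \<A>_def)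
  define e f where "e = \<delta> * t" and "f = \<delta> * t\<^sup>2"
  have e: "e \<in> \<E> \<theta>" and f: "f \<in> \<E> \<theta>" by (simp_all add: e_def f_def EE_mult[OF \<delta>])
  have "cong (- (h * \<theta> t)) (- (- 1 * t))"
    unfolding h by (intro cong_uminus cong_mult cong_half cong_theta)
  then have ct: "cong t' t" by (simp add: t'_def)
  have ef: "\<delta> * t' = e" "\<delta> * t'\<^sup>2 = f"
    using congD[OF ct \<delta>] congD[OF cong_power[OF ct] \<delta>] by (simp_all add: e_def f_def)
  have he: "h * e = - e" "h * f = - f" "2 * e = - e" "2 * f = - f" "e * h = - e" "f * h = - f"
      "e * 2 = - e" "f * 2 = - f"
    using EE_half e f EE_two by (auto simp: h mult.commute)
  have R: "y4_2n \<delta> t u * v2_4 = v2_4 * y4_2 \<delta> t' u'"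
    unfolding y4_2_rows[OF \<delta>] y4_2n_rows[OF \<delta>] v2_4_rows ef e_def[symmetric] f_def[symmetric] tt
        h[symmetric]
    by (simp add: mat_eval he h2 t'_def u'_def mult.commute[of _ 2] mult.commute[of _ h])
  have "conj_by 5 v2_4 (y4_2 \<delta> t' u') = y4_2n \<delta> t u"
    by (rule n4.conj_by_E(1)[OF w4_E(2) R]) (simp add: y4_2n_rows[OF \<delta>])
  moreover have "n4.Rel \<delta> (transpose_mat (x4_2 \<theta> t u)) (conj_by 5 v2_4 (y4_2 \<delta> t' u'))"
    by (rule n4.Rel_conj[OF Rel4_w(2)[OF \<delta>] Rel4_2[OF \<delta> tu']])
      (simp_all add: x4_2_rows x4_2_transpose_rows v2_4_rows mat_eval theta_simps hx(2) h[symmetric]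
          h2 t'_def u'_def
        mult.commute[of _ 2] mult.commute[of _ h])
  ultimately show ?thesis by simp
qed

lemma Rel4_3:
  assumes \<delta>: "\<delta> \<in> \<E> \<theta>" and tu: "(t, u) \<in> \<A> \<theta>"
  shows "n4.Rel \<delta> (x4_3 \<theta> t u) (conj_by 5 w1_4 (y4_2 \<delta> t u))"
    "n4.Rel \<delta> (transpose_mat (x4_3 \<theta> t u)) (conj_by 5 w1_4 (y4_2n \<delta> t u))"
  by (rule n4.Rel_conj[OF Rel4_w(1)[OF \<delta>] Rel4_2[OF \<delta> tu]] n4.Rel_conj[OF Rel4_w(1)[OF \<delta>] Rel4_2n[OF
      \<delta> tu]];
      simp add: x4_2_rows x4_3_rows x4_2_transpose_rows x4_3_transpose_rows w1_4_rows mat_eval)+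

lemma Rel4_4:
  assumes \<delta>: "\<delta> \<in> \<E> \<theta>"
  shows "n4.Rel \<delta> (x4_4 \<theta> t) (conj_by 5 v2_4 (y4_1 \<delta> (2 * t)))"
    "n4.Rel \<delta> (transpose_mat (x4_4 \<theta> t)) (conj_by 5 v2_4 (y4_1n \<delta> (t * half)))"
proof -
  obtain h :: 'a where h: "h = half" by blast
  have hx: "2 * h = 1" "\<theta> h = h" using two_half theta_half by (simp_all add: h)
  have h2: "2 * (h * x) = x" "h * (2 * x) = x" for x
    using hx(1) by (simp_all add: mult.commute[of h 2] flip: mult.assoc)
  show "n4.Rel \<delta> (x4_4 \<theta> t) (conj_by 5 v2_4 (y4_1 \<delta> (2 * t)))"
    by (rule n4.Rel_conj[OF Rel4_w(2)[OF \<delta>] Rel4_1[OF \<delta>]])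
      (simp_all add: x4_1_rows x4_4_rows v2_4_rows mat_eval theta_simps h[symmetric] h2
        mult.commute[of _ 2] mult.commute[of _ h])
  show "n4.Rel \<delta> (transpose_mat (x4_4 \<theta> t)) (conj_by 5 v2_4 (y4_1n \<delta> (t * half)))"
    by (rule n4.Rel_conj[OF Rel4_w(2)[OF \<delta>] Rel4_1n[OF \<delta>]])
      (simp_all add: x4_1_transpose_rows x4_4_transpose_rows v2_4_rows mat_eval theta_simps
          h[symmetric] hx h2
        mult.commute[of _ 2] mult.commute[of _ h])
qed

lemma relation_family4:
  "relation_family (E_sc \<theta> 4) (\<E> \<theta>) n4.Rel (root_elements \<theta> 4) (prescription \<theta> 4)"
proof (rule n4.relation_familyI)
  fix \<delta> x assume \<delta>: "\<delta> \<in> \<E> \<theta>" and "x \<in> root_elements \<theta> 4"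
  then show "\<exists>y. n4.Rel \<delta> x y"
    using Rel4_1[OF \<delta>] Rel4_1n[OF \<delta>] Rel4_2[OF \<delta>] Rel4_2n[OF \<delta>] Rel4_3[OF \<delta>] Rel4_4[OF \<delta>]
    by (fastforce simp: root_elements_def positive_root_elements_def)
next
  fix \<delta> f assume \<delta>: "\<delta> \<in> \<E> \<theta>"
  have iff: "n4.Rel \<delta> x z \<longleftrightarrow> z = y" if "n4.Rel \<delta> x y" for x y z
    using that n4.Rel_unique by blast
  note iffs = iff[OF Rel4_1[OF \<delta>]] iff[OF Rel4_1n[OF \<delta>]] iff[OF Rel4_2[OF \<delta>]] iff[OF Rel4_2n[OF \<delta>]]
    iff[OF Rel4_3(1)[OF \<delta>]] iff[OF Rel4_3(2)[OF \<delta>]] iff[OF Rel4_4(1)[OF \<delta>]] iff[OF Rel4_4(2)[OF \<delta>]]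
  have "prescription \<theta> 4 \<delta> f \<longleftrightarrow>
      (\<forall>t. f (x4_1 \<theta> t) = y4_1 \<delta> t \<and> f (transpose_mat (x4_1 \<theta> t)) = y4_1n \<delta> t) \<and>
      (\<forall>(t, u) \<in> \<A> \<theta>. f (x4_2 \<theta> t u) = y4_2 \<delta> t u \<and> f (transpose_mat (x4_2 \<theta> t u)) = y4_2n \<delta> t u) \<and>
      (\<forall>(t, u) \<in> \<A> \<theta>. f (x4_3 \<theta> t u) = conj_by 5 w1_4 (f (x4_2 \<theta> t u)) \<and>
        f (transpose_mat (x4_3 \<theta> t u)) = conj_by 5 w1_4 (f (transpose_mat (x4_2 \<theta> t u)))) \<and>
      (\<forall>t. f (x4_4 \<theta> t) = conj_by 5 v2_4 (f (x4_1 \<theta> (2 * t))) \<and>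
        f (transpose_mat (x4_4 \<theta> t)) = conj_by 5 v2_4 (f (transpose_mat (x4_1 \<theta> (t * half)))))"
    by (simp add: prescription_def prescription4_def Let_def y4_1_def y4_1n_def y4_2_def y4_2n_def)
  also have "\<dots> \<longleftrightarrow>
      (\<forall>t. f (x4_1 \<theta> t) = y4_1 \<delta> t) \<and> (\<forall>t. f (transpose_mat (x4_1 \<theta> t)) = y4_1n \<delta> t) \<and>
      (\<forall>(t, u) \<in> \<A> \<theta>. f (x4_2 \<theta> t u) = y4_2 \<delta> t u) \<and>
      (\<forall>(t, u) \<in> \<A> \<theta>. f (transpose_mat (x4_2 \<theta> t u)) = y4_2n \<delta> t u) \<and>
      (\<forall>(t, u) \<in> \<A> \<theta>. f (x4_3 \<theta> t u) = conj_by 5 w1_4 (y4_2 \<delta> t u)) \<and>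
      (\<forall>(t, u) \<in> \<A> \<theta>. f (transpose_mat (x4_3 \<theta> t u)) = conj_by 5 w1_4 (y4_2n \<delta> t u)) \<and>
      (\<forall>t. f (x4_4 \<theta> t) = conj_by 5 v2_4 (y4_1 \<delta> (2 * t))) \<and>
      (\<forall>t. f (transpose_mat (x4_4 \<theta> t)) = conj_by 5 v2_4 (y4_1n \<delta> (t * half)))"
    by (intro iffI conjI; fastforce)
  also have "\<dots> \<longleftrightarrow>
      (\<forall>t. n4.Rel \<delta> (x4_1 \<theta> t) (f (x4_1 \<theta> t))) \<and>
      (\<forall>t. n4.Rel \<delta> (transpose_mat (x4_1 \<theta> t)) (f (transpose_mat (x4_1 \<theta> t)))) \<and>
      (\<forall>(t, u) \<in> \<A> \<theta>. n4.Rel \<delta> (x4_2 \<theta> t u) (f (x4_2 \<theta> t u))) \<and>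
      (\<forall>(t, u) \<in> \<A> \<theta>. n4.Rel \<delta> (transpose_mat (x4_2 \<theta> t u)) (f (transpose_mat (x4_2 \<theta> t u)))) \<and>
      (\<forall>(t, u) \<in> \<A> \<theta>. n4.Rel \<delta> (x4_3 \<theta> t u) (f (x4_3 \<theta> t u))) \<and>
      (\<forall>(t, u) \<in> \<A> \<theta>. n4.Rel \<delta> (transpose_mat (x4_3 \<theta> t u)) (f (transpose_mat (x4_3 \<theta> t u)))) \<and>
      (\<forall>t. n4.Rel \<delta> (x4_4 \<theta> t) (f (x4_4 \<theta> t))) \<and>
      (\<forall>t. n4.Rel \<delta> (transpose_mat (x4_4 \<theta> t)) (f (transpose_mat (x4_4 \<theta> t))))"
    by (intro arg_cong2[where f = "(\<and>)"] all_cong ball_cong refl; auto simp: iffs simp del: One_nat_def)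
  also have "\<dots> \<longleftrightarrow> (\<forall>x \<in> root_elements \<theta> 4. n4.Rel \<delta> x (f x))"
    by (auto simp: root_elements_def positive_root_elements_def ball_Un split_def simp del: One_nat_def)
  finally show "prescription \<theta> 4 \<delta> f \<longleftrightarrow> (\<forall>x \<in> root_elements \<theta> 4. n4.Rel \<delta> x (f x))" .
qed

end

section \<open>The isogeny types and the theorem\<close>

text \<open>The group axioms of a quotient type are transported from the elementary group along the
  projection, whose image is the whole carrier.\<close>

lemma group_image:
  assumes "group G" "pr \<in> hom G F" "carrier F = pr ` carrier G" "\<one>\<^bsub>F\<^esub> = pr \<one>\<^bsub>G\<^esub>"
  shows "group (F :: 'h monoid)"
proof -
  have "F\<lparr>carrier := pr ` carrier G, one := pr \<one>\<^bsub>G\<^esub>\<rparr> = F"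
    using assms(3,4) by simp
  then show ?thesis using group.hom_imp_img_group[OF assms(1,2)] by simp
qed

lemma Units_class_ring: "c \<in> Units class_ring \<longleftrightarrow> (c :: 'a::comm_ring_1) dvd 1"
  by (simp add: Units_def dvd_def) (metis mult.commute)

text \<open>Cosets of scalars are families indexed by units. In a product of two families the units
  multiply, and every unit is reached with second factor 1.\<close>

lemma units_image_mult:
  assumes "\<And>c d. op2 (f c) (g d) = h (c * d)"
  shows "(\<Union>x \<in> f ` Units class_ring. \<Union>y \<in> g ` Units class_ring. {op2 x y}) =
    h ` Units (class_ring :: 'a::comm_ring_1 ring)"
proof -
  show ?thesis
  proof (intro equalityI subsetI)
    fix z assume "z \<in> (\<Union>x \<in> f ` Units class_ring. \<Union>y \<in> g ` Units class_ring. {op2 x y})"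
    then obtain c d :: 'a where cd: "c dvd 1" "d dvd 1" "z = op2 (f c) (g d)"
      by (auto simp: Units_class_ring)
    then have "z = h (c * d)" "c * d dvd 1" using assms mult_dvd_mono[of c 1 d 1] by auto
    then show "z \<in> h ` Units (class_ring :: 'a ring)" by (auto simp: Units_class_ring)
  next
    fix z assume "z \<in> h ` Units (class_ring :: 'a ring)"
    then obtain c :: 'a where c: "c \<in> Units class_ring" "z = h c" by auto
    then have "z = op2 (f c) (g 1)" using assms[of c 1] by simp
    moreover have "(1::'a) \<in> Units class_ring" by (simp add: Units_class_ring)
    ultimately show "z \<in> (\<Union>x \<in> f ` Units class_ring. \<Union>y \<in> g ` Units class_ring. {op2 x y})"
      using c(1) by blast
  qed
qed

context involution_ring
begin

lemma scalar_in_centre: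
  assumes n: "n \<in> {3, 4}" and A: "A \<in> carrier (E_sc \<theta> n)" "A = c \<cdot>\<^sub>m 1\<^sub>m (n + 1)"
  shows "A \<in> centre (E_sc \<theta> n)"
proof -
  have "A * B = B * A" if "B \<in> carrier (E_sc \<theta> n)" for B
    using E_carrier[OF n that] by (simp add: A(2) mat_smult)
  then show ?thesis using A(1) by (simp add: centre_def)
qed

lemma proj_ad_eq:
  assumes "A \<in> carrier_mat (n + 1) (n + 1)"
  shows "proj_ad n A = (\<lambda>c. c \<cdot>\<^sub>m A) ` Units class_ring"
  using assms by (auto simp: proj_ad_def r_coset_def scalars_ad_def mat_smult)

lemma proj_mid_eq:
  assumes "A \<in> carrier_mat 4 4"
  shows "proj_mid A = (\<lambda>c. (c \<cdot>\<^sub>m A, c\<^sup>2)) ` Units class_ring"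
  using assms
  by (auto simp: proj_mid_def r_coset_def scalars_mid_def mat_smult cover_mid_def DirProd_def
      units_of_mult)

lemma smult_mult_smult:
  "A \<in> carrier_mat m m \<Longrightarrow> B \<in> carrier_mat m m \<Longrightarrow>
    (c \<cdot>\<^sub>m A) * (d \<cdot>\<^sub>m B) = (c * d) \<cdot>\<^sub>m (A * B :: 'a mat)"
  by (simp add: mat_smult smult_smult_mat mult.commute)

lemma E_ad_hom:
  assumes n: "n \<in> {3, 4}"
  shows "proj_ad n \<in> hom (E_sc \<theta> n) (E_ad \<theta> n)"
proof (rule homI)
  fix A B assume AB: "A \<in> carrier (E_sc \<theta> n)" "B \<in> carrier (E_sc \<theta> n)"
  note c = E_carrier[OF n AB(1)] E_carrier[OF n AB(2)]
  have "proj_ad n A <#>\<^bsub>GL (n + 1)\<^esub> proj_ad n B = proj_ad n (A * B)"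
    unfolding set_mult_def proj_ad_eq[OF c(1)] proj_ad_eq[OF c(2)] proj_ad_eq[OF mult_carrier_mat[OF c]]
    by (rule units_image_mult) (simp add: smult_mult_smult[OF c])
  then show "proj_ad n (A \<otimes>\<^bsub>E_sc \<theta> n\<^esub> B) = proj_ad n A \<otimes>\<^bsub>E_ad \<theta> n\<^esub> proj_ad n B"
    by (simp add: E_ad_def G_ad_def G_ad_A_def)
qed (simp add: E_ad_def)

lemma E_mid_hom: "proj_mid \<in> hom (E_sc \<theta> 3) (E_mid \<theta>)"
proof (rule homI)
  fix A B assume AB: "A \<in> carrier (E_sc \<theta> 3)" "B \<in> carrier (E_sc \<theta> 3)"
  have c: "A \<in> carrier_mat 4 4" "B \<in> carrier_mat 4 4"
      using E_carrier[OF _ AB(1)] E_carrier[OF _ AB(2)] by simp_all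
  have "proj_mid A <#>\<^bsub>cover_mid\<^esub> proj_mid B = proj_mid (A * B)"
    unfolding set_mult_def proj_mid_eq[OF c(1)] proj_mid_eq[OF c(2)] proj_mid_eq[OF
        mult_carrier_mat[OF c]]
    by (rule units_image_mult)
      (simp add: smult_mult_smult[OF c] cover_mid_def DirProd_def units_of_mult power_mult_distrib)
  then show "proj_mid (A \<otimes>\<^bsub>E_sc \<theta> 3\<^esub> B) = proj_mid A \<otimes>\<^bsub>E_mid \<theta>\<^esub> proj_mid B"
    by (simp add: E_mid_def G_mid_def G_mid_A_def)
qed (simp add: E_mid_def)

text \<open>An element lies in its own coset as its multiple by 1, so a trivial coset consists of
  scalar matrices including the element itself, which is then central.\<close>

lemma E_ad_facts:
  assumes n: "n \<in> {3, 4}"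
  shows "group (E_ad \<theta> n)" "carrier (E_ad \<theta> n) = proj_ad n ` carrier (E_sc \<theta> n)"
    "\<And>A. A \<in> carrier (E_sc \<theta> n) \<Longrightarrow> proj_ad n A = \<one>\<^bsub>E_ad \<theta> n\<^esub> \<Longrightarrow> A \<in> centre (E_sc \<theta> n)"
proof -
  have one: "\<one>\<^bsub>E_ad \<theta> n\<^esub> = scalars_ad (n + 1)"
    by (simp add: E_ad_def G_ad_def G_ad_A_def)
  show carr: "carrier (E_ad \<theta> n) = proj_ad n ` carrier (E_sc \<theta> n)" by (simp add: E_ad_def)
  have "proj_ad n (1\<^sub>m (n + 1) :: 'a mat) = scalars_ad (n + 1)"
    by (subst proj_ad_eq) (simp_all add: scalars_ad_def)
  then show "group (E_ad \<theta> n)"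
    by (intro group_image[OF group_E[OF n] E_ad_hom[OF n] carr]) (simp add: one)
  fix A assume A: "A \<in> carrier (E_sc \<theta> n)" "proj_ad n A = \<one>\<^bsub>E_ad \<theta> n\<^esub>"
  have "1 \<cdot>\<^sub>m A \<in> proj_ad n A"
    unfolding proj_ad_eq[OF E_carrier[OF n A(1)]] by (rule imageI) (simp add: Units_class_ring)
  then obtain c where "A = c \<cdot>\<^sub>m 1\<^sub>m (n + 1)"
    unfolding A(2) one by (auto simp: scalars_ad_def one_smult_mat)
  then show "A \<in> centre (E_sc \<theta> n)" by (rule scalar_in_centre[OF n A(1)])
qed

lemma E_mid_facts:
  shows "group (E_mid \<theta>)" "carrier (E_mid \<theta>) = proj_mid ` carrier (E_sc \<theta> 3)"
    "\<And>A. A \<in> carrier (E_sc \<theta> 3) \<Longrightarrow> proj_mid A = \<one>\<^bsub>E_mid \<theta>\<^esub> \<Longrightarrow> A \<in> centre (E_sc \<theta> 3)"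
proof -
  have n: "(3::nat) \<in> {3, 4}" by simp
  have one: "\<one>\<^bsub>E_mid \<theta>\<^esub> = scalars_mid"
    by (simp add: E_mid_def G_mid_def G_mid_A_def)
  show carr: "carrier (E_mid \<theta>) = proj_mid ` carrier (E_sc \<theta> 3)" by (simp add: E_mid_def)
  have "proj_mid (1\<^sub>m 4 :: 'a mat) = scalars_mid"
    by (subst proj_mid_eq) (simp_all add: scalars_mid_def)
  then show "group (E_mid \<theta>)"
    by (intro group_image[OF group_E[OF n] E_mid_hom carr]) (simp add: one)
  fix A assume A: "A \<in> carrier (E_sc \<theta> 3)" "proj_mid A = \<one>\<^bsub>E_mid \<theta>\<^esub>"
  have c: "A \<in> carrier_mat 4 4" using E_carrier[OF n A(1)] by simp
  have "(1 \<cdot>\<^sub>m A, 1\<^sup>2) \<in> proj_mid A"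
    unfolding proj_mid_eq[OF c] by (rule imageI) (simp add: Units_class_ring)
  then obtain c where "A = c \<cdot>\<^sub>m 1\<^sub>m (3 + 1)"
    unfolding A(2) one by (auto simp: scalars_mid_def one_smult_mat)
  then show "A \<in> centre (E_sc \<theta> 3)" by (rule scalar_in_centre[OF n A(1)])
qed

lemma relation_family_ex:
  assumes "n \<in> {3, 4}"
  shows "\<exists>Rel. relation_family (E_sc \<theta> n) (\<E> \<theta>) Rel (root_elements \<theta> n) (prescription \<theta> n)"
  using assms relation_family3 relation_family4 by blast

end

text \<open>\<open>Theta\<close> is a definite description that is identified with the constructed
  family only on \<E>; closure of \<open>D\<close> keeps sums and negatives in that range.\<close>

lemma additive_family_cong:
  assumes "additive_family F D T" "\<And>\<delta>. \<delta> \<in> D \<Longrightarrow> T \<delta> = T' \<delta>"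
    and "0 \<in> D" "\<And>\<delta>. \<delta> \<in> D \<Longrightarrow> - \<delta> \<in> D" "\<And>\<delta> \<epsilon>. \<delta> \<in> D \<Longrightarrow> \<epsilon> \<in> D \<Longrightarrow> \<delta> + \<epsilon> \<in> D"
  shows "additive_family F D T'"
  using assms unfolding additive_family_def by metis

theorem proposition3p7:
  fixes \<theta> :: "'a::comm_ring_1 \<Rightarrow> 'a" and n :: nat
  assumes local_ring: "\<exists>!M. maximalideal M (class_ring :: 'a ring)"
    and two_unit: "(2::'a) \<in> Units class_ring"
    and automorphism: "\<theta> \<in> ring_iso class_ring class_ring"
    and involution: "\<theta> \<circ> \<theta> = id"
    and nontrivial: "\<theta> \<noteq> id"
    and n: "n \<in> {3, 4}"
  shows
    "(\<forall>\<delta> \<in> \<E> \<theta>. (\<exists>!f. f \<in> auto (E_sc \<theta> n) \<and> prescription \<theta> n \<delta> f) \<and>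
        (\<forall>z \<in> centre (E_sc \<theta> n). Theta \<theta> n \<delta> z = z)) \<and>
     (\<forall>\<delta> \<in> \<E> \<theta>.
        (\<exists>!g. descends_to (E_sc \<theta> n) (E_sc \<theta> n) id (Theta \<theta> n \<delta>) g) \<and>
        (n = 3 \<longrightarrow> (\<exists>!g. descends_to (E_sc \<theta> n) (E_mid \<theta>) proj_mid (Theta \<theta> n \<delta>) g)) \<and>
        (\<exists>!g. descends_to (E_sc \<theta> n) (E_ad \<theta> n) (proj_ad n) (Theta \<theta> n \<delta>) g)) \<and>
     additive_family (E_sc \<theta> n) (\<E> \<theta>) (Theta \<theta> n) \<and>
     additive_family (E_sc \<theta> n) (\<E> \<theta>)
       (\<lambda>\<delta>. induced (E_sc \<theta> n) (E_sc \<theta> n) id (Theta \<theta> n \<delta>)) \<and>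
     (n = 3 \<longrightarrow> additive_family (E_mid \<theta>) (\<E> \<theta>)
       (\<lambda>\<delta>. induced (E_sc \<theta> n) (E_mid \<theta>) proj_mid (Theta \<theta> n \<delta>))) \<and>
     additive_family (E_ad \<theta> n) (\<E> \<theta>)
       (\<lambda>\<delta>. induced (E_sc \<theta> n) (E_ad \<theta> n) (proj_ad n) (Theta \<theta> n \<delta>))"
proof -
  interpret involution_ring \<theta>
    by unfold_locales (fact local_ring two_unit automorphism involution)+
  obtain Rel where "relation_family (E_sc \<theta> n) (\<E> \<theta>) Rel (root_elements \<theta> n) (prescription \<theta> n)"
    using relation_family_ex[OF n] by blast
  then interpret R: relation_family "E_sc \<theta> n" "\<E> \<theta>" Rel "root_elements \<theta> n" "prescription \<theta> n" .
  have T: "Theta \<theta> n \<delta> = R.T \<delta>" if "\<delta> \<in> \<E> \<theta>" for \<delta>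
    using R.the_auto_pres[OF that] by (simp add: Theta_def)
  note D = R.D_zero R.D_uminus R.D_add
  \<comment> \<open>The simply connected type is treated as a quotient by the identity map with
    trivial kernel, so that all isogeny types pass through the same rules.\<close>
  have id_hom: "id \<in> hom (E_sc \<theta> n) (E_sc \<theta> n)" by (simp add: hom_def)
  have id_ker: "x \<in> centre (E_sc \<theta> n)" if "x \<in> carrier (E_sc \<theta> n)" "id x = \<one>\<^bsub>E_sc \<theta> n\<^esub>" for x
    using that group.is_monoid[OF R.group_E] by (simp add: centre_def monoid.l_one monoid.r_one del: E_simps)
  have id_im: "carrier (E_sc \<theta> n) = id ` carrier (E_sc \<theta> n)" by simp
  note sc = R.group_E id_hom id_im id_ker
  note ad = E_ad_facts(1)[OF n] E_ad_hom[OF n] E_ad_facts(2,3)[OF n]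
  have mid: "group (E_mid \<theta>)" "proj_mid \<in> hom (E_sc \<theta> n) (E_mid \<theta>)"
    "carrier (E_mid \<theta>) = proj_mid ` carrier (E_sc \<theta> n)"
    "\<And>x. x \<in> carrier (E_sc \<theta> n) \<Longrightarrow> proj_mid x = \<one>\<^bsub>E_mid \<theta>\<^esub> \<Longrightarrow> x \<in> centre (E_sc \<theta> n)" if "n = 3"
    using E_mid_facts E_mid_hom that by auto
  show ?thesis
  proof (intro conjI ballI impI)
    fix \<delta> assume \<delta>: "\<delta> \<in> \<E> \<theta>"
    show "\<exists>!f. f \<in> auto (E_sc \<theta> n) \<and> prescription \<theta> n \<delta> f" by (rule R.ex1_auto_pres[OF \<delta>])
    show "Theta \<theta> n \<delta> z = z" if "z \<in> centre (E_sc \<theta> n)" for z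
      unfolding T[OF \<delta>] by (rule R.T_centre[OF \<delta> that])
    show "\<exists>!g. descends_to (E_sc \<theta> n) (E_sc \<theta> n) id (Theta \<theta> n \<delta>) g"
      unfolding T[OF \<delta>] by (rule R.ex1_descends_T[OF sc \<delta>])
    show "\<exists>!g. descends_to (E_sc \<theta> n) (E_mid \<theta>) proj_mid (Theta \<theta> n \<delta>) g" if "n = 3"
      unfolding T[OF \<delta>] by (rule R.ex1_descends_T[OF mid[OF that] \<delta>])
    show "\<exists>!g. descends_to (E_sc \<theta> n) (E_ad \<theta> n) (proj_ad n) (Theta \<theta> n \<delta>) g"
      unfolding T[OF \<delta>] by (rule R.ex1_descends_T[OF ad \<delta>])
  next
    show "additive_family (E_sc \<theta> n) (\<E> \<theta>) (Theta \<theta> n)"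
      by (rule additive_family_cong[OF R.additive_family_T _ D]) (simp_all add: T)
    show "additive_family (E_sc \<theta> n) (\<E> \<theta>) (\<lambda>\<delta>. induced (E_sc \<theta> n) (E_sc \<theta> n) id (Theta \<theta> n \<delta>))"
      by (rule additive_family_cong[OF R.additive_family_induced[OF sc] _ D]) (simp_all add: T)
    show "additive_family (E_mid \<theta>) (\<E> \<theta>) (\<lambda>\<delta>. induced (E_sc \<theta> n) (E_mid \<theta>) proj_mid (Theta \<theta> n \<delta>))"
      if "n = 3" by (rule additive_family_cong[OF R.additive_family_induced[OF mid[OF that]] _ D]) (simp_all add: T)
    show "additive_family (E_ad \<theta> n) (\<E> \<theta>) (\<lambda>\<delta>. induced (E_sc \<theta> n) (E_ad \<theta> n) (proj_ad n) (Theta \<theta> n \<delta>))"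
      by (rule additive_family_cong[OF R.additive_family_induced[OF ad] _ D]) (simp_all add: T)
  qed
qed

end
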